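(* Let $\mathcal{T}$ be the labelled family of simply generated trees associated to a degree-weight sequence $(\varphi_\ell)_{\ell\ge 0}$ (nonnegative reals, $\varphi_0>0$). Assume that $\varphi(t)=\sum_{\ell\ge0}\varphi_\ell t^\ell$ has positive radius of convergence $R$ (possibly $R=\infty$) and that the equation $t\varphi'(t)=\varphi(t)$ has a minimal positive solution $\tau<R$. Put $\rho=\tau/\varphi(\tau)$, $d=\gcd\{\ell:\varphi_\ell>0\}$ and $c_\varphi=\frac{1}{\sqrt{8\rho\tau\varphi''(\tau)}}$. Let $I_n$ be the total number of inversions in a random tree of size $n$ of $\mathcal{T}$. Then, as $n\to\infty$ with $n\equiv 1 \pmod d$, $$\mathbb{E}(I_n)\sim c_\varphi\sqrt{\pi}\,n^{3/2}\qquad\text{and}\qquad \frac{I_n}{c_\varphi n^{3/2}}\xrightarrow{(d)} I,$$ where $I$ is an Airy distributed random variable.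
   Context: Trees are rooted ordered trees (the children of each node are linearly ordered) whose $|T|$ vertices are labelled with the distinct integers $1,\dots,|T|$ (all labellings allowed); $|T|$ is the number of vertices. The weight of $T$ is $w(T)=\prod_{v\in T}\varphi_{d(v)}$, where $d(v)$ is the number of children of $v$. The simply generated family $\mathcal{T}$ consists of all such trees together with their weights; $T_n=\sum_{|T|=n}w(T)$ is the total weight of trees of size $n$. A random tree of size $n$ (defined when $T_n>0$) is chosen with probability $w(T)/T_n$. An inversion in $T$ is a pair $(i,j)$ of vertices (identified with labels) such that $i>j$ and $i$ lies on the path from the root to $j$ (i.e. $i$ is an ancestor of $j$). The Airy distribution is the distribution, uniquely determined by its moments, of a random variable $I$ with $r$-th moments $\mathbb{E}(I^r)=\frac{2\sqrt{\pi}}{\Gamma(\frac{3r-1}{2})}C_r$ for $r\ge1$, where $C_1=\frac12$ and $2C_r=(3r-4)rC_{r-1}+\sum_{j=1}^{r-1}\binom{r}{j}C_jC_{r-j}$ for $r\ge2$. The symbol $\xrightarrow{(d)}$ denotes convergence in distribution. *)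

theory Defs
  imports "HOL-Probability.Probability" "HOL-Library.Landau_Symbols"
begin

datatype 'a otree = Node (root: 'a) (children: "'a otree list")

primrec labels :: "'a otree \<Rightarrow> 'a list" where
  "labels (Node a ts) = a # concat (map labels ts)"

primrec weight :: "(nat \<Rightarrow> real) \<Rightarrow> 'a otree \<Rightarrow> real" where
  "weight \<phi> (Node a ts) = \<phi> (length ts) * prod_list (map (weight \<phi>) ts)"

definition labelled_trees :: "nat \<Rightarrow> nat otree set" where
  "labelled_trees n =
     {T. length (labels T) = n \<and> distinct (labels T) \<and> set (labels T) = {1..n}}"

definition total_weight :: "(nat \<Rightarrow> real) \<Rightarrow> nat \<Rightarrow> real" where
  "total_weight \<phi> n = (\<Sum>T\<in>labelled_trees n. weight \<phi> T)"

text \<open>This is a probability measure exactly when \<open>total_weight \<phi> n > 0\<close>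
  (for nonnegative \<open>\<phi>\<close>); otherwise it is the null measure.\<close>

definition random_tree :: "(nat \<Rightarrow> real) \<Rightarrow> nat \<Rightarrow> nat otree measure" where
  "random_tree \<phi> n =
     point_measure (labelled_trees n) (\<lambda>T. ennreal (weight \<phi> T / total_weight \<phi> n))"

text \<open>\<open>root_path T p\<close>: the list \<open>p\<close> consists of the labels met on the path from the root of \<open>T\<close>
  down to some vertex, both ends included.\<close>

inductive root_path :: "'a otree \<Rightarrow> 'a list \<Rightarrow> bool" where
  "root_path (Node a ts) [a]"
| "t \<in> set ts \<Longrightarrow> root_path t p \<Longrightarrow> root_path (Node a ts) (a # p)"

definition inversions :: "nat otree \<Rightarrow> (nat \<times> nat) set" where
  "inversions T = {(i, j). i > j \<and> (\<exists>p. root_path T p \<and> last p = j \<and> i \<in> set p)}"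

definition weight_gf :: "(nat \<Rightarrow> real) \<Rightarrow> real \<Rightarrow> real" where
  "weight_gf \<phi> t = (\<Sum>l. \<phi> l * t ^ l)"

text \<open>The value at \<open>0\<close> is a dummy that is never used.\<close>

fun airy_C :: "nat \<Rightarrow> real" where
  "airy_C r =
     (if r = 0 then 0
      else if r = 1 then 1 / 2
      else ((3 * real r - 4) * real r * airy_C (r - 1)
            + (\<Sum>j\<in>{1..r-1}. real (r choose j) * airy_C j * airy_C (r - j))) / 2)"

declare airy_C.simps [simp del]

definition has_airy_moments :: "real measure \<Rightarrow> bool" where
  "has_airy_moments M \<longleftrightarrow>
     (\<forall>r\<ge>1. integrable M (\<lambda>x. x ^ r) \<and>
        (\<integral>x. x ^ r \<partial>M) = 2 * sqrt pi / Gamma ((3 * real r - 1) / 2) * airy_C r)"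

definition airy_distribution :: "real measure" where
  "airy_distribution = (THE M. real_distribution M \<and> has_airy_moments M)"

end

theory Submission
  imports Defs "HOL-Real_Asymp.Real_Asymp" "HOL-Computational_Algebra.Computational_Algebra"
begin

text \<open>
  Put \<open>p l = \<phi> l * \<tau> ^ l / \<phi>(\<tau>)\<close>.  All trees of the same size have their weights multiplied by the
  same factor, so the random tree does not change, and the equation \<open>\<tau> \<phi>'(\<tau>) = \<phi>(\<tau>)\<close> says that \<open>p\<close>
  is a probability distribution of mean \<open>1\<close>.  Its variance is \<open>v = \<rho> \<tau> \<phi>''(\<tau>)\<close>, so the
  scaling constant is \<open>1 / sqrt (8 * v)\<close>.

  In a uniformly labelled tree the rank of the root label is uniform, and given that rank the subtrees
  are again uniformly labelled.  Let \<open>F\<close> be the exponential generating function of the trees by size,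
  each tree carrying the coefficient \<open>w(T) exp (u inv(T))\<close>, a formal power series in \<open>u\<close>.  Then the
  coefficient of order \<open>n\<close> of \<open>F\<close> is the moment series of a uniform variable on \<open>{0..<n}\<close> times
  the coefficient of order \<open>n - 1\<close> of \<open>\<phi>(F)\<close> (\<open>tree_gf_recursion\<close>).  Only sizes \<open>k * d + 1\<close> occur;
  in terms of \<open>k\<close> the coefficients of powers of \<open>u\<close> are power series \<open>X_r\<close> with coefficients
  \<open>E(inv ^ r) / r!\<close> (up to normalisation), and comparing coefficients gives linear equations
  \<open>(1 - Psi_1) X_r = source_r\<close> in which the right-hand side involves lower moments only.  Lagrange
  inversion yields \<open>1 / (1 - Psi_1)\<close> explicitly: its coefficients are those of order \<open>k\<close> in
  \<open>psi ^ (d * k)\<close>, where \<open>psi\<close> generates the offspring distribution rescaled by \<open>d\<close>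
  (\<open>Psi_lag\<close>, \<open>mgf_eq_lag_source\<close>).

  These are point probabilities of a centred random walk at the origin, so a local limit theorem gives
  their asymptotics (\<open>local_limit\<close>).  Sequences asymptotic to \<open>A\<close> times the coefficients of
  \<open>(1 - x) ^ (-\<alpha>)\<close> are closed under convolution, the exponents adding and the constants multiplying
  (\<open>coeff_order_convolution\<close>); this replaces singularity analysis.  By induction \<open>X_r\<close> is of this kind
  with exponent \<open>(3 r - 1) / 2\<close>.  Of all terms in \<open>source_r\<close> just two have maximal order: the root
  taking part in one of the \<open>r\<close> marked inversions, and the remaining marks being split between
  two subtrees.  The constants therefore obey the recursion for \<open>C_r\<close> (\<open>mgf_order\<close>), and dividing by
  the asymptotics of the total weights gives convergence of all moments to the Airy moments
  (\<open>moment_limit\<close>); the first moment is the statement on the mean.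

  Finally, the Airy moments grow slowly enough to determine a distribution.  Convergence of moments
  makes the laws tight, every limit point has the Airy moments, and there is only one such limit
  (\<open>method_of_moments\<close>).  In particular this shows that the Airy distribution exists.
\<close>

unbundle no vec_syntax
unbundle fps_syntax

section \<open>Coefficients growing like those of a power of a geometric series\<close>

text \<open>
  The coefficient of \<open>x ^ n\<close> in \<open>(1 - x) powr (-\<alpha>)\<close>.
\<close>
definition bin_coeff :: "real \<Rightarrow> nat \<Rightarrow> real" where
  "bin_coeff \<alpha> n = pochhammer \<alpha> n / fact n"

text \<open>
  For \<open>\<alpha> > 0\<close> this says that \<open>a\<close> behaves like \<open>A * n powr (\<alpha> - 1) / Gamma \<alpha>\<close>.  Comparing with
  \<open>bin_coeff\<close> rather than with the power makes convolutions exact.  The value \<open>A = 0\<close> is allowed and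
  then means that \<open>a\<close> is of smaller order, so that negligible terms need no separate treatment.
\<close>
definition coeff_order :: "real \<Rightarrow> real \<Rightarrow> (nat \<Rightarrow> real) \<Rightarrow> bool" where
  "coeff_order \<alpha> A a \<longleftrightarrow> (\<lambda>n. a n / bin_coeff \<alpha> n) \<longlonglongrightarrow> A"

lemma bin_coeff_pos: "\<alpha> > 0 \<Longrightarrow> bin_coeff \<alpha> n > 0"
  by (simp add: bin_coeff_def pochhammer_pos)

lemma bin_coeff_Suc: "bin_coeff \<alpha> (Suc n) = bin_coeff \<alpha> n * ((\<alpha> + real n) / real (Suc n))"
  by (simp add: bin_coeff_def pochhammer_rec' field_simps)

lemma bin_coeff_add_one: "\<alpha> > 0 \<Longrightarrow> bin_coeff (\<alpha> + 1) n = bin_coeff \<alpha> n * ((\<alpha> + real n) / \<alpha>)"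
proof -
  assume a: "\<alpha> > 0"
  have "\<alpha> * pochhammer (\<alpha> + 1) n = pochhammer \<alpha> (Suc n)"
    by (simp add: pochhammer_rec)
  also have "\<dots> = (\<alpha> + real n) * pochhammer \<alpha> n"
    by (simp add: pochhammer_rec')
  finally show ?thesis using a by (simp add: bin_coeff_def field_simps)
qed

text \<open>
  Vandermonde's identity, that is, \<open>(1 - x) powr (-\<alpha>) * (1 - x) powr (-\<beta>) = (1 - x) powr (-\<alpha> - \<beta>)\<close>.
\<close>
lemma bin_coeff_convolution:
  "(\<Sum>i\<le>n. bin_coeff \<alpha> i * bin_coeff \<beta> (n - i)) = bin_coeff (\<alpha> + \<beta>) n"
proof -
  have *: "bin_coeff x k = (- 1) ^ k * (- x gchoose k)" for x :: real and k
    unfolding bin_coeff_def by (subst gbinomial_pochhammer) (simp add: power_mult_distrib [symmetric])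
  have "(\<Sum>i\<le>n. bin_coeff \<alpha> i * bin_coeff \<beta> (n - i)) =
        (- 1) ^ n * (\<Sum>k=0..n. (- \<alpha> gchoose k) * (- \<beta> gchoose (n - k)))"
    unfolding * sum_distrib_left atLeast0AtMost
    by (intro sum.cong refl) (auto simp: mult_ac simp flip: power_add)
  also have "\<dots> = bin_coeff (\<alpha> + \<beta>) n"
    by (subst gbinomial_Vandermonde) (simp add: *)
  finally show ?thesis .
qed

text \<open>
  A form of Euler's limit formula for the Gamma function.
\<close>
lemma bin_coeff_asymp:
  assumes "\<alpha> > 0"
  shows "(\<lambda>n. bin_coeff \<alpha> n / real n powr (\<alpha> - 1)) \<longlonglongrightarrow> 1 / Gamma \<alpha>"
proof -
  have "rGamma_series \<alpha> \<longlonglongrightarrow> rGamma \<alpha>" by (rule rGamma_series_LIMSEQ)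
  moreover have "(\<lambda>n. real n / (\<alpha> + real n)) \<longlonglongrightarrow> 1"
    by real_asymp
  ultimately have "(\<lambda>n. rGamma_series \<alpha> n * (real n / (\<alpha> + real n))) \<longlonglongrightarrow> rGamma \<alpha> * 1"
    by (rule tendsto_mult)
  moreover have "eventually (\<lambda>n. rGamma_series \<alpha> n * (real n / (\<alpha> + real n)) =
      bin_coeff \<alpha> n / real n powr (\<alpha> - 1)) sequentially"
    using eventually_gt_at_top[of 0]
  proof eventually_elim
    case (elim n)
    have "\<alpha> + real n > 0" using assms by simp
    moreover have "real n powr (\<alpha> - 1) = exp (\<alpha> * ln (real n)) / real n"
      using elim by (simp add: powr_def left_diff_distrib exp_diff)
    ultimately show ?case using elim
      by (simp add: rGamma_series_def bin_coeff_def pochhammer_rec')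
  qed
  ultimately show ?thesis
    using Lim_transform_eventually rGamma_inverse_Gamma[of \<alpha>] by (force simp: field_simps)
qed

lemma bin_coeff_ratio_limit:
  assumes "0 < \<alpha>" "\<alpha> < \<beta>"
  shows "(\<lambda>n. bin_coeff \<alpha> n / bin_coeff \<beta> n) \<longlonglongrightarrow> 0"
proof -
  have "(\<lambda>n. (bin_coeff \<alpha> n / real n powr (\<alpha> - 1)) / (bin_coeff \<beta> n / real n powr (\<beta> - 1))
           * real n powr (\<alpha> - \<beta>)) \<longlonglongrightarrow> (1 / Gamma \<alpha>) / (1 / Gamma \<beta>) * 0"
    using assms Gamma_real_pos[of \<beta>, THEN less_imp_neq]
    by (intro tendsto_mult tendsto_divide[OF bin_coeff_asymp bin_coeff_asymp] tendsto_neg_powr filterlim_real_sequentially) auto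
  moreover have "eventually (\<lambda>n. (bin_coeff \<alpha> n / real n powr (\<alpha> - 1)) / (bin_coeff \<beta> n / real n powr (\<beta> - 1))
           * real n powr (\<alpha> - \<beta>) = bin_coeff \<alpha> n / bin_coeff \<beta> n) sequentially"
    using eventually_gt_at_top[of 0]
    by eventually_elim (simp add: powr_diff field_simps)
  ultimately show ?thesis using Lim_transform_eventually by force
qed

lemma bin_coeff_shift_limit:
  assumes "0 < \<alpha>"
  shows "(\<lambda>n. bin_coeff \<alpha> (n - i) / bin_coeff \<alpha> n) \<longlonglongrightarrow> 1"
proof (induction i)
  case 0
  then show ?case using bin_coeff_pos[OF assms] by (simp add: less_imp_neq[symmetric] field_simps)
next
  case (Suc i)
  have "(\<lambda>n. real (Suc n) / (\<alpha> + real n)) \<longlonglongrightarrow> 1" by real_asymp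
  then have "(\<lambda>n. real (Suc (n - Suc i)) / (\<alpha> + real (n - Suc i))) \<longlonglongrightarrow> 1"
    by (rule filterlim_compose) (rule filterlim_minus_const_nat_at_top)
  from tendsto_mult[OF this Suc]
  have "(\<lambda>n. real (Suc (n - Suc i)) / (\<alpha> + real (n - Suc i)) * (bin_coeff \<alpha> (n - i) / bin_coeff \<alpha> n)) \<longlonglongrightarrow> 1"
    by simp
  moreover have "eventually (\<lambda>n. real (Suc (n - Suc i)) / (\<alpha> + real (n - Suc i)) * (bin_coeff \<alpha> (n - i) / bin_coeff \<alpha> n)
      = bin_coeff \<alpha> (n - Suc i) / bin_coeff \<alpha> n) sequentially"
    using eventually_gt_at_top[of i]
  proof eventually_elim
    case (elim n)
    then have *: "n - i = Suc (n - Suc i)" by simp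
    have "\<alpha> + real (n - Suc i) > 0" using assms by simp
    then show ?case unfolding * bin_coeff_Suc by simp
  qed
  ultimately show ?case using Lim_transform_eventually by force
qed

lemma coeff_order_add: "coeff_order \<alpha> A a \<Longrightarrow> coeff_order \<alpha> B b \<Longrightarrow> coeff_order \<alpha> (A + B) (\<lambda>n. a n + b n)"
  unfolding coeff_order_def by (drule (1) tendsto_add) (simp add: add_divide_distrib)

lemma coeff_order_cmult: "coeff_order \<alpha> A a \<Longrightarrow> coeff_order \<alpha> (c * A) (\<lambda>n. c * a n)"
  unfolding coeff_order_def by (drule tendsto_mult_left[of _ A sequentially c]) simp

lemma coeff_order_zero: "coeff_order \<alpha> 0 (\<lambda>n. 0)"
  by (simp add: coeff_order_def)

lemma coeff_order_sum:
  "(\<And>i. i \<in> I \<Longrightarrow> coeff_order \<alpha> (A i) (a i)) \<Longrightarrow> coeff_order \<alpha> (\<Sum>i\<in>I. A i) (\<lambda>n. \<Sum>i\<in>I. a i n)"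
  by (induction I rule: infinite_finite_induct) (auto intro: coeff_order_add coeff_order_zero)

lemma coeff_order_bounded:
  assumes "coeff_order \<alpha> A a" "\<alpha> > 0"
  obtains K where "K > 0" "\<And>n. \<bar>a n\<bar> \<le> K * bin_coeff \<alpha> n"
proof -
  have "Bseq (\<lambda>n. a n / bin_coeff \<alpha> n)"
    using assms(1) unfolding coeff_order_def by (intro convergent_imp_Bseq convergentI)
  then obtain K where K: "K > 0" "\<And>n. norm (a n / bin_coeff \<alpha> n) \<le> K"
    by (meson Bseq_def)
  then have "\<bar>a n\<bar> \<le> K * bin_coeff \<alpha> n" for n
    using K(2)[of n] bin_coeff_pos[OF assms(2), of n] by (simp add: abs_divide field_simps)
  with K(1) that show thesis by blast
qed

lemma coeff_order_lower:
  assumes "coeff_order \<alpha> A a" "0 < \<alpha>" "\<alpha> < \<beta>"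
  shows "coeff_order \<beta> 0 a"
proof -
  have "(\<lambda>n. a n / bin_coeff \<alpha> n * (bin_coeff \<alpha> n / bin_coeff \<beta> n)) \<longlonglongrightarrow> A * 0"
    using assms bin_coeff_ratio_limit[OF assms(2,3)] unfolding coeff_order_def by (intro tendsto_mult)
  moreover have "a n / bin_coeff \<alpha> n * (bin_coeff \<alpha> n / bin_coeff \<beta> n) = a n / bin_coeff \<beta> n" for n
    using bin_coeff_pos[OF assms(2), of n] by simp
  ultimately show ?thesis unfolding coeff_order_def by (simp only: mult_zero_right)
qed

lemma coeff_order_dominated:
  assumes "coeff_order \<alpha> 0 b" "0 < \<alpha>" "\<And>n. \<bar>a n\<bar> \<le> K * \<bar>b n\<bar>"
  shows "coeff_order \<alpha> 0 a"
proof -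
  have "(\<lambda>n. K * \<bar>b n / bin_coeff \<alpha> n\<bar>) \<longlonglongrightarrow> K * \<bar>0\<bar>"
    using assms(1) unfolding coeff_order_def by (intro tendsto_mult_left tendsto_rabs)
  then have "(\<lambda>n. K * \<bar>b n / bin_coeff \<alpha> n\<bar>) \<longlonglongrightarrow> 0" by simp
  then show ?thesis unfolding coeff_order_def
    by (rule Lim_null_comparison[rotated])
       (use assms(2,3) bin_coeff_pos[OF assms(2)] in \<open>auto simp: abs_divide field_simps intro!: always_eventually divide_right_mono\<close>)
qed

text \<open>
  Multiplication by the index corresponds to \<open>x * d/dx\<close>, which raises the exponent by one.
\<close>
lemma coeff_order_times_index:
  assumes "coeff_order \<alpha> A a" "\<alpha> > 0"
  shows "coeff_order (\<alpha> + 1) (\<alpha> * A) (\<lambda>n. real n * a n)"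
proof -
  have "(\<lambda>n. \<alpha> * real n / (\<alpha> + real n)) \<longlonglongrightarrow> \<alpha>" by real_asymp
  from tendsto_mult[OF this assms(1)[unfolded coeff_order_def]]
  have "(\<lambda>n. \<alpha> * real n / (\<alpha> + real n) * (a n / bin_coeff \<alpha> n)) \<longlonglongrightarrow> \<alpha> * A" .
  moreover have "\<alpha> * real n / (\<alpha> + real n) * (a n / bin_coeff \<alpha> n) = real n * a n / bin_coeff (\<alpha> + 1) n" for n
    unfolding bin_coeff_add_one[OF assms(2)] using assms(2) by (simp add: mult_ac)
  ultimately show ?thesis unfolding coeff_order_def by simp
qed

lemma convolution_commute:
  fixes a b :: "nat \<Rightarrow> real"
  shows "(\<Sum>i\<le>n. a i * b (n - i)) = (\<Sum>i\<le>n. b i * a (n - i))"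
  by (rule sum.reindex_bij_witness[of _ "\<lambda>i. n - i" "\<lambda>i. n - i"]) auto

text \<open>
  The terms with large \<open>i\<close> are controlled by the exact convolution of the two model sequences; each of
  the finitely many remaining terms is of order \<open>\<beta>\<close> only.
\<close>
lemma convolution_bin_coeff_small:
  assumes "0 < \<alpha>" "0 < \<beta>" and a: "coeff_order \<alpha> 0 a" and b: "coeff_order \<beta> B b"
  shows "coeff_order (\<alpha> + \<beta>) 0 (\<lambda>n. \<Sum>i\<le>n. a i * b (n - i))"
proof -
  obtain K where K: "K > 0" "\<And>n. \<bar>b n\<bar> \<le> K * bin_coeff \<beta> n"
    using coeff_order_bounded[OF b \<open>0 < \<beta>\<close>] by metis
  have pa: "bin_coeff \<alpha> n > 0" and pb: "bin_coeff \<beta> n > 0" and pab: "bin_coeff (\<alpha> + \<beta>) n > 0" for n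
    using assms by (auto intro: bin_coeff_pos)
  show ?thesis unfolding coeff_order_def
  proof (rule LIMSEQ_I)
    fix r :: real assume "r > 0"
    \<comment> \<open>with this tolerance the tail contributes at most \<open>r / 2\<close>, leaving \<open>r / 2\<close> for the head\<close>
    define e where "e = r / (2 * K)"
    have "e > 0" using \<open>r > 0\<close> K by (simp add: e_def)
    from LIMSEQ_D[OF a[unfolded coeff_order_def] this] obtain N where
      "\<And>n. n \<ge> N \<Longrightarrow> \<bar>a n / bin_coeff \<alpha> n\<bar> < e"
      by auto
    then have N: "\<And>n. n \<ge> N \<Longrightarrow> \<bar>a n\<bar> \<le> e * bin_coeff \<alpha> n"
      using pa by (simp add: abs_divide abs_of_pos pos_divide_less_eq less_imp_le)
    have "(\<lambda>n. \<Sum>i<N. \<bar>a i\<bar> * K * (bin_coeff \<beta> (n - i) / bin_coeff \<beta> n) * (bin_coeff \<beta> n / bin_coeff (\<alpha> + \<beta>) n))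
        \<longlonglongrightarrow> (\<Sum>i<N. \<bar>a i\<bar> * K * 1 * 0)"
      using assms by (intro tendsto_intros bin_coeff_shift_limit bin_coeff_ratio_limit) auto
    then have "(\<lambda>n. \<Sum>i<N. \<bar>a i\<bar> * K * (bin_coeff \<beta> (n - i) / bin_coeff \<beta> n) * (bin_coeff \<beta> n / bin_coeff (\<alpha> + \<beta>) n))
        \<longlonglongrightarrow> 0" by simp
    moreover have "r / 2 > 0" using \<open>r > 0\<close> by simp
    ultimately have "eventually (\<lambda>n. (\<Sum>i<N. \<bar>a i\<bar> * K * (bin_coeff \<beta> (n - i) / bin_coeff \<beta> n) *
        (bin_coeff \<beta> n / bin_coeff (\<alpha> + \<beta>) n)) < r / 2) sequentially"
      by (rule order_tendstoD)
    then obtain M where M: "\<And>n. n \<ge> M \<Longrightarrow> (\<Sum>i<N. \<bar>a i\<bar> * K * (bin_coeff \<beta> (n - i) / bin_coeff \<beta> n) *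
        (bin_coeff \<beta> n / bin_coeff (\<alpha> + \<beta>) n)) < r / 2"
      by (auto simp: eventually_sequentially)
    show "\<exists>no. \<forall>n\<ge>no. norm ((\<Sum>i\<le>n. a i * b (n - i)) / bin_coeff (\<alpha> + \<beta>) n - 0) < r"
    proof (intro exI allI impI)
      fix n assume n: "n \<ge> max M N"
      have "\<bar>\<Sum>i\<le>n. a i * b (n - i)\<bar> \<le> (\<Sum>i\<le>n. \<bar>a i\<bar> * \<bar>b (n - i)\<bar>)"
        by (rule order_trans[OF sum_abs]) (simp add: abs_mult)
      also have "\<dots> \<le> (\<Sum>i\<le>n. (e * K) * (bin_coeff \<alpha> i * bin_coeff \<beta> (n - i)) +
                          (if i < N then \<bar>a i\<bar> * K * bin_coeff \<beta> (n - i) else 0))"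
      proof (rule sum_mono)
        fix i
        have "\<bar>a i\<bar> * \<bar>b (n - i)\<bar> \<le> \<bar>a i\<bar> * (K * bin_coeff \<beta> (n - i))"
          by (intro mult_left_mono K) auto
        moreover have "\<bar>a i\<bar> * (K * bin_coeff \<beta> (n - i)) \<le> e * bin_coeff \<alpha> i * (K * bin_coeff \<beta> (n - i))" if "\<not> i < N"
          using that N[of i] K(1) pb[of "n - i"] by (intro mult_right_mono) auto
        moreover have "0 \<le> e * K * (bin_coeff \<alpha> i * bin_coeff \<beta> (n - i))"
          using \<open>e > 0\<close> K pa[of i] pb[of "n-i"] by simp
        ultimately show "\<bar>a i\<bar> * \<bar>b (n - i)\<bar> \<le> (e * K) * (bin_coeff \<alpha> i * bin_coeff \<beta> (n - i)) +
                          (if i < N then \<bar>a i\<bar> * K * bin_coeff \<beta> (n - i) else 0)"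
          by (auto simp: mult_ac)
      qed
      also have "\<dots> = e * K * bin_coeff (\<alpha> + \<beta>) n + (\<Sum>i\<le>n. if i < N then \<bar>a i\<bar> * K * bin_coeff \<beta> (n - i) else 0)"
        unfolding sum.distrib sum_distrib_left[symmetric] bin_coeff_convolution ..
      also have "(\<Sum>i\<le>n. if i < N then \<bar>a i\<bar> * K * bin_coeff \<beta> (n - i) else 0) =
                 (\<Sum>i<N. \<bar>a i\<bar> * K * bin_coeff \<beta> (n - i))"
        using n by (intro sum.mono_neutral_cong_right) auto
      also have "\<dots> = (\<Sum>i<N. \<bar>a i\<bar> * K * (bin_coeff \<beta> (n - i) / bin_coeff \<beta> n) *
        (bin_coeff \<beta> n / bin_coeff (\<alpha> + \<beta>) n)) * bin_coeff (\<alpha> + \<beta>) n"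
        unfolding sum_distrib_right using pb[of n] pab[of n] by (intro sum.cong) auto
      also have "e * K * bin_coeff (\<alpha> + \<beta>) n + \<dots> < r / 2 * bin_coeff (\<alpha> + \<beta>) n + r / 2 * bin_coeff (\<alpha> + \<beta>) n"
        using M[of n] n pab[of n] K by (intro add_le_less_mono mult_strict_right_mono) (auto simp: e_def)
      finally show "norm ((\<Sum>i\<le>n. a i * b (n - i)) / bin_coeff (\<alpha> + \<beta>) n - 0) < r"
        using pab[of n] by (simp add: abs_divide field_simps)
    qed
  qed
qed

text \<open>
  Replace first \<open>a\<close> and then \<open>b\<close> by the model sequence; both replacements cost a negligible
  convolution, and the convolution of the models is known exactly.
\<close>
theorem coeff_order_convolution:
  assumes "0 < \<alpha>" "0 < \<beta>" and a: "coeff_order \<alpha> A a" and b: "coeff_order \<beta> B b"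
  shows "coeff_order (\<alpha> + \<beta>) (A * B) (\<lambda>n. \<Sum>i\<le>n. a i * b (n - i))"
proof -
  have self: "coeff_order x 1 (bin_coeff x)" if "x > 0" for x
    using bin_coeff_pos[OF that] unfolding coeff_order_def by (simp add: less_imp_neq[symmetric])
  have diff: "coeff_order x 0 (\<lambda>n. c n - C * bin_coeff x n)" if "coeff_order x C c" "x > 0" for x C c
    using coeff_order_add[OF that(1) coeff_order_cmult[OF self[OF that(2)], of "- C"]] by simp
  have 1: "coeff_order (\<alpha> + \<beta>) 0 (\<lambda>n. \<Sum>i\<le>n. (a i - A * bin_coeff \<alpha> i) * b (n - i))"
    by (rule convolution_bin_coeff_small[OF assms(1,2) diff[OF a assms(1)] b])
  have "coeff_order (\<beta> + \<alpha>) 0 (\<lambda>n. \<Sum>i\<le>n. (b i - B * bin_coeff \<beta> i) * bin_coeff \<alpha> (n - i))"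
    by (rule convolution_bin_coeff_small[OF assms(2,1) diff[OF b assms(2)] self[OF assms(1)]])
  from coeff_order_add[OF 1
      coeff_order_cmult[OF this[unfolded add.commute[of \<beta> \<alpha>]], of A]]
  have "coeff_order (\<alpha> + \<beta>) 0 (\<lambda>n. (\<Sum>i\<le>n. (a i - A * bin_coeff \<alpha> i) * b (n - i)) +
      A * (\<Sum>i\<le>n. bin_coeff \<alpha> i * (b (n - i) - B * bin_coeff \<beta> (n - i))))"
    by (simp add: convolution_commute[of "\<lambda>i. b i - B * bin_coeff \<beta> i"])
  also have "(\<lambda>n. (\<Sum>i\<le>n. (a i - A * bin_coeff \<alpha> i) * b (n - i)) +
      A * (\<Sum>i\<le>n. bin_coeff \<alpha> i * (b (n - i) - B * bin_coeff \<beta> (n - i)))) =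
      (\<lambda>n. (\<Sum>i\<le>n. a i * b (n - i)) - A * B * bin_coeff (\<alpha> + \<beta>) n)"
    unfolding bin_coeff_convolution[symmetric] sum_distrib_left sum.distrib[symmetric] sum_subtractf[symmetric]
    by (intro ext sum.cong refl) (simp add: algebra_simps)
  finally have "coeff_order (\<alpha> + \<beta>) 0 (\<lambda>n. (\<Sum>i\<le>n. a i * b (n - i)) - A * B * bin_coeff (\<alpha> + \<beta>) n)" .
  from coeff_order_add[OF this coeff_order_cmult[OF self, of "\<alpha> + \<beta>" "A * B"]] assms(1,2)
  show ?thesis by simp
qed

text \<open>
  A summable factor acts through its sum, since for \<open>\<alpha> \<ge> 1\<close> the model sequence is nondecreasing and
  Tannery's theorem applies with a multiple of \<open>b\<close> as majorant.
\<close>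
theorem coeff_order_convolution_summable:
  assumes "1 \<le> \<alpha>" and a: "coeff_order \<alpha> A a" and b: "b sums B" "\<And>n. b n \<ge> 0"
  shows "coeff_order \<alpha> (B * A) (\<lambda>n. \<Sum>i\<le>n. b i * a (n - i))"
proof -
  have "\<alpha> > 0" using assms by simp
  have p: "bin_coeff \<alpha> n > 0" for n using \<open>\<alpha> > 0\<close> by (rule bin_coeff_pos)
  obtain K where K: "K > 0" "\<And>n. \<bar>a n\<bar> \<le> K * bin_coeff \<alpha> n"
    using coeff_order_bounded[OF a \<open>\<alpha> > 0\<close>] by metis
  have inc: "incseq (bin_coeff \<alpha>)"
  proof (rule incseq_SucI)
    fix n
    have "1 \<le> (\<alpha> + real n) / real (Suc n)" using assms by simp
    then show "bin_coeff \<alpha> n \<le> bin_coeff \<alpha> (Suc n)"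
      using p[of n] unfolding bin_coeff_Suc by (metis mult.right_neutral mult_left_mono less_imp_le)
  qed
  define f where "f i n = (if i \<le> n then b i * (a (n - i) / bin_coeff \<alpha> n) else 0)" for i n
  have "((\<lambda>n. \<Sum>i. f i n) \<longlonglongrightarrow> (\<Sum>i. b i * A))"
  proof (rule tannerys_theorem[THEN conjunct2, THEN conjunct2])
    fix i
    have "(\<lambda>n. a n / bin_coeff \<alpha> n) \<longlonglongrightarrow> A" using a by (simp add: coeff_order_def)
    then have "(\<lambda>n. a (n - i) / bin_coeff \<alpha> (n - i)) \<longlonglongrightarrow> A"
      by (rule filterlim_compose) (rule filterlim_minus_const_nat_at_top)
    from tendsto_mult[OF this bin_coeff_shift_limit[OF \<open>\<alpha> > 0\<close>, of i]]
    have "(\<lambda>n. a (n - i) / bin_coeff \<alpha> n) \<longlonglongrightarrow> A"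
      using p by (simp add: less_imp_neq[symmetric])
    then have "(\<lambda>n. b i * (a (n - i) / bin_coeff \<alpha> n)) \<longlonglongrightarrow> b i * A" by (rule tendsto_mult_left)
    moreover have "eventually (\<lambda>n. b i * (a (n - i) / bin_coeff \<alpha> n) = f i n) sequentially"
      using eventually_ge_at_top[of i] by eventually_elim (simp add: f_def)
    ultimately show "(\<lambda>n. f i n) \<longlonglongrightarrow> b i * A" by (rule Lim_transform_eventually)
  next
    have "norm (f i n) \<le> b i * K" for i n
    proof (cases "i \<le> n")
      case True
      have "\<bar>a (n - i)\<bar> / bin_coeff \<alpha> n \<le> K"
      proof -
        have "\<bar>a (n - i)\<bar> \<le> K * bin_coeff \<alpha> (n - i)" by (rule K)
        also have "\<dots> \<le> K * bin_coeff \<alpha> n"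
          using K inc by (intro mult_left_mono) (auto simp: incseq_def)
        finally show ?thesis using p[of n] by (simp add: field_simps)
      qed
      from mult_left_mono[OF this b(2)[of i]] show ?thesis using True b(2)[of i] p[of n]
        by (simp add: f_def abs_mult)
    qed (use b(2)[of i] K in \<open>simp add: f_def\<close>)
    then show "\<forall>\<^sub>F (k, n) in at_top \<times>\<^sub>F sequentially. norm (f k n) \<le> b k * K"
      by (intro always_eventually) auto
  next
    show "summable (\<lambda>i. b i * K)" using b by (intro summable_mult2) (auto simp: sums_iff)
  qed auto
  moreover have "(\<Sum>i. b i * A) = B * A" using sums_mult2[OF b(1), of A] by (simp add: sums_iff)
  moreover have "(\<Sum>i. f i n) = (\<Sum>i\<le>n. b i * a (n - i)) / bin_coeff \<alpha> n" for n
    by (subst suminf_finite[of "{..n}"]) (auto simp: f_def sum_divide_distrib)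
  ultimately show ?thesis unfolding coeff_order_def by simp
qed

lemma coeff_order_powr:
  assumes "coeff_order \<alpha> A a" "\<alpha> > 0"
  shows "(\<lambda>n. a n / real n powr (\<alpha> - 1)) \<longlonglongrightarrow> A / Gamma \<alpha>"
proof -
  have "(\<lambda>n. a n / bin_coeff \<alpha> n * (bin_coeff \<alpha> n / real n powr (\<alpha> - 1))) \<longlonglongrightarrow> A * (1 / Gamma \<alpha>)"
    using assms bin_coeff_asymp unfolding coeff_order_def by (intro tendsto_mult)
  moreover have "a n / bin_coeff \<alpha> n * (bin_coeff \<alpha> n / real n powr (\<alpha> - 1)) = a n / real n powr (\<alpha> - 1)" for n
    using bin_coeff_pos[OF assms(2), of n] by simp
  ultimately show ?thesis by (simp only: times_divide_eq_right mult_1_right)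
qed

text \<open>
  Multiplying by powers of the tree size \<open>k * d + 1\<close> raises the exponent accordingly; the constant
  does not matter where this is used.
\<close>
lemma coeff_order_times_linear_power:
  assumes "coeff_order \<alpha> A a" "\<alpha> > 0"
  shows "\<exists>B. coeff_order (\<alpha> + real i) B (\<lambda>k. real (k * d + 1) ^ i * a k)"
proof (induction i)
  case 0
  then show ?case using assms by auto
next
  case (Suc i)
  then obtain B where B: "coeff_order (\<alpha> + real i) B (\<lambda>k. real (k * d + 1) ^ i * a k)" by blast
  have p: "\<alpha> + real i > 0" using assms by simp
  have "coeff_order (\<alpha> + real i + 1) (real d * ((\<alpha> + real i) * B) + 0)
      (\<lambda>k. real d * (real k * (real (k * d + 1) ^ i * a k)) + real (k * d + 1) ^ i * a k)"
    using p by (intro coeff_order_add coeff_order_cmult coeff_order_times_index B coeff_order_lower[OF B]) auto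
  also have "(\<lambda>k. real d * (real k * (real (k * d + 1) ^ i * a k)) + real (k * d + 1) ^ i * a k) =
      (\<lambda>k. real (k * d + 1) ^ Suc i * a k)"
    by (simp add: fun_eq_iff algebra_simps)
  finally show ?case by (auto simp: add_ac)
qed

lemma coeff_order_sum_ex:
  assumes "\<And>i. i \<in> I \<Longrightarrow> \<exists>B. coeff_order \<alpha> B (a i)"
  shows "\<exists>B. coeff_order \<alpha> B (\<lambda>n. \<Sum>i\<in>I. a i n)"
proof -
  from assms obtain B where "\<And>i. i \<in> I \<Longrightarrow> coeff_order \<alpha> (B i) (a i)" by metis
  then show ?thesis using coeff_order_sum by blast
qed

lemma coeff_order_fps_mult:
  fixes F G :: "real fps"
  assumes "0 < \<alpha>" "0 < \<beta>" "coeff_order \<alpha> A (fps_nth F)" "coeff_order \<beta> B (fps_nth G)" "\<gamma> = \<alpha> + \<beta>"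
  shows "coeff_order \<gamma> (A * B) (fps_nth (F * G))"
proof -
  have "fps_nth (F * G) = (\<lambda>n. \<Sum>i\<le>n. F $ i * G $ (n - i))"
    by (simp add: fun_eq_iff fps_mult_nth atLeast0AtMost)
  then show ?thesis using coeff_order_convolution[OF assms(1-4)] assms(5) by simp
qed

lemma coeff_order_fps_mult_summable:
  fixes F G :: "real fps"
  assumes "1 \<le> \<alpha>" "coeff_order \<alpha> A (fps_nth G)" "(\<lambda>n. F $ n) sums B" "\<And>n. F $ n \<ge> 0"
  shows "coeff_order \<alpha> (B * A) (fps_nth (F * G))"
proof -
  have "fps_nth (F * G) = (\<lambda>n. \<Sum>i\<le>n. F $ i * G $ (n - i))"
    by (simp add: fun_eq_iff fps_mult_nth atLeast0AtMost)
  then show ?thesis using coeff_order_convolution_summable[OF assms] by simp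
qed

section \<open>Lagrange inversion for the tree equation\<close>

text \<open>
  The formal sum of \<open>b m * x ^ m * A m\<close> over all \<open>m\<close>.  The factor \<open>x ^ m\<close> makes every coefficient a
  finite sum.
\<close>
definition twisted_sum :: "(nat \<Rightarrow> 'a::comm_ring_1) \<Rightarrow> (nat \<Rightarrow> 'a fps) \<Rightarrow> 'a fps" where
  "twisted_sum b A = Abs_fps (\<lambda>n. \<Sum>m\<le>n. b m * A m $ (n - m))"

lemma twisted_sum_nth: "twisted_sum b A $ n = (\<Sum>m\<le>n. b m * A m $ (n - m))"
  by (simp add: twisted_sum_def)

lemma twisted_sum_nth_truncate:
  assumes "n \<le> K"
  shows "twisted_sum b A $ n = (\<Sum>m\<le>K. fps_const (b m) * fps_X ^ m * A m) $ n"
proof -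
  have "(\<Sum>m\<le>K. fps_const (b m) * fps_X ^ m * A m) $ n = (\<Sum>m\<le>K. if m \<le> n then b m * A m $ (n - m) else 0)"
    by (simp add: fps_sum_nth mult.assoc fps_X_power_mult_nth if_distrib not_less cong: if_cong)
       (intro sum.cong, auto)
  also have "\<dots> = (\<Sum>m\<le>n. b m * A m $ (n - m))"
    using assms by (intro sum.mono_neutral_cong_right) auto
  finally show ?thesis by (simp add: twisted_sum_nth)
qed

lemma twisted_sum_mult: "twisted_sum b A * B = twisted_sum b (\<lambda>m. A m * B)"
proof (rule fps_ext)
  fix n
  have "(twisted_sum b A * B) $ n = (\<Sum>i=0..n. twisted_sum b A $ i * B $ (n - i))"
    by (simp add: fps_mult_nth)
  also have "\<dots> = (\<Sum>i=0..n. (\<Sum>m\<le>n. fps_const (b m) * fps_X ^ m * A m) $ i * B $ (n - i))"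
    by (intro sum.cong refl) (simp add: twisted_sum_nth_truncate[where K = n])
  also have "\<dots> = ((\<Sum>m\<le>n. fps_const (b m) * fps_X ^ m * A m) * B) $ n"
    by (simp add: fps_mult_nth)
  also have "\<dots> = twisted_sum b (\<lambda>m. A m * B) $ n"
    by (simp add: twisted_sum_nth_truncate[where K = n] sum_distrib_right mult.assoc)
  finally show "(twisted_sum b A * B) $ n = twisted_sum b (\<lambda>m. A m * B) $ n" .
qed

lemma twisted_sum_powers:
  "twisted_sum b (\<lambda>m. A ^ m) = fps_compose (Abs_fps b) (fps_X * A)"
  by (rule fps_ext)
     (auto simp: twisted_sum_nth fps_compose_nth power_mult_distrib fps_X_power_mult_nth atLeast0AtMost not_less
           intro!: sum.cong)

text \<open>
  Tonelli: the double sum over pairs may be grouped by the exponent of \<open>x\<close> or by \<open>m\<close>.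
\<close>
lemma twisted_sum_suminf:
  assumes b: "\<And>m. b m \<ge> (0::real)" and A: "\<And>m i. A m $ i \<ge> 0" and s: "\<And>m. (\<lambda>i. A m $ i) sums s m"
  shows "(\<Sum>n. ennreal (twisted_sum b A $ n)) = (\<Sum>m. ennreal (b m * s m))"
proof -
  define g where "g m n = ennreal (if m \<le> n then b m * A m $ (n - m) else 0)" for m n
  have "ennreal (twisted_sum b A $ n) = (\<Sum>m. g m n)" for n
  proof -
    have "(\<Sum>m. g m n) = (\<Sum>m\<le>n. g m n)"
      by (rule suminf_finite) (auto simp: g_def)
    also have "\<dots> = ennreal (\<Sum>m\<le>n. b m * A m $ (n - m))"
      using b A by (subst sum_ennreal[symmetric]) (auto simp: g_def intro!: sum.cong)
    finally show ?thesis by (simp add: twisted_sum_nth)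
  qed
  then have "(\<Sum>n. ennreal (twisted_sum b A $ n)) = (\<integral>\<^sup>+n. (\<Sum>m. g m n) \<partial>count_space UNIV)"
    by (simp add: nn_integral_count_space_nat)
  also have "\<dots> = (\<Sum>m. \<integral>\<^sup>+n. g m n \<partial>count_space UNIV)"
    by (rule nn_integral_suminf) simp
  also have "(\<lambda>m. \<integral>\<^sup>+n. g m n \<partial>count_space UNIV) = (\<lambda>m. ennreal (b m * s m))"
  proof
    fix m
    have "(\<lambda>i. b m * A m $ i) sums (b m * s m)" by (intro sums_mult s)
    then have "(\<lambda>n. if m \<le> n then b m * A m $ (n - m) else 0) sums (b m * s m)"
      by (subst sums_iff_shift'[of _ m, symmetric]) (auto simp: sums_zero_iff_shift)
    then show "(\<integral>\<^sup>+n. g m n \<partial>count_space UNIV) = ennreal (b m * s m)"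
      unfolding nn_integral_count_space_nat g_def using b A by (intro suminf_ennreal_eq) auto
  qed
  finally show ?thesis .
qed

text \<open>
  Evaluation at \<open>x = 1\<close>.  Both directions are needed: from right to left to sum the coefficients of
  such a series, from left to right to learn that the right-hand side converges at all.
\<close>
lemma twisted_sum_sums:
  assumes b: "\<And>m. b m \<ge> (0::real)" and A: "\<And>m i. A m $ i \<ge> 0" and s: "\<And>m. (\<lambda>i. A m $ i) sums s m"
  shows "(\<lambda>n. twisted_sum b A $ n) sums S \<longleftrightarrow> (\<lambda>m. b m * s m) sums S"
proof -
  have iff: "f sums S \<longleftrightarrow> (\<Sum>n. ennreal (f n)) = ennreal S \<and> S \<ge> 0" if f: "\<And>n. f n \<ge> 0" for f :: "nat \<Rightarrow> real"
  proof
    assume S: "f sums S"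
    from sums_le[OF f sums_zero S] suminf_ennreal_eq[OF f S]
    show "(\<Sum>n. ennreal (f n)) = ennreal S \<and> S \<ge> 0" by simp
  next
    assume *: "(\<Sum>n. ennreal (f n)) = ennreal S \<and> S \<ge> 0"
    then have sf: "summable f" using f by (intro summable_suminf_not_top) auto
    have "ennreal (suminf f) = ennreal S"
      using suminf_ennreal_eq[OF f summable_sums[OF sf]] * by (simp only: )
    then have "suminf f = S"
      using ennreal_inj[OF suminf_nonneg[OF sf f] conjunct2[OF *]] by blast
    with sf show "f sums S" by (simp add: sums_iff)
  qed
  have "s m \<ge> 0" for m using sums_le[OF _ sums_zero s, of m] A by auto
  then have "b m * s m \<ge> 0" for m using b by simp
  moreover have "twisted_sum b A $ n \<ge> 0" for n
    using b A by (auto simp: twisted_sum_nth intro!: sum_nonneg)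
  ultimately show ?thesis
    using twisted_sum_suminf[OF b A s] by (simp add: iff)
qed

lemma fps_X_deriv_nth: "(fps_X * fps_deriv G) $ m = of_nat m * G $ m"
  for G :: "'a::comm_ring_1 fps"
  by (cases m) auto

text \<open>
  The sum is a coefficient of \<open>y F' F ^ q\<close>, which is \<open>y\<close> times the derivative of
  \<open>F ^ (q + 1) / (q + 1)\<close>.
\<close>
lemma index_weighted_power_convolution_one:
  fixes F :: "'a::{field_char_0} fps"
  shows "(\<Sum>m\<le>n. of_nat m * F $ m * (F ^ q) $ (n - m)) = of_nat n / of_nat (Suc q) * (F ^ Suc q) $ n"
proof -
  have "(\<Sum>m\<le>n. of_nat m * F $ m * (F ^ q) $ (n - m)) = (fps_X * fps_deriv F * F ^ q) $ n"
    by (subst fps_mult_nth) (simp only: fps_X_deriv_nth atLeast0AtMost)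
  also have "\<dots> = (fps_X * (fps_const (1 / of_nat (Suc q)) * fps_deriv (F ^ Suc q))) $ n"
  proof -
    have "fps_const (1 / of_nat (Suc q)) * fps_deriv (F ^ Suc q) =
       fps_const (1 / of_nat (Suc q)) * fps_const (of_nat (Suc q)) * (fps_deriv F * F ^ q)"
      unfolding fps_deriv_power' by (simp add: mult_ac flip: fps_of_nat)
    also have "fps_const (1 / of_nat (Suc q) :: 'a) * fps_const (of_nat (Suc q)) = 1"
      by (simp del: of_nat_Suc)
    finally show ?thesis by (simp add: mult_ac)
  qed
  also have "\<dots> = of_nat n / of_nat (Suc q) * (F ^ Suc q) $ n"
    by (cases n) (simp_all del: of_nat_Suc power_Suc)
  finally show ?thesis .
qed

lemma index_weighted_power_convolution:
  fixes F :: "'a::{field_char_0} fps"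
  shows "(\<Sum>m\<le>n. of_nat m * (F ^ p) $ m * (F ^ q) $ (n - m)) = of_nat (p * n) / of_nat (p + q) * (F ^ (p + q)) $ n"
proof (cases "p = 0")
  case True
  then show ?thesis by (auto intro!: sum.neutral)
next
  case False
  then obtain p' where p: "p = Suc p'" by (cases p) auto
  have "(\<Sum>m\<le>n. of_nat m * (F ^ p) $ m * (F ^ q) $ (n - m)) = (fps_X * fps_deriv (F ^ p) * F ^ q) $ n"
    by (subst fps_mult_nth) (simp only: fps_X_deriv_nth atLeast0AtMost)
  also have "fps_X * fps_deriv (F ^ p) * F ^ q = fps_const (of_nat p) * (fps_X * fps_deriv F * F ^ (p' + q))"
    unfolding fps_deriv_power' p by (simp add: power_add mult_ac flip: fps_of_nat)
  also have "\<dots> $ n = of_nat p * (\<Sum>m\<le>n. of_nat m * F $ m * (F ^ (p' + q)) $ (n - m))"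
    by (subst fps_mult_left_const_nth, subst fps_mult_nth) (simp only: fps_X_deriv_nth atLeast0AtMost)
  also have "\<dots> = of_nat (p * n) / of_nat (p + q) * (F ^ (p + q)) $ n"
    unfolding index_weighted_power_convolution_one by (simp add: p field_simps)
  finally show ?thesis .
qed

text \<open>
  With \<open>z ^ d = x\<close> the series \<open>z T(x)\<close> solves the tree equation \<open>G = z \<phi>(G)\<close> for \<open>\<phi>(t) = \<psi>(t ^ d)\<close>;
  in terms of \<open>T\<close> itself it reads \<open>T = \<psi>(x T ^ d)\<close>.
\<close>
locale tree_equation =
  fixes \<psi> :: "real fps" and d :: nat and T :: "real fps"
  assumes d_pos: "d > 0"
    and T_eq: "T = twisted_sum (fps_nth \<psi>) (\<lambda>m. T ^ (d * m))"
    and psi_0: "\<psi> $ 0 \<noteq> 0"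
begin

lemma T_power_eq: "T ^ p = twisted_sum (fps_nth (\<psi> ^ p)) (\<lambda>m. T ^ (d * m))"
proof -
  have T: "T = \<psi> oo (fps_X * T ^ d)"
    using T_eq by (subst (asm) power_mult, subst (asm) twisted_sum_powers) (simp add: fps_nth_inverse)
  have "T ^ p = (\<psi> oo (fps_X * T ^ d)) ^ p"
    using T by simp
  also have "\<dots> = \<psi> ^ p oo (fps_X * T ^ d)"
    by (rule fps_compose_power) simp
  finally show ?thesis
    by (subst power_mult, subst twisted_sum_powers) (simp add: fps_nth_inverse)
qed

text \<open>
  Lagrange inversion for powers, by induction on the order of the coefficient: expanding
  \<open>T ^ p = \<psi> ^ p (x T ^ d)\<close> expresses the coefficient of order \<open>i\<close> by coefficients of lower order, and
  the resulting sum is an index-weighted convolution of powers of \<open>\<psi>\<close>.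
\<close>
theorem lagrange_power:
  "real (p + d * i) * T ^ p $ i = real p * (\<psi> ^ (p + d * i)) $ i"
proof (induction i arbitrary: p rule: less_induct)
  case (less i)
  show ?case
  proof (cases "i = 0")
    case True
    have "T ^ p $ 0 = (\<psi> ^ p) $ 0"
      by (subst T_power_eq) (simp add: twisted_sum_nth)
    then show ?thesis using True by simp
  next
    case False
    have "real (d * i) * T ^ p $ i = (\<Sum>m\<le>i. (\<psi> ^ p) $ m * (real (d * i) * T ^ (d * m) $ (i - m)))"
      by (subst T_power_eq) (simp add: twisted_sum_nth sum_distrib_left mult_ac)
    also have "\<dots> = (\<Sum>m\<le>i. real d * (real m * (\<psi> ^ p) $ m * (\<psi> ^ (d * i)) $ (i - m)))"
    proof (intro sum.cong refl)
      fix m assume m: "m \<in> {..i}"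
      show "(\<psi> ^ p) $ m * (real (d * i) * T ^ (d * m) $ (i - m)) =
            real d * (real m * (\<psi> ^ p) $ m * (\<psi> ^ (d * i)) $ (i - m))"
      proof (cases "m = 0")
        case True
        then show ?thesis using False by simp
      next
        case m0: False
        with False have "i - m < i" by simp
        from less.IH[OF this, of "d * m"]
        have "real (d * i) * T ^ (d * m) $ (i - m) = real (d * m) * (\<psi> ^ (d * i)) $ (i - m)"
          using m by (simp flip: add_mult_distrib2)
        then show ?thesis by simp
      qed
    qed
    also have "\<dots> = real d * (real (p * i) / real (p + d * i) * (\<psi> ^ (p + d * i)) $ i)"
      unfolding sum_distrib_left[symmetric] index_weighted_power_convolution ..
    finally have "real (d * i) * (T ^ p $ i) = real (d * i) * (real p * (\<psi> ^ (p + d * i)) $ i / real (p + d * i))"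
      by (simp add: mult_ac)
    then have "T ^ p $ i = real p * (\<psi> ^ (p + d * i)) $ i / real (p + d * i)"
      using False d_pos by (simp del: of_nat_add of_nat_mult times_divide_eq_right)
    then show ?thesis using False d_pos by (simp del: of_nat_add of_nat_mult)
  qed
qed

text \<open>
  The series whose coefficients appear in the second form of Lagrange's formula; it equals
  \<open>T ^ p / (1 - Psi 1)\<close> with \<open>Psi\<close> as below.
\<close>
definition lag :: "nat \<Rightarrow> real fps" where
  "lag p = Abs_fps (\<lambda>i. (\<psi> ^ (p + d * i)) $ i)"

lemma lag_nth: "lag p $ i = (\<psi> ^ (p + d * i)) $ i" by (simp add: lag_def)

lemma T_0: "T $ 0 = \<psi> $ 0"
  by (subst T_eq) (simp add: twisted_sum_nth)

text \<open>
  For positive exponents \<open>lag p\<close> is \<open>T ^ p\<close> plus a multiple of \<open>x\<close> times its derivative, by Lagrange's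
  formula, and the derivative of a power splits off \<open>T ^ (p - 1)\<close>.
\<close>
lemma lag_Suc: "lag (Suc p) = T ^ p * lag 1"
proof -
  have ls: "lag (Suc p) = T ^ Suc p + fps_const (real d / real (Suc p)) * (fps_X * fps_deriv (T ^ Suc p))" for p
  proof (rule fps_ext)
    fix i
    show "lag (Suc p) $ i = (T ^ Suc p + fps_const (real d / real (Suc p)) * (fps_X * fps_deriv (T ^ Suc p))) $ i"
      using lagrange_power[of "Suc p" i] d_pos
      unfolding fps_add_nth fps_mult_left_const_nth fps_X_deriv_nth lag_nth
      by (simp add: field_simps del: power_Suc)
  qed
  have "lag (Suc p) = T ^ Suc p + fps_const (real d / real (Suc p)) * fps_const (real (Suc p)) * (fps_X * (fps_deriv T * T ^ p))"
    unfolding ls fps_deriv_power' by (simp add: mult_ac flip: fps_of_nat)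
  also have "fps_const (real d / real (Suc p)) * fps_const (real (Suc p)) = fps_const (real d)"
    by (simp del: of_nat_Suc)
  also have "T ^ Suc p + fps_const (real d) * (fps_X * (fps_deriv T * T ^ p)) = T ^ p * lag 1"
    using ls[of 0] by (simp add: algebra_simps)
  finally show ?thesis .
qed

text \<open>
  The formula used for positive exponents degenerates at \<open>0\<close>.  Instead the quotient \<open>W = lag 1 / T\<close>
  is determined from the tree equation multiplied by \<open>W\<close>: all its terms but the one with \<open>m = 0\<close> are
  already known, and that one is \<open>\<psi> $ 0 * W\<close>.
\<close>
lemma lag_1: "lag 1 = T * lag 0"
proof -
  \<comment> \<open>\<open>T\<close> is a unit because its constant term is \<open>\<psi> $ 0\<close>\<close>
  define W where "W = inverse T * lag 1"
  have W: "T * W = lag 1"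
    unfolding W_def using T_0 psi_0 by (simp add: inverse_mult_eq_1' flip: mult.assoc)
  have "lag 1 = twisted_sum (fps_nth \<psi>) (\<lambda>m. T ^ (d * m)) * W"
    using W T_eq by metis
  also have "\<dots> = twisted_sum (fps_nth \<psi>) (\<lambda>m. T ^ (d * m) * W)"
    by (rule twisted_sum_mult)
  finally have 1: "lag 1 = twisted_sum (fps_nth \<psi>) (\<lambda>m. T ^ (d * m) * W)" .
  have 2: "T ^ p * W = lag p" if "p > 0" for p
    using lag_Suc[of "p - 1"] that W by (cases p) (auto simp: mult_ac)
  have "W $ k = lag 0 $ k" for k
  proof -
    have "lag 1 $ k = (\<Sum>m\<le>k. \<psi> $ m * (T ^ (d * m) * W) $ (k - m))"
      by (subst 1) (simp add: twisted_sum_nth)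
    also have "\<dots> = \<psi> $ 0 * W $ k + (\<Sum>m\<in>{..k} - {0}. \<psi> $ m * (T ^ (d * m) * W) $ (k - m))"
      by (subst sum.remove[of _ 0]) auto
    also have "(\<Sum>m\<in>{..k} - {0}. \<psi> $ m * (T ^ (d * m) * W) $ (k - m)) =
               (\<Sum>m\<in>{..k} - {0}. \<psi> $ m * (\<psi> ^ (d * k)) $ (k - m))"
      using d_pos by (intro sum.cong refl) (auto simp: 2 lag_nth simp flip: add_mult_distrib2)
    also have "lag 1 $ k = (\<Sum>m\<le>k. \<psi> $ m * (\<psi> ^ (d * k)) $ (k - m))"
      by (simp add: lag_nth fps_mult_nth atLeast0AtMost)
    also have "\<dots> = \<psi> $ 0 * (\<psi> ^ (d * k)) $ k + (\<Sum>m\<in>{..k} - {0}. \<psi> $ m * (\<psi> ^ (d * k)) $ (k - m))"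
      by (subst sum.remove[of _ 0]) auto
    finally show ?thesis using psi_0 by (simp add: lag_nth)
  qed
  then have "W = lag 0" by (rule fps_ext)
  with W show ?thesis by simp
qed

lemma T_power_lag: "T ^ p * lag 0 = lag p"
proof (cases p)
  case (Suc q)
  then show ?thesis using lag_Suc[of q] lag_1 by (simp add: mult_ac)
qed simp

text \<open>
  The Taylor coefficient of order \<open>j\<close> of \<open>t \<mapsto> \<psi>(x t ^ d)\<close> at the point \<open>T\<close>.
\<close>
definition Psi :: "nat \<Rightarrow> real fps" where
  "Psi j = twisted_sum (\<lambda>m. \<psi> $ m * real ((d * m) choose j)) (\<lambda>m. T ^ (d * m - j))"

text \<open>
  Linearising the tree equation produces the factor \<open>1 - Psi 1\<close>; its inverse has explicit coefficients.
\<close>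
lemma Psi_lag: "(1 - Psi 1) * lag 0 = 1"
proof -
  have "Psi 1 * lag 0 = twisted_sum (\<lambda>m. \<psi> $ m * real (d * m)) (\<lambda>m. T ^ (d * m - 1) * lag 0)"
    unfolding Psi_def by (simp add: twisted_sum_mult)
  also have "\<dots> = lag 0 - 1"
  proof (rule fps_ext)
    fix k
    show "twisted_sum (\<lambda>m. \<psi> $ m * real (d * m)) (\<lambda>m. T ^ (d * m - 1) * lag 0) $ k = (lag 0 - 1) $ k"
    proof (cases "k = 0")
      case True
      then show ?thesis by (simp add: twisted_sum_nth lag_nth)
    next
      case False
      have "twisted_sum (\<lambda>m. \<psi> $ m * real (d * m)) (\<lambda>m. T ^ (d * m - 1) * lag 0) $ k
          = (\<Sum>m\<le>k. real d * (real m * \<psi> $ m * (\<psi> ^ (d * k - 1)) $ (k - m)))"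
        unfolding twisted_sum_nth T_power_lag
      proof (intro sum.cong refl)
        fix m assume m: "m \<in> {..k}"
        have "d * m - 1 + d * (k - m) = d * k - 1" if "m \<noteq> 0"
        proof -
          have "d * m \<ge> 1" using that d_pos by (simp add: Suc_le_eq)
          then have "d * m - 1 + d * (k - m) = d * m + d * (k - m) - 1" by simp
          also have "d * m + d * (k - m) = d * k" using m by (simp flip: add_mult_distrib2)
          finally show ?thesis .
        qed
        then show "\<psi> $ m * real (d * m) * lag (d * m - 1) $ (k - m) =
             real d * (real m * \<psi> $ m * (\<psi> ^ (d * k - 1)) $ (k - m))"
          by (cases "m = 0") (simp_all add: lag_nth)
      qed
      also have "\<dots> = real d * (real k / real (Suc (d * k - 1)) * (\<psi> ^ Suc (d * k - 1)) $ k)"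
        unfolding sum_distrib_left[symmetric] index_weighted_power_convolution_one ..
      also have "Suc (d * k - 1) = d * k" using False d_pos by simp
      finally show ?thesis using False d_pos by (simp add: lag_nth)
    qed
  qed
  finally show ?thesis by (simp add: algebra_simps)
qed

lemma T_nth: "T $ k = lag 1 $ k / real (d * k + 1)"
  using lagrange_power[of 1 k] by (simp add: lag_nth nonzero_eq_divide_eq mult.commute del: of_nat_add of_nat_mult)

end

section \<open>Inversions in labelled trees\<close>

definition trees_on :: "nat set \<Rightarrow> nat otree set" where
  "trees_on S = {t. distinct (labels t) \<and> set (labels t) = S}"

text \<open>
  Sequences of \<open>l\<close> trees whose labels together are exactly \<open>U\<close>, each used once.
\<close>
definition forests_on :: "nat \<Rightarrow> nat set \<Rightarrow> nat otree list set" where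
  "forests_on l U = {ts. length ts = l \<and> distinct (concat (map labels ts)) \<and> set (concat (map labels ts)) = U}"

lemma labelled_trees_eq: "labelled_trees n = trees_on {1..n}"
  by (auto simp: labelled_trees_def trees_on_def distinct_card[symmetric])

lemma labels_ne: "labels t \<noteq> []" by (cases t) auto

lemma trees_on_empty: "trees_on {} = {}"
  using labels_ne by (auto simp: trees_on_def)

lemma forests_on_0: "forests_on 0 U = (if U = {} then {[]} else {})"
  by (auto simp: forests_on_def)

lemma forests_on_Suc:
  "forests_on (Suc l) U = (\<lambda>(V, t, ts). t # ts) ` (SIGMA V:Pow U. trees_on V \<times> forests_on l (U - V))"
  (is "_ = ?f ` ?A")
proof (intro equalityI subsetI)
  fix x assume "x \<in> forests_on (Suc l) U"
  then obtain t ts where x: "x = t # ts" "length ts = l" "distinct (labels t)"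
     "distinct (concat (map labels ts))" "set (labels t) \<inter> set (concat (map labels ts)) = {}"
     "set (labels t) \<union> set (concat (map labels ts)) = U"
    unfolding forests_on_def by (auto simp: length_Suc_conv)
  then have "(set (labels t), t, ts) \<in> ?A" by (auto simp: trees_on_def forests_on_def)
  then show "x \<in> ?f ` ?A" unfolding x(1) by (rule rev_image_eqI) simp
next
  fix x assume "x \<in> ?f ` ?A"
  then obtain V t ts where *: "x = t # ts" "V \<subseteq> U" "t \<in> trees_on V" "ts \<in> forests_on l (U - V)"
    by auto
  then have "set (labels t) \<inter> set (concat (map labels ts)) = {}"
     "set (labels t) \<union> set (concat (map labels ts)) = U"
    unfolding trees_on_def forests_on_def by blast+
  with * show "x \<in> forests_on (Suc l) U" by (auto simp: trees_on_def forests_on_def)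
qed

lemma forests_on_Suc_inj: "inj_on (\<lambda>(V, t, ts). t # ts) (SIGMA V:Pow U. trees_on V \<times> forests_on l (U - V))"
  by (auto simp: inj_on_def trees_on_def)

text \<open>
  Every tree has a label, so a forest has at most as many trees as labels.  This bounds the sum over
  root degrees.
\<close>
lemma forest_length_le:
  assumes "ts \<in> forests_on l U"
  shows "l \<le> card U"
proof -
  have "length ts \<le> length (concat (map labels ts))"
  proof (induction ts)
    case (Cons t ts)
    then show ?case using labels_ne[of t] by (cases "labels t") auto
  qed simp
  also have "\<dots> = card U" using assms by (auto simp: forests_on_def distinct_card[symmetric])
  finally show ?thesis using assms by (simp add: forests_on_def)
qed

lemma trees_on_decomp:
  assumes "finite S"
  shows "trees_on S = (\<lambda>(a, l, ts). Node a ts) ` (SIGMA a:S. SIGMA l:{..<card S}. forests_on l (S - {a}))"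
  (is "_ = ?f ` ?A")
proof (intro equalityI subsetI)
  fix t assume t: "t \<in> trees_on S"
  obtain a ts where n: "t = Node a ts" by (cases t)
  with t have f: "ts \<in> forests_on (length ts) (S - {a})" and a: "a \<in> S"
    by (auto simp: trees_on_def forests_on_def)
  from forest_length_le[OF f] a assms have "length ts < card S"
    by (metis card_Diff1_less le_less_trans)
  with f a have "(a, length ts, ts) \<in> ?A" by auto
  then show "t \<in> ?f ` ?A" unfolding n by (rule rev_image_eqI) simp
qed (auto simp: trees_on_def forests_on_def)

lemma trees_on_decomp_inj:
  "inj_on (\<lambda>(a, l, ts). Node a ts) (SIGMA a:S. SIGMA l:{..<card S}. forests_on l (S - {a}))"
  by (auto simp: inj_on_def forests_on_def)

lemma finite_forests_on:
  assumes "finite U" "\<And>V. V \<subseteq> U \<Longrightarrow> finite (trees_on V)"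
  shows "finite (forests_on l U)"
  using assms
proof (induction l arbitrary: U)
  case (Suc l)
  have "finite (SIGMA V:Pow U. trees_on V \<times> forests_on l (U - V))"
    using Suc.prems by (intro finite_SigmaI finite_cartesian_product Suc.IH) auto
  then show ?case unfolding forests_on_Suc by (rule finite_imageI)
qed (simp add: forests_on_0)

lemma finite_trees_on: "finite S \<Longrightarrow> finite (trees_on S)"
proof (induction "card S" arbitrary: S rule: less_induct)
  case less
  have "finite (forests_on l (S - {a}))" if "a \<in> S" for a l
  proof (rule finite_forests_on)
    fix V assume "V \<subseteq> S - {a}"
    then have "V \<subset> S" using that by auto
    then show "finite (trees_on V)"
      using less by (intro less.hyps) (auto intro: psubset_card_mono finite_subset)
  qed (use less in auto)
  then show ?case using less.prems
    by (subst trees_on_decomp) (auto intro!: finite_imageI finite_SigmaI)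
qed

lemma root_path_subset: "root_path t p \<Longrightarrow> set p \<subseteq> set (labels t) \<and> p \<noteq> []"
  by (induction rule: root_path.induct) auto

lemma root_path_exists: "j \<in> set (labels t) \<Longrightarrow> \<exists>p. root_path t p \<and> last p = j"
proof (induction t)
  case (Node a ts)
  show ?case
  proof (cases "j = a")
    case True
    then show ?thesis using root_path.intros(1)[of a ts] by (intro exI[of _ "[a]"]) auto
  next
    case False
    with Node.prems obtain t where t: "t \<in> set ts" "j \<in> set (labels t)" by auto
    from Node.IH[OF this] obtain p where p: "root_path t p" "last p = j" by auto
    then have "root_path (Node a ts) (a # p)" "last (a # p) = j"
      using t root_path_subset[OF p(1)] by (auto intro: root_path.intros)
    then show ?thesis by blast
  qed
qed

lemma root_path_Node: "root_path (Node a ts) p \<longleftrightarrow> p = [a] \<or> (\<exists>t q. t \<in> set ts \<and> root_path t q \<and> p = a # q)"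
  by (subst root_path.simps) auto

lemma inversions_subset: "inversions t \<subseteq> set (labels t) \<times> set (labels t)"
  using root_path_subset by (fastforce simp: inversions_def)

lemma finite_inversions: "finite (inversions t)"
  by (rule finite_subset[OF inversions_subset]) simp

text \<open>
  An inversion either has the root as its upper vertex, and then any smaller label may be the lower one,
  or lies in one of the subtrees.
\<close>
lemma inversions_Node:
  assumes "distinct (labels (Node a ts))"
  shows "inversions (Node a ts) =
    Pair a ` {j \<in> set (labels (Node a ts)). j < a} \<union> (\<Union>t\<in>set ts. inversions t)" (is "_ = ?R")
proof (intro equalityI subsetI)
  fix x assume "x \<in> inversions (Node a ts)"
  then obtain i p where x: "x = (i, last p)" "i > last p" "i \<in> set p" "root_path (Node a ts) p"
    by (auto simp: inversions_def)
  then obtain t q where q: "t \<in> set ts" "root_path t q" "p = a # q"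
    by (auto simp: root_path_Node)
  have ne: "q \<noteq> []" "set q \<subseteq> set (labels t)" using root_path_subset[OF q(2)] by auto
  then have lq: "last q \<in> set (labels t)" "last p = last q" using q by (auto dest: last_in_set)
  show "x \<in> ?R"
  proof (cases "i \<in> set q")
    case True
    then have "x \<in> inversions t" using x q lq by (auto simp: inversions_def)
    then show ?thesis using q by auto
  next
    case False
    then have "i = a" using x q by auto
    then show ?thesis using x lq q by auto
  qed
next
  fix x assume "x \<in> ?R"
  then consider j where "x = (a, j)" "j < a" "j \<in> set (labels (Node a ts))" | t where "t \<in> set ts" "x \<in> inversions t"
    by auto
  then show "x \<in> inversions (Node a ts)"
  proof cases
    case 1
    from root_path_exists[OF 1(3)] obtain p where p: "root_path (Node a ts) p" "last p = j" by auto
    then have "a \<in> set p" by (auto simp: root_path_Node)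
    with p 1 show ?thesis by (auto simp: inversions_def)
  next
    case 2
    then obtain i p where x: "x = (i, last p)" "i > last p" "i \<in> set p" "root_path t p"
      by (auto simp: inversions_def)
    have "p \<noteq> []" using x(3) by auto
    then have "root_path (Node a ts) (a # p) \<and> last (a # p) = last p \<and> i \<in> set (a # p)"
      using x 2 by (auto intro: root_path.intros)
    then show ?thesis using x by (auto simp: inversions_def simp del: last.simps)
  qed
qed

lemma card_inversions_forest:
  "distinct (concat (map labels ts)) \<Longrightarrow> card (\<Union>t\<in>set ts. inversions t) = (\<Sum>t\<leftarrow>ts. card (inversions t))"
proof (induction ts)
  case (Cons t ts)
  have "inversions t \<inter> (\<Union>t\<in>set ts. inversions t) = {}"
  proof -
    have "set (labels t) \<inter> set (labels s) = {}" if "s \<in> set ts" for s using Cons.prems that by auto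
    then show ?thesis using inversions_subset by blast
  qed
  then show ?case using Cons
    by (simp add: card_Un_disjoint finite_inversions)
qed simp

lemma card_inversions_Node:
  assumes "distinct (labels (Node a ts))"
  shows "card (inversions (Node a ts)) =
    card {j \<in> set (labels (Node a ts)). j < a} + (\<Sum>t\<leftarrow>ts. card (inversions t))"
proof -
  have "Pair a ` {j \<in> set (labels (Node a ts)). j < a} \<inter> (\<Union>t\<in>set ts. inversions t) = {}"
  proof -
    have "a \<notin> set (labels t)" if "t \<in> set ts" for t using assms that by auto
    then show ?thesis using inversions_subset by blast
  qed
  then show ?thesis
    using card_inversions_forest[of ts] assms[unfolded labels.simps distinct.simps]
    unfolding inversions_Node[OF assms]
    by (subst card_Un_disjoint) (auto simp: finite_inversions card_image inj_on_def simp del: labels.simps)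
qed

context
  fixes \<phi> :: "nat \<Rightarrow> real"
begin

text \<open>
  The variable \<open>u\<close> of these series marks inversions exponentially, so that the coefficient of \<open>u ^ r\<close>
  carries the moment of order \<open>r\<close>, divided by \<open>r!\<close>.
\<close>
definition gf_tree :: "nat otree \<Rightarrow> real fps" where
  "gf_tree t = fps_const (weight \<phi> t) * fps_exp (real (card (inversions t)))"

definition gf_trees_on :: "nat set \<Rightarrow> real fps" where
  "gf_trees_on S = (\<Sum>t\<in>trees_on S. gf_tree t)"

definition gf_forests_on :: "nat \<Rightarrow> nat set \<Rightarrow> real fps" where
  "gf_forests_on l U = (\<Sum>ts\<in>forests_on l U. prod_list (map gf_tree ts))"

text \<open>
  An exponential generating function in the size.  It is built from the label sets \<open>{1..n}\<close>; that any
  other label set of the same size gives the same series is \<open>gf_trees_on_eq\<close>.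
\<close>
definition tree_gf :: "real fps fps" where
  "tree_gf = Abs_fps (\<lambda>n. fps_const (1 / fact n) * gf_trees_on {1..n})"

lemma gf_tree_Node:
  assumes "distinct (labels (Node a ts))"
  shows "gf_tree (Node a ts) = fps_const (\<phi> (length ts)) *
           fps_exp (real (card {j \<in> set (labels (Node a ts)). j < a})) * prod_list (map gf_tree ts)"
proof -
  have "prod_list (map gf_tree ts) =
     fps_const (prod_list (map (weight \<phi>) ts)) * fps_exp (real (\<Sum>t\<leftarrow>ts. card (inversions t)))"
    by (induction ts) (auto simp: gf_tree_def fps_exp_add_mult mult_ac simp flip: fps_const_mult)
  then show ?thesis
    unfolding gf_tree_def card_inversions_Node[OF assms]
    by (simp add: fps_exp_add_mult mult_ac del: labels.simps flip: fps_const_mult)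
qed

lemma gf_forests_on_0: "gf_forests_on 0 U = (if U = {} then 1 else 0)"
  by (simp add: gf_forests_on_def forests_on_0)

text \<open>
  Choose the set of labels of the first tree.
\<close>
lemma gf_forests_on_Suc:
  assumes "finite U"
  shows "gf_forests_on (Suc l) U = (\<Sum>V\<in>Pow U. gf_trees_on V * gf_forests_on l (U - V))"
proof -
  have fin: "finite (trees_on V)" "finite (forests_on l (U - V))" if "V \<subseteq> U" for V
    using that assms by (auto intro!: finite_trees_on finite_forests_on intro: finite_subset)
  have "gf_forests_on (Suc l) U =
     (\<Sum>x\<in>(SIGMA V:Pow U. trees_on V \<times> forests_on l (U - V)). case x of (V, t, ts) \<Rightarrow> gf_tree t * prod_list (map gf_tree ts))"
    unfolding gf_forests_on_def forests_on_Suc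
    by (subst sum.reindex[OF forests_on_Suc_inj]) (auto intro!: sum.cong)
  also have "\<dots> = (\<Sum>V\<in>Pow U. \<Sum>(t, ts)\<in>trees_on V \<times> forests_on l (U - V). gf_tree t * prod_list (map gf_tree ts))"
    using assms fin by (subst sum.Sigma) auto
  also have "\<dots> = (\<Sum>V\<in>Pow U. gf_trees_on V * gf_forests_on l (U - V))"
    unfolding gf_trees_on_def gf_forests_on_def sum_product sum.cartesian_product ..
  finally show ?thesis .
qed

text \<open>
  Choose the root label, whose rank is the number of inversions with the root on top, and the root degree.
\<close>
lemma gf_trees_on_decomp:
  assumes "finite S"
  shows "gf_trees_on S = (\<Sum>a\<in>S. fps_exp (real (card {j \<in> S. j < a})) *
           (\<Sum>l<card S. fps_const (\<phi> l) * gf_forests_on l (S - {a})))"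
proof -
  have fin: "finite (forests_on l (S - {a}))" for a l
    using assms by (auto intro!: finite_trees_on finite_forests_on intro: finite_subset)
  have "gf_trees_on S = (\<Sum>(a, l, ts)\<in>(SIGMA a:S. SIGMA l:{..<card S}. forests_on l (S - {a})). gf_tree (Node a ts))"
    unfolding gf_trees_on_def trees_on_decomp[OF assms]
    by (subst sum.reindex[OF trees_on_decomp_inj]) (auto intro!: sum.cong)
  also have "\<dots> = (\<Sum>(a, l, ts)\<in>(SIGMA a:S. SIGMA l:{..<card S}. forests_on l (S - {a})).
      fps_exp (real (card {j \<in> S. j < a})) * (fps_const (\<phi> l) * prod_list (map gf_tree ts)))"
  proof (intro sum.cong refl, clarify)
    fix a l ts assume *: "a \<in> S" "l < card S" "ts \<in> forests_on l (S - {a})"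
    then have "distinct (labels (Node a ts))" "set (labels (Node a ts)) = S" "length ts = l"
      by (auto simp: forests_on_def)
    then show "gf_tree (Node a ts) = fps_exp (real (card {j \<in> S. j < a})) * (fps_const (\<phi> l) * prod_list (map gf_tree ts))"
      by (subst gf_tree_Node) (simp_all add: mult_ac)
  qed
  also have "\<dots> = (\<Sum>a\<in>S. \<Sum>l<card S. \<Sum>ts\<in>forests_on l (S - {a}).
      fps_exp (real (card {j \<in> S. j < a})) * (fps_const (\<phi> l) * prod_list (map gf_tree ts)))"
    using assms fin by (simp add: sum.Sigma split_def)
  finally show ?thesis by (simp add: gf_forests_on_def sum_distrib_left)
qed

lemma sum_Pow_by_card:
  fixes g :: "nat \<Rightarrow> 'a::comm_ring_1"
  assumes "finite U"
  shows "(\<Sum>V\<in>Pow U. g (card V)) = (\<Sum>i\<le>card U. of_nat (card U choose i) * g i)"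
proof -
  have "(\<Sum>V\<in>Pow U. g (card V)) = (\<Sum>i\<le>card U. \<Sum>V\<in>{V \<in> Pow U. card V = i}. g (card V))"
    using assms by (intro sum.group[symmetric]) (auto intro: card_mono)
  also have "\<dots> = (\<Sum>i\<le>card U. \<Sum>V\<in>{V. V \<subseteq> U \<and> card V = i}. g i)"
    by (intro sum.cong) auto
  also have "\<dots> = (\<Sum>i\<le>card U. of_nat (card U choose i) * g i)"
    using n_subsets[OF assms] by simp
  finally show ?thesis .
qed

lemma mult_regroup: "a * b * c = e \<Longrightarrow> a * (b * x * (c * y)) = e * (x * y)"
  for a :: "'a::comm_ring_1"
  by (auto simp: mult_ac)

text \<open>
  Distributing labels among the trees of a forest is the binomial convolution that exponential
  generating functions turn into a product.
\<close>
lemma gf_forests_on_power: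
  assumes "finite U" "\<And>V. V \<subseteq> U \<Longrightarrow> gf_trees_on V = fps_const (fact (card V)) * tree_gf $ card V"
  shows "gf_forests_on l U = fps_const (fact (card U)) * (tree_gf ^ l) $ card U"
  using assms
proof (induction l arbitrary: U)
  case 0
  then show ?case by (auto simp: gf_forests_on_0)
next
  case (Suc l)
  have "gf_forests_on (Suc l) U = (\<Sum>V\<in>Pow U. fps_const (fact (card V)) * tree_gf $ card V *
      (fps_const (fact (card U - card V)) * (tree_gf ^ l) $ (card U - card V)))"
    unfolding gf_forests_on_Suc[OF Suc.prems(1)]
  proof (intro sum.cong refl)
    fix V assume V: "V \<in> Pow U"
    then have "card (U - V) = card U - card V"
      using Suc.prems(1) by (auto intro!: card_Diff_subset intro: finite_subset)
    moreover have "gf_forests_on l (U - V) = fps_const (fact (card (U - V))) * (tree_gf ^ l) $ card (U - V)"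
      using Suc.prems by (intro Suc.IH) auto
    ultimately show "gf_trees_on V * gf_forests_on l (U - V) = fps_const (fact (card V)) * tree_gf $ card V *
      (fps_const (fact (card U - card V)) * (tree_gf ^ l) $ (card U - card V))"
      using Suc.prems(2)[of V] V by simp
  qed
  also have "\<dots> = (\<Sum>i\<le>card U. of_nat (card U choose i) * (fps_const (fact i) * tree_gf $ i *
      (fps_const (fact (card U - i)) * (tree_gf ^ l) $ (card U - i))))"
    by (rule sum_Pow_by_card[OF Suc.prems(1)])
  also have "\<dots> = (\<Sum>i\<le>card U. fps_const (fact (card U)) * (tree_gf $ i * (tree_gf ^ l) $ (card U - i)))"
  proof (intro sum.cong refl)
    fix i assume "i \<in> {..card U}"
    then have "real (card U choose i) * fact i * fact (card U - i) = fact (card U)"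
      using arg_cong[OF binomial_fact_lemma[of i "card U"], of real] by (simp add: mult_ac)
    then have "fps_const (real (card U choose i)) * fps_const (fact i) * fps_const (fact (card U - i)) = fps_const (fact (card U))"
      by simp
    then have "of_nat (card U choose i) * fps_const (fact i) * fps_const (fact (card U - i)) = fps_const (fact (card U) :: real)"
      by (metis fps_of_nat)
    then show "of_nat (card U choose i) * (fps_const (fact i) * tree_gf $ i *
      (fps_const (fact (card U - i)) * (tree_gf ^ l) $ (card U - i))) = fps_const (fact (card U)) * (tree_gf $ i * (tree_gf ^ l) $ (card U - i))"
      by (rule mult_regroup)
  qed
  finally show ?case by (simp add: fps_mult_nth sum_distrib_left atLeast0AtMost)
qed

text \<open>
  The ranks of the elements of \<open>S\<close> are \<open>0, ..., card S - 1\<close>, each attained once; hence the rank of the root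
  label is uniform.
\<close>
lemma sum_over_ranks:
  fixes g :: "nat \<Rightarrow> 'a::comm_monoid_add" and S :: "nat set"
  assumes "finite S"
  shows "(\<Sum>a\<in>S. g (card {j \<in> S. j < a})) = (\<Sum>i<card S. g i)"
  using assms
proof (induction "card S" arbitrary: S)
  case 0
  then show ?case by simp
next
  case (Suc n)
  define m where "m = Max S"
  have ne: "S \<noteq> {}" using Suc.hyps(2) by auto
  have m: "m \<in> S" "\<And>x. x \<in> S \<Longrightarrow> x \<le> m" using Max_in[OF Suc.prems ne] Suc.prems by (auto simp: m_def)
  have c: "card (S - {m}) = n" using Suc.hyps(2) m Suc.prems by simp
  have "{j \<in> S. j < m} = S - {m}" using m by (auto simp: order_less_le)
  moreover have "(\<Sum>a\<in>S - {m}. g (card {j \<in> S. j < a})) = (\<Sum>a\<in>S - {m}. g (card {j \<in> S - {m}. j < a}))"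
    using m by (intro sum.cong arg_cong[of _ _ g] arg_cong[of _ _ card]) (auto dest: leD)
  moreover have "\<dots> = (\<Sum>i<n. g i)" using Suc.hyps(1)[of "S - {m}"] c Suc.prems by simp
  ultimately show ?case using m Suc.prems c Suc.hyps(2)[symmetric] by (simp add: sum.remove[of S m] add_ac)
qed

text \<open>
  The right-hand side depends on \<open>S\<close> through its cardinality only, which closes the induction in
  \<open>gf_trees_on_eq\<close>.
\<close>
lemma gf_trees_on_eq_aux:
  assumes "finite S" "\<And>V. V \<subset> S \<Longrightarrow> gf_trees_on V = fps_const (fact (card V)) * tree_gf $ card V"
  shows "gf_trees_on S = fps_const (fact (card S - 1)) * (\<Sum>i<card S. fps_exp (real i)) *
           (\<Sum>l<card S. fps_const (\<phi> l) * (tree_gf ^ l) $ (card S - 1))"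
proof -
  have "gf_trees_on S = (\<Sum>a\<in>S. fps_exp (real (card {j \<in> S. j < a})) *
           (\<Sum>l<card S. fps_const (\<phi> l) * (fps_const (fact (card S - 1)) * (tree_gf ^ l) $ (card S - 1))))"
    unfolding gf_trees_on_decomp[OF assms(1)]
  proof (intro sum.cong refl arg_cong2[of _ _ _ _ "(*)"])
    fix a l assume a: "a \<in> S"
    then have "gf_forests_on l (S - {a}) = fps_const (fact (card (S - {a}))) * (tree_gf ^ l) $ card (S - {a})"
      using assms by (intro gf_forests_on_power) auto
    then show "gf_forests_on l (S - {a}) = fps_const (fact (card S - 1)) * (tree_gf ^ l) $ (card S - 1)"
      using a assms by simp
  qed
  also have "\<dots> = (\<Sum>i<card S. fps_exp (real i)) *
           (\<Sum>l<card S. fps_const (\<phi> l) * (fps_const (fact (card S - 1)) * (tree_gf ^ l) $ (card S - 1)))"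
    unfolding sum_distrib_right[symmetric]
    by (subst sum_over_ranks[OF assms(1), where g = "\<lambda>i. fps_exp (real i)"]) (rule refl)
  also have "(\<Sum>l<card S. fps_const (\<phi> l) * (fps_const (fact (card S - 1)) * (tree_gf ^ l) $ (card S - 1))) =
      fps_const (fact (card S - 1)) * (\<Sum>l<card S. fps_const (\<phi> l) * (tree_gf ^ l) $ (card S - 1))"
    unfolding sum_distrib_left by (simp only: mult.left_commute)
  finally show ?thesis by (simp only: mult_ac)
qed

theorem gf_trees_on_eq:
  "finite S \<Longrightarrow> gf_trees_on S = fps_const (fact (card S)) * tree_gf $ card S"
proof (induction "card S" arbitrary: S rule: less_induct)
  case less
  have IH: "gf_trees_on V = fps_const (fact (card V)) * tree_gf $ card V"
    if "V \<subset> W" "card W = card S" "finite W" for V W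
    using less.hyps[of V] that psubset_card_mono[of W V] finite_subset[of V W] by auto
  have "gf_trees_on S = gf_trees_on {1..card S}"
    using less.prems
    by (subst (1 2) gf_trees_on_eq_aux)
       (simp_all add: IH)
  also have "\<dots> = fps_const (fact (card S)) * tree_gf $ card S"
    by (simp add: tree_gf_def flip: mult.assoc)
  finally show ?case .
qed

theorem tree_gf_recursion:
  assumes "n > 0"
  shows "tree_gf $ n = fps_const (1 / real n) * (\<Sum>i<n. fps_exp (real i)) * (\<Sum>l<n. fps_const (\<phi> l) * (tree_gf ^ l) $ (n - 1))"
proof -
  have "gf_trees_on {1..n} = fps_const (fact (n - 1)) * (\<Sum>i<n. fps_exp (real i)) *
           (\<Sum>l<n. fps_const (\<phi> l) * (tree_gf ^ l) $ (n - 1))"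
    using gf_trees_on_eq by (subst gf_trees_on_eq_aux) (auto intro: finite_subset[OF psubset_imp_subset])
  moreover have "1 / fact n * fact (n - 1) = 1 / real n"
    using assms by (simp add: fact_reduce[of n])
  ultimately show ?thesis
    unfolding tree_gf_def fps_nth_Abs_fps by (simp flip: mult.assoc)
qed

lemma tree_gf_0: "tree_gf $ 0 = 0"
  by (simp add: tree_gf_def gf_trees_on_def trees_on_empty)

text \<open>
  If all admissible degrees are multiples of \<open>d\<close>, the number of non-root vertices, being the sum of all
  degrees, is one as well.
\<close>
lemma weight_nonzero_size:
  assumes "\<And>l. \<phi> l \<noteq> 0 \<Longrightarrow> d dvd l"
  shows "weight \<phi> t \<noteq> 0 \<Longrightarrow> d dvd length (labels t) - 1"
proof (induction t)
  case (Node a ts)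
  have "\<phi> (length ts) \<noteq> 0" using Node.prems by auto
  then have "d dvd length ts" by (rule assms)
  moreover have "d dvd length (labels t) - 1" if "t \<in> set ts" for t
    using Node.prems that by (intro Node.IH) (auto simp: prod_list_zero_iff)
  then have "d dvd (\<Sum>t\<leftarrow>ts. length (labels t) - 1)"
    by (induction ts) auto
  moreover have "(\<Sum>t\<leftarrow>ts. length (labels t)) = length ts + (\<Sum>t\<leftarrow>ts. length (labels t) - 1)"
  proof (induction ts)
    case (Cons t ts)
    then show ?case using labels_ne[of t] by (cases "labels t") auto
  qed simp
  ultimately show ?case by (simp add: length_concat comp_def)
qed

end

text \<open>
  Exchange of the two variables of a bivariate series: the recursion lives in series in the size with
  coefficients in \<open>u\<close>, the asymptotics in series in \<open>u\<close> with coefficients in the size.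
\<close>
definition fps_swap :: "'a::comm_ring_1 fps fps \<Rightarrow> 'a fps fps" where
  "fps_swap F = Abs_fps (\<lambda>r. Abs_fps (\<lambda>n. F $ n $ r))"

lemma fps_swap_nth: "fps_swap F $ r $ n = F $ n $ r"
  by (simp add: fps_swap_def)

lemma fps_swap_mult: "fps_swap (F * G) = fps_swap F * fps_swap G"
  by (intro fps_ext, simp add: fps_swap_nth fps_mult_nth fps_sum_nth, rule sum.swap)

lemma fps_swap_1: "fps_swap 1 = 1"
  by (intro fps_ext) (simp add: fps_swap_nth)

lemma fps_swap_power: "fps_swap (F ^ p) = fps_swap F ^ p"
  by (induction p) (simp_all add: fps_swap_1 fps_swap_mult)

text \<open>
  The moment of order \<open>r\<close> of a uniform variable on \<open>{0..<n}\<close>, divided by \<open>r!\<close>.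
\<close>
definition uniform_moment :: "nat \<Rightarrow> nat \<Rightarrow> real" where
  "uniform_moment n r = (\<Sum>i<n. real i ^ r / fact r) / real n"

definition inversion_moment :: "(nat \<Rightarrow> real) \<Rightarrow> nat \<Rightarrow> nat \<Rightarrow> real" where
  "inversion_moment \<phi> n r =
     (\<Sum>T\<in>labelled_trees n. weight \<phi> T * real (card (inversions T)) ^ r) / (fact n * fact r)"

definition moment_gf :: "(nat \<Rightarrow> real) \<Rightarrow> nat \<Rightarrow> real fps fps" where
  "moment_gf \<phi> d = Abs_fps (\<lambda>r. Abs_fps (\<lambda>k. inversion_moment \<phi> (k * d + 1) r))"

lemma tree_gf_nth_nth: "tree_gf \<phi> $ n $ r = inversion_moment \<phi> n r"
  by (simp add: tree_gf_def gf_trees_on_def gf_tree_def inversion_moment_def fps_sum_nth labelled_trees_eq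
      sum_divide_distrib sum_distrib_left)

text \<open>
  All sizes that occur are \<open>k * d + 1\<close>, so \<open>tree_gf\<close> is \<open>z P(z ^ d)\<close> with a series \<open>P\<close>.  The recursion is
  rewritten for \<open>P\<close> and the coefficient of \<open>u ^ r\<close> is extracted.
\<close>
theorem moment_gf_recursion:
  assumes d: "d > 0" and supp: "\<And>l. \<phi> l \<noteq> 0 \<Longrightarrow> d dvd l"
  shows "moment_gf \<phi> d $ r $ k =
     (\<Sum>i\<le>r. uniform_moment (k * d + 1) i *
        twisted_sum (\<lambda>m. \<phi> (d * m)) (\<lambda>m. (moment_gf \<phi> d ^ (d * m)) $ (r - i)) $ k)"
proof -
  define P where "P = Abs_fps (\<lambda>k. tree_gf \<phi> $ (k * d + 1))"
  have swap: "fps_swap P = moment_gf \<phi> d"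
    by (intro fps_ext) (simp add: fps_swap_nth P_def moment_gf_def tree_gf_nth_nth)
  have F0: "tree_gf \<phi> $ n = 0" if "n = 0 \<or> \<not> d dvd (n - 1)" for n
  proof (cases "n = 0")
    case False
    have "weight \<phi> T = 0" if "T \<in> labelled_trees n" for T
      using weight_nonzero_size[of \<phi> d T] supp that \<open>n = 0 \<or> \<not> d dvd (n - 1)\<close> False
      by (auto simp: labelled_trees_def)
    then show ?thesis by (intro fps_ext) (simp add: tree_gf_nth_nth inversion_moment_def)
  qed (simp add: tree_gf_0)
  have F: "tree_gf \<phi> = fps_X * (P oo fps_X ^ d)"
  proof (rule fps_ext)
    fix n
    show "tree_gf \<phi> $ n = (fps_X * (P oo fps_X ^ d)) $ n"
      using F0[of n] d by (cases n) (auto simp: fps_nth_compose_X_power P_def)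
  qed
  have pow: "(tree_gf \<phi> ^ (d * m)) $ (d * k) = (P ^ (d * m)) $ (k - m)" if "m \<le> k" for m k
  proof -
    have "tree_gf \<phi> ^ (d * m) = fps_X ^ (d * m) * (P ^ (d * m) oo fps_X ^ d)"
      unfolding F power_mult_distrib using d by (subst fps_compose_power) auto
    then show ?thesis using that d
      by (simp add: fps_X_power_mult_nth fps_nth_compose_X_power flip: diff_mult_distrib2)
  qed
  have "P $ k = tree_gf \<phi> $ (d * k + 1)" by (simp add: P_def mult.commute)
  also have "\<dots> = fps_const (1 / real (d * k + 1)) * (\<Sum>i<d * k + 1. fps_exp (real i)) *
      (\<Sum>l<d * k + 1. fps_const (\<phi> l) * (tree_gf \<phi> ^ l) $ (d * k))"
    by (subst tree_gf_recursion) auto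
  also have "(\<Sum>l<d * k + 1. fps_const (\<phi> l) * (tree_gf \<phi> ^ l) $ (d * k)) =
      (\<Sum>l\<in>(\<lambda>m. d * m) ` {..k}. fps_const (\<phi> l) * (tree_gf \<phi> ^ l) $ (d * k))"
  proof (rule sum.mono_neutral_right)
    show "\<forall>l\<in>{..<d * k + 1} - (\<lambda>m. d * m) ` {..k}. fps_const (\<phi> l) * (tree_gf \<phi> ^ l) $ (d * k) = 0"
    proof
      fix l assume l: "l \<in> {..<d * k + 1} - (\<lambda>m. d * m) ` {..k}"
      have "\<not> d dvd l"
      proof
        assume "d dvd l"
        then obtain q where q: "l = d * q" by (auto simp: dvd_def)
        with l d have "q \<le> k" by (simp add: less_Suc_eq_le)
        with l q show False by auto
      qed
      then have "\<phi> l = 0" using supp by blast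
      then show "fps_const (\<phi> l) * (tree_gf \<phi> ^ l) $ (d * k) = 0" by simp
    qed
  qed (use d in \<open>auto simp: less_Suc_eq_le\<close>)
  also have "\<dots> = (\<Sum>m\<le>k. fps_const (\<phi> (d * m)) * (P ^ (d * m)) $ (k - m))"
    using d by (subst sum.reindex) (auto simp: inj_on_def pow)
  finally have P: "P $ k = fps_const (1 / real (d * k + 1)) * (\<Sum>i<d * k + 1. fps_exp (real i)) *
      (\<Sum>m\<le>k. fps_const (\<phi> (d * m)) * (P ^ (d * m)) $ (k - m))" .
  have 1: "(fps_const (1 / real (d * k + 1)) * (\<Sum>i<d * k + 1. fps_exp (real i))) $ i = uniform_moment (k * d + 1) i" for i
    unfolding fps_mult_left_const_nth fps_sum_nth fps_exp_nth uniform_moment_def by (simp add: mult.commute)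
  have 2: "(\<Sum>m\<le>k. fps_const (\<phi> (d * m)) * (P ^ (d * m)) $ (k - m)) $ s =
     twisted_sum (\<lambda>m. \<phi> (d * m)) (\<lambda>m. (moment_gf \<phi> d ^ (d * m)) $ s) $ k" for s
    by (simp add: fps_sum_nth twisted_sum_nth fps_swap_nth flip: swap fps_swap_power)
  have "moment_gf \<phi> d $ r $ k = P $ k $ r" by (simp add: fps_swap_nth flip: swap)
  also have "\<dots> = (\<Sum>i\<le>r. uniform_moment (k * d + 1) i *
        twisted_sum (\<lambda>m. \<phi> (d * m)) (\<lambda>m. (moment_gf \<phi> d ^ (d * m)) $ (r - i)) $ k)"
    unfolding P by (subst fps_mult_nth) (simp only: 1 2 atLeast0AtMost)
  finally show ?thesis .
qed

section \<open>A local limit theorem\<close>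

lemma fps_mult_sums:
  fixes F G :: "'a::{real_normed_field, banach} fps"
  assumes "summable (\<lambda>n. norm (F $ n))" "summable (\<lambda>n. norm (G $ n))"
  shows "(\<lambda>n. (F * G) $ n) sums ((\<Sum>n. F $ n) * (\<Sum>n. G $ n))"
    and "summable (\<lambda>n. norm ((F * G) $ n))"
proof -
  show "(\<lambda>n. (F * G) $ n) sums ((\<Sum>n. F $ n) * (\<Sum>n. G $ n))"
    using Cauchy_product_sums[OF assms] by (simp add: fps_mult_nth atLeast0AtMost)
  have "summable (\<lambda>n. \<Sum>i\<le>n. norm (F $ i) * norm (G $ (n - i)))"
    using summable_Cauchy_product[of "\<lambda>n. norm (F $ n)" "\<lambda>n. norm (G $ n)"] assms by simp
  then show "summable (\<lambda>n. norm ((F * G) $ n))"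
    by (rule summable_comparison_test'[where N = 0])
       (auto simp: fps_mult_nth atLeast0AtMost norm_mult intro!: order_trans[OF norm_sum] sum_mono)
qed

lemma fps_power_sums:
  fixes F :: "'a::{real_normed_field, banach} fps"
  assumes "summable (\<lambda>n. norm (F $ n))"
  shows "(\<lambda>n. (F ^ N) $ n) sums ((\<Sum>n. F $ n) ^ N) \<and> summable (\<lambda>n. norm ((F ^ N) $ n))"
proof (induction N)
  case 0
  have "(\<lambda>n. if n = 0 then (\<lambda>_. 1) n else 0) sums (1::'a)" by (rule sums_single)
  moreover have "summable (\<lambda>n. if n = 0 then (\<lambda>_. 1) n else (0::real))" by (rule sums_summable[OF sums_single])
  ultimately show ?case by (simp add: if_distrib cong: if_cong)
next
  case (Suc N)
  with fps_mult_sums[OF assms, of "F ^ N"] show ?case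
    by (auto simp: sums_iff)
qed

lemma fps_power_twist:
  fixes F G :: "'a::comm_ring_1 fps"
  assumes "\<And>n. G $ n = F $ n * c ^ n"
  shows "(G ^ N) $ n = (F ^ N) $ n * c ^ n"
proof (induction N arbitrary: n)
  case (Suc N)
  have "(G ^ Suc N) $ n = (\<Sum>i=0..n. F $ i * c ^ i * ((F ^ N) $ (n - i) * c ^ (n - i)))"
    by (simp add: fps_mult_nth assms Suc)
  also have "\<dots> = (\<Sum>i=0..n. F $ i * (F ^ N) $ (n - i) * c ^ n)"
  proof (intro sum.cong refl)
    fix i assume "i \<in> {0..n}"
    then have "c ^ n = c ^ i * c ^ (n - i)" by (simp flip: power_add)
    then show "F $ i * c ^ i * ((F ^ N) $ (n - i) * c ^ (n - i)) = F $ i * (F ^ N) $ (n - i) * c ^ n"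
      by (simp only: mult_ac)
  qed
  also have "\<dots> = (F ^ Suc N) $ n * c ^ n"
    by (simp add: fps_mult_nth sum_distrib_right)
  finally show ?case .
qed (auto simp: assms)

lemma fps_power_of_real:
  "((Abs_fps (\<lambda>n. complex_of_real (F $ n))) ^ N) $ n = complex_of_real ((F ^ N) $ n)"
proof (induction N arbitrary: n)
  case (Suc N)
  then show ?case by (simp add: fps_mult_nth)
qed simp

lemma fps_power_nonneg:
  fixes F :: "real fps"
  assumes "\<And>n. F $ n \<ge> 0"
  shows "(F ^ N) $ n \<ge> 0"
proof (induction N arbitrary: n)
  case (Suc N)
  then show ?case using assms by (auto simp: fps_mult_nth intro!: sum_nonneg)
qed simp

lemma integral_cis:
  "(\<integral>\<theta>. indicator {-pi..pi} \<theta> *\<^sub>R cis (of_int j * \<theta>) \<partial>lborel) = (if j = 0 then 2 * pi else 0)"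
proof (cases "j = 0")
  case True
  then show ?thesis by (simp add: measure_def scaleR_conv_of_real)
next
  case False
  have "(\<integral>\<theta>. indicator {-pi..pi} \<theta> *\<^sub>R cis (of_int j * \<theta>) \<partial>lborel) =
        cis (of_int j * pi) / (\<i> * of_int j) - cis (of_int j * (- pi)) / (\<i> * of_int j)"
  proof (rule integral_FTC_atLeastAtMost)
    fix x :: real
    have "((\<lambda>z. exp (\<i> * of_int j * z) / (\<i> * of_int j)) has_field_derivative exp (\<i> * of_int j * of_real x)) (at (of_real x))"
      using False by (auto intro!: derivative_eq_intros)
    from has_vector_derivative_real_field[OF this]
    show "((\<lambda>x. cis (of_int j * x) / (\<i> * of_int j)) has_vector_derivative cis (of_int j * x)) (at x within {-pi..pi})"
      by (simp add: cis_conv_exp mult.assoc)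
  qed (auto intro!: continuous_intros)
  also have "cis (of_int j * (- pi)) = cis (of_int j * pi)"
  proof -
    have "cis (of_int j * pi) = cis (of_int j * (- pi)) * cis (2 * pi * of_int j)"
      by (simp add: cis_mult algebra_simps)
    then show ?thesis by (simp add: cis_multiple_2pi)
  qed
  finally show ?thesis using False by simp
qed

text \<open>
  A probability distribution on the natural numbers, given by its generating function \<open>\<psi>\<close>; the
  coefficients of \<open>\<psi> ^ N\<close> are the point probabilities of a sum of \<open>N\<close> independent copies.
\<close>
locale lattice_distribution =
  fixes \<psi> :: "real fps"
  assumes nonneg: "\<psi> $ m \<ge> 0"
    and sums_1: "(\<lambda>m. \<psi> $ m) sums 1"
begin

definition cf :: "real \<Rightarrow> complex" where
  "cf \<theta> = (\<Sum>m. of_real (\<psi> $ m) * cis (real m * \<theta>))"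

lemma summable_cf: "summable (\<lambda>m. norm (of_real (\<psi> $ m) * cis (real m * \<theta>)))"
  using sums_1 nonneg by (simp add: norm_mult sums_iff)

lemma cf_sums: "(\<lambda>m. of_real (\<psi> $ m) * cis (real m * \<theta>)) sums cf \<theta>"
  unfolding cf_def by (rule summable_sums[OF summable_norm_cancel[OF summable_cf]])

lemma cf_power_sums: "(\<lambda>m. of_real ((\<psi> ^ N) $ m) * cis (real m * \<theta>)) sums (cf \<theta> ^ N)"
proof -
  define G where "G = Abs_fps (\<lambda>m. of_real (\<psi> $ m) * cis (real m * \<theta>))"
  have "(G ^ N) $ m = of_real ((\<psi> ^ N) $ m) * cis \<theta> ^ m" for m
    unfolding fps_power_of_real[symmetric]
    by (rule fps_power_twist) (simp add: G_def Complex.DeMoivre)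
  moreover have "(\<lambda>m. (G ^ N) $ m) sums ((\<Sum>m. G $ m) ^ N)"
    using summable_cf by (intro fps_power_sums[THEN conjunct1]) (simp add: G_def)
  ultimately show ?thesis by (simp add: G_def cf_def Complex.DeMoivre)
qed

lemma power_sums_1: "(\<lambda>m. (\<psi> ^ N) $ m) sums 1"
  using fps_power_sums[of \<psi> N] sums_1 nonneg by (simp add: sums_iff)

lemma cf_measurable [measurable]: "cf \<in> borel_measurable borel"
  unfolding cf_def by (intro borel_measurable_suminf borel_measurable_continuous_onI continuous_intros)

lemma norm_cf_le_1: "norm (cf \<theta>) \<le> 1"
proof -
  have "norm (cf \<theta>) \<le> (\<Sum>m. norm (of_real (\<psi> $ m) * cis (real m * \<theta>)))"
    unfolding cf_def by (rule summable_norm[OF summable_cf])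
  also have "\<dots> = 1" using sums_1 nonneg by (simp add: norm_mult sums_iff)
  finally show ?thesis .
qed

lemma fourier_coeff:
  "(\<integral>\<theta>. indicator {-pi..pi} \<theta> *\<^sub>R (cf \<theta> ^ N * cis (- real k * \<theta>)) \<partial>lborel) = 2 * pi * (\<psi> ^ N) $ k"
proof -
  define f where "f m \<theta> = indicator {-pi..pi} \<theta> *\<^sub>R (of_real ((\<psi> ^ N) $ m) * cis (of_int (int m - int k) * \<theta>))" for m \<theta>
  have fi: "integrable lborel (f m)" for m
    unfolding f_def
    by (rule borel_integrable_atLeastAtMost'[unfolded set_integrable_def]) (auto intro!: continuous_intros)
  have nf: "norm (f m \<theta>) = indicator {-pi..pi} \<theta> * (\<psi> ^ N) $ m" for m \<theta>
    using fps_power_nonneg[of \<psi> N m] nonneg by (simp add: f_def norm_mult)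
  have "(\<lambda>m. integral\<^sup>L lborel (f m)) sums (\<integral>\<theta>. (\<Sum>m. f m \<theta>) \<partial>lborel)"
  proof (rule sums_integral[OF fi])
    show "AE \<theta> in lborel. summable (\<lambda>m. norm (f m \<theta>))"
      unfolding nf using power_sums_1[of N] by (auto intro!: summable_mult simp: sums_iff)
    have "(\<integral>\<theta>. norm (f m \<theta>) \<partial>lborel) = 2 * pi * (\<psi> ^ N) $ m" for m
      unfolding nf by (simp add: measure_def)
    then show "summable (\<lambda>m. \<integral>\<theta>. norm (f m \<theta>) \<partial>lborel)"
      using power_sums_1[of N] by (auto intro!: summable_mult simp: sums_iff)
  qed
  moreover have "(\<Sum>m. f m \<theta>) = indicator {-pi..pi} \<theta> *\<^sub>R (cf \<theta> ^ N * cis (- real k * \<theta>))" for \<theta>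
  proof -
    have "(\<lambda>m. indicator {-pi..pi} \<theta> *\<^sub>R (of_real ((\<psi> ^ N) $ m) * cis (real m * \<theta>) * cis (- real k * \<theta>)))
        sums (indicator {-pi..pi} \<theta> *\<^sub>R (cf \<theta> ^ N * cis (- real k * \<theta>)))"
      by (intro sums_scaleR_right sums_mult2 cf_power_sums)
    moreover have "of_real ((\<psi> ^ N) $ m) * cis (real m * \<theta>) * cis (- real k * \<theta>) =
       of_real ((\<psi> ^ N) $ m) * cis (of_int (int m - int k) * \<theta>)" for m
      by (simp add: mult.assoc cis_mult left_diff_distrib)
    ultimately show ?thesis unfolding f_def by (simp only: sums_iff)
  qed
  moreover have "integral\<^sup>L lborel (f m) = (if m = k then 2 * pi * (\<psi> ^ N) $ m else 0)" for m
  proof -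
    have "integral\<^sup>L lborel (f m) = of_real ((\<psi> ^ N) $ m) * (\<integral>\<theta>. indicator {-pi..pi} \<theta> *\<^sub>R cis (of_int (int m - int k) * \<theta>) \<partial>lborel)"
      unfolding f_def by (subst integral_mult_right_zero[symmetric]) (simp add: scaleR_conv_of_real mult_ac)
    then show ?thesis unfolding integral_cis by auto
  qed
  moreover have "(\<lambda>m. if m = k then 2 * pi * (\<psi> ^ N) $ m else 0 :: complex) sums (2 * pi * (\<psi> ^ N) $ k)"
    by (rule sums_of_real[OF sums_single])
  ultimately show ?thesis by (simp add: sums_iff)
qed

text \<open>
  Only the two atoms \<open>0\<close> and \<open>m\<close> are used: by the triangle inequality the loss in \<open>1 - norm (cf \<theta>)\<close> is
  at least the loss from adding these two terms with phases \<open>0\<close> and \<open>m * \<theta>\<close>.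
\<close>
lemma norm_cf_sin_bound:
  assumes "\<psi> $ 0 > 0" "\<psi> $ m > 0" "m > 0"
  obtains K where "K \<ge> 0" "\<And>\<theta>. sin (real m * \<theta> / 2) ^ 2 \<le> K * (1 - norm (cf \<theta>))"
proof
  define a where "a = \<psi> $ 0"
  define b where "b = \<psi> $ m"
  have ab: "a > 0" "b > 0" using assms by (auto simp: a_def b_def)
  show "(a + b) / (2 * a * b) \<ge> 0" using ab by simp
  fix \<theta>
  define x where "x = real m * \<theta>"
  \<comment> \<open>from \<open>norm (a + b * cis x) ^ 2 = (a + b) ^ 2 - 4 * a * b * sin (x / 2) ^ 2\<close> and \<open>sqrt (y ^ 2 - 2 * y * s) \<le> y - s\<close>\<close>
  define s where "s = 2 * a * b * sin (x / 2) ^ 2 / (a + b)"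
  have split: "(\<Sum>j. f j) = (\<Sum>j\<in>{0, m}. f j) + (\<Sum>j. if j \<in> {0, m} then 0 else f j)"
    if "summable f" for f :: "nat \<Rightarrow> 'a::banach"
  proof -
    have "(\<lambda>j. if j \<in> {0, m} then f j else 0) sums (\<Sum>j\<in>{0, m}. f j)"
      by (rule sums_If_finite_set) simp
    from sums_diff[OF summable_sums[OF that] this]
    have "(\<lambda>j. if j \<in> {0, m} then 0 else f j) sums ((\<Sum>j. f j) - (\<Sum>j\<in>{0, m}. f j))"
      by (rule sums_cong[THEN iffD1, rotated]) auto
    then show ?thesis by (simp add: sums_iff)
  qed
  let ?c = "\<lambda>j. of_real (\<psi> $ j) * cis (real j * \<theta>)"
  have sN: "summable (\<lambda>j. norm (if j \<in> {0, m} then 0 else ?c j))"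
    by (rule summable_comparison_test'[OF summable_cf[of \<theta>], where N = 0]) auto
  have "cf \<theta> = (a + b * cis x) + (\<Sum>j. if j \<in> {0, m} then 0 else ?c j)"
    unfolding cf_def using assms
    by (subst split) (auto simp: a_def b_def x_def intro: summable_norm_cancel[OF summable_cf])
  also have "norm \<dots> \<le> norm (a + b * cis x) + (\<Sum>j. norm (if j \<in> {0, m} then 0 else ?c j))"
    by (rule order_trans[OF norm_triangle_ineq add_left_mono[OF summable_norm[OF sN]]])
  also have "(\<lambda>j. norm (if j \<in> {0, m} then 0 else ?c j)) = (\<lambda>j. if j \<in> {0, m} then 0 else \<psi> $ j)"
    using nonneg by (auto simp: norm_mult)
  also have "(\<Sum>j. if j \<in> {0, m} then 0 else \<psi> $ j) = 1 - (a + b)"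
    using split[of "fps_nth \<psi>"] sums_1 assms by (simp add: sums_iff a_def b_def)
  also have "norm (a + b * cis x) \<le> (a + b) - s"
  proof (rule power2_le_imp_le)
    have "sin (x / 2) ^ 2 \<le> 1" by (simp add: abs_square_le_1)
    then have "s \<le> 2 * a * b * 1 / (a + b)" unfolding s_def using ab
      by (intro divide_right_mono mult_left_mono) auto
    also have "\<dots> \<le> a + b" using ab by (simp add: field_simps)
    finally show "0 \<le> a + b - s" by simp
    have c: "cos x = 1 - 2 * sin (x / 2) ^ 2" using cos_double_sin[of "x / 2"] by simp
    have "norm (a + b * cis x) ^ 2 = (a + b * cos x) ^ 2 + (b * sin x) ^ 2"
      by (simp add: cmod_def)
    also have "\<dots> = a ^ 2 + b ^ 2 * (sin x ^ 2 + cos x ^ 2) + 2 * a * b * cos x"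
      by algebra
    also have "\<dots> = a ^ 2 + b ^ 2 + 2 * a * b * cos x"
      unfolding sin_cos_squared_add by simp
    also have "\<dots> = (a + b) ^ 2 - 2 * (a + b) * s"
      unfolding s_def c using ab by (simp add: power2_eq_square field_simps)
    also have "\<dots> \<le> (a + b - s) ^ 2" by (simp add: power2_eq_square algebra_simps)
    finally show "norm (a + b * cis x) ^ 2 \<le> (a + b - s) ^ 2" .
  qed
  finally have "s \<le> 1 - norm (cf \<theta>)" by simp
  then have "(a + b) / (2 * a * b) * s \<le> (a + b) / (2 * a * b) * (1 - norm (cf \<theta>))"
    using ab by (intro mult_left_mono) auto
  then show "sin (real m * \<theta> / 2) ^ 2 \<le> (a + b) / (2 * a * b) * (1 - norm (cf \<theta>))"
    using ab by (simp add: s_def x_def)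
qed

lemma sin_add_bound: "sin (x + y) ^ 2 \<le> 2 * (sin x ^ 2 + sin (y::real) ^ 2)"
proof -
  have "sin (x + y) ^ 2 \<le> (\<bar>sin x\<bar> + \<bar>sin y\<bar>) ^ 2"
  proof (rule power2_le_iff_abs_le[THEN iffD2])
    have "\<bar>sin (x + y)\<bar> \<le> \<bar>sin x\<bar> * \<bar>cos y\<bar> + \<bar>cos x\<bar> * \<bar>sin y\<bar>"
      unfolding sin_add by (rule order_trans[OF abs_triangle_ineq]) (simp add: abs_mult)
    also have "\<dots> \<le> \<bar>sin x\<bar> * 1 + 1 * \<bar>sin y\<bar>"
      by (intro add_mono mult_mono) auto
    finally show "\<bar>sin (x + y)\<bar> \<le> \<bar>sin x\<bar> + \<bar>sin y\<bar>" by simp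
  qed simp
  also have "\<dots> \<le> 2 * (\<bar>sin x\<bar> ^ 2 + \<bar>sin y\<bar> ^ 2)"
    using sum_squares_bound[of "\<bar>sin x\<bar>" "\<bar>sin y\<bar>"] by (simp add: power2_sum)
  finally show ?thesis by simp
qed

lemma sin_half_lower_bound:
  assumes "0 \<le> x" "x \<le> pi"
  shows "x / 4 \<le> sin (x / 2)"
proof (cases "x = 0")
  case False
  with assms have "0 < x / 4" by simp
  from MVT2[OF this, of sin cos] obtain z where z: "0 < z" "z < x / 4" "sin (x / 4) = x / 4 * cos z"
    by auto
  have "cos (pi / 4) \<le> cos y" if "0 \<le> y" "y \<le> pi / 4" for y
    using that pi_gt_zero by (subst cos_mono_le_eq) auto
  moreover have "cos (pi / 4) > 1 / 2 \<and> cos (pi / 4) ^ 2 = (1 / 2 :: real)"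
    by (auto simp: cos_45 power_divide real_less_rsqrt)
  ultimately have c: "cos (pi / 4) \<le> cos z" "cos (pi / 4) \<le> cos (x / 4)" "cos (pi / 4) > 0" "cos (pi / 4) ^ 2 = (1 / 2 :: real)"
    using z assms by auto
  \<comment> \<open>the mean value theorem bounds the sine of \<open>x / 4\<close>, and the angle is doubled once\<close>
  have "x / 4 = 2 * (x / 4) * (cos (pi / 4) * cos (pi / 4))"
    using c(4) by (simp add: power2_eq_square)
  also have "\<dots> \<le> 2 * (x / 4) * (cos z * cos (x / 4))"
    using assms c by (intro mult_left_mono mult_mono) auto
  also have "\<dots> = 2 * sin (x / 4) * cos (x / 4)" using z by simp
  also have "\<dots> = sin (x / 2)" using sin_double[of "x / 4"] by simp
  finally show ?thesis .
qed simp

text \<open>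
  The integers \<open>j\<close> for which \<open>sin (j * \<theta> / 2) ^ 2\<close> is bounded by a multiple of \<open>1 - norm (cf \<theta>)\<close> are
  closed under differences and contain the support, hence its greatest common divisor \<open>1\<close>.  On
  \<open>[-pi, pi]\<close> the function \<open>sin (\<theta> / 2)\<close> is bounded below linearly.
\<close>
lemma norm_cf_gaussian_bound:
  assumes "\<psi> $ 0 > 0" "Gcd {m. \<psi> $ m > 0} = 1"
  obtains \<epsilon> where "\<epsilon> > 0" "\<And>\<theta>. \<bar>\<theta>\<bar> \<le> pi \<Longrightarrow> norm (cf \<theta>) \<le> exp (- \<epsilon> * \<theta> ^ 2)"
proof -
  define P where "P j \<longleftrightarrow> (\<exists>K\<ge>0. \<forall>\<theta>. sin (real j * \<theta> / 2) ^ 2 \<le> K * (1 - norm (cf \<theta>)))" for j :: nat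
  have diff: "P (i - j)" if "P i" "P j" "j \<le> i" for i j
  proof -
    from that obtain K L where K: "K \<ge> 0" "\<And>\<theta>. sin (real i * \<theta> / 2) ^ 2 \<le> K * (1 - norm (cf \<theta>))"
      and L: "L \<ge> 0" "\<And>\<theta>. sin (real j * \<theta> / 2) ^ 2 \<le> L * (1 - norm (cf \<theta>))"
      unfolding P_def by blast
    have "sin (real (i - j) * \<theta> / 2) ^ 2 \<le> (2 * (K + L)) * (1 - norm (cf \<theta>))" for \<theta>
      using sin_add_bound[of "real i * \<theta> / 2" "- (real j * \<theta> / 2)"] K(2)[of \<theta>] L(2)[of \<theta>] that(3)
      by (simp add: of_nat_diff algebra_simps diff_divide_distrib)
    then show ?thesis unfolding P_def using K L by (intro exI[of _ "2 * (K + L)"]) auto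
  qed
  have pos: "P m" if "\<psi> $ m > 0" "m > 0" for m
    using norm_cf_sin_bound[OF assms(1) that] unfolding P_def by metis
  have "\<exists>m>0. \<psi> $ m > 0"
  proof (rule ccontr)
    assume "\<not> ?thesis"
    then have "{m. \<psi> $ m > 0} \<subseteq> {0}" by auto
    then have "Gcd {m. \<psi> $ m > 0} = 0" by (simp add: Gcd_0_iff)
    then show False using assms by simp
  qed
  then obtain m0 where m0: "P m0" "m0 > 0" using pos by blast
  \<comment> \<open>the Euclidean algorithm: the least positive element divides every element of the support\<close>
  define g where "g = (LEAST g. P g \<and> g > 0)"
  have g: "P g" "g > 0" using LeastI[of "\<lambda>g. P g \<and> g > 0" m0] m0 unfolding g_def by auto
  have "g dvd Gcd {m. \<psi> $ m > 0}"
  proof (rule Gcd_greatest)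
    fix m assume "m \<in> {m. \<psi> $ m > 0}"
    then have "\<psi> $ m > 0" by simp
    have "P (m - q * g)" if "q * g \<le> m" "m > 0" for q
      using that
    proof (induction q)
      case 0
      then show ?case using pos \<open>\<psi> $ m > 0\<close> by simp
    next
      case (Suc q)
      then have "P (m - q * g)" "g \<le> m - q * g" by auto
      from diff[OF this(1) g(1) this(2)] show ?case by (simp add: add.commute)
    qed
    from this[of "m div g"] have "m > 0 \<Longrightarrow> P (m mod g)"
      by (simp add: minus_div_mult_eq_mod)
    moreover have "m mod g < g" using g by simp
    ultimately have "m > 0 \<Longrightarrow> m mod g = 0"
      using not_less_Least[of "m mod g" "\<lambda>g. P g \<and> g > 0"] unfolding g_def by auto
    then show "g dvd m" by (cases "m = 0") auto
  qed
  then have "P 1" using assms g by simp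
  then obtain K where K: "K \<ge> 0" "\<And>\<theta>. sin (\<theta> / 2) ^ 2 \<le> K * (1 - norm (cf \<theta>))" unfolding P_def by auto
  have "K \<noteq> 0" using K(2)[of pi] by auto
  with K have "K > 0" by simp
  show thesis
  proof (rule that[of "1 / (16 * K)"])
    show "1 / (16 * K) > 0" using \<open>K > 0\<close> by simp
    fix \<theta> :: real assume t: "\<bar>\<theta>\<bar> \<le> pi"
    have "(\<theta> / 4) ^ 2 \<le> sin (\<theta> / 2) ^ 2"
    proof (rule power2_le_iff_abs_le[THEN iffD2, OF _, of "\<bar>_\<bar>", unfolded power2_abs])
      have "\<bar>\<theta>\<bar> / 4 \<le> sin (\<bar>\<theta>\<bar> / 2)" using sin_half_lower_bound[of "\<bar>\<theta>\<bar>"] t by simp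
      then show "\<bar>\<theta> / 4\<bar> \<le> \<bar>sin (\<theta> / 2)\<bar>" by (cases "\<theta> \<ge> 0") auto
    qed simp
    also have "\<dots> \<le> K * (1 - norm (cf \<theta>))" by (rule K)
    finally have "norm (cf \<theta>) \<le> 1 + (- (1 / (16 * K)) * \<theta> ^ 2)"
      using \<open>K > 0\<close> by (simp add: field_simps power2_eq_square)
    also have "\<dots> \<le> exp (- (1 / (16 * K)) * \<theta> ^ 2)" by (rule exp_ge_add_one_self)
    finally show "norm (cf \<theta>) \<le> exp (- (1 / (16 * K)) * \<theta> ^ 2)" .
  qed
qed

text \<open>
  Taylor expansion of the exponential, integrated against the distribution: mass, mean and variance
  match those of the Gaussian, and the third absolute moment bounds the error.
\<close>
lemma centred_cf_approx:
  assumes mean: "(\<lambda>m. real m * \<psi> $ m) sums \<mu>"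
    and var: "(\<lambda>m. (real m - \<mu>) ^ 2 * \<psi> $ m) sums v"
    and third: "summable (\<lambda>m. \<bar>real m - \<mu>\<bar> ^ 3 * \<psi> $ m)"
  obtains C where "\<And>\<theta>. norm (cf \<theta> * cis (- \<mu> * \<theta>) - exp (- v * \<theta> ^ 2 / 2)) \<le> C * (\<bar>\<theta>\<bar> ^ 3 + \<theta> ^ 4)"
proof -
  define K where "K = (\<Sum>m. \<bar>real m - \<mu>\<bar> ^ 3 * \<psi> $ m)"
  have "K \<ge> 0" unfolding K_def using nonneg by (intro suminf_nonneg third) auto
  have "v \<ge> 0" using var nonneg sums_le[of "\<lambda>_. 0" "\<lambda>m. (real m - \<mu>) ^ 2 * \<psi> $ m" 0 v] by auto
  have bound: "norm (cf \<theta> * cis (- \<mu> * \<theta>) - exp (- v * \<theta> ^ 2 / 2)) \<le> K * \<bar>\<theta>\<bar> ^ 3 + v ^ 2 * \<theta> ^ 4" for \<theta>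
  proof -
    define x where "x m = (real m - \<mu>) * \<theta>" for m
    have "(\<lambda>m. of_real (\<psi> $ m) * cis (real m * \<theta>) * cis (- \<mu> * \<theta>)) sums (cf \<theta> * cis (- \<mu> * \<theta>))"
      by (intro sums_mult2 cf_sums)
    then have 1: "(\<lambda>m. of_real (\<psi> $ m) * cis (x m)) sums (cf \<theta> * cis (- \<mu> * \<theta>))"
      by (simp add: x_def mult.assoc cis_mult left_diff_distrib)
    have "(\<lambda>m. (real m * \<psi> $ m - \<mu> * \<psi> $ m) * \<theta>) sums ((\<mu> - \<mu> * 1) * \<theta>)"
      by (intro sums_mult2 sums_diff mean sums_mult sums_1)
    then have m0: "(\<lambda>m. \<psi> $ m * x m) sums 0" by (simp add: x_def algebra_simps)
    have v0: "(\<lambda>m. \<psi> $ m * (x m) ^ 2) sums (v * \<theta> ^ 2)"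
      using sums_mult2[OF var, of "\<theta> ^ 2"] by (simp add: x_def power_mult_distrib mult_ac)
    have 2: "(\<lambda>m. of_real (\<psi> $ m) + \<i> * of_real (\<psi> $ m * x m) - of_real (\<psi> $ m * (x m) ^ 2) / 2) sums
       (of_real 1 + \<i> * of_real 0 - of_real (v * \<theta> ^ 2) / 2)"
      by (intro sums_diff sums_add sums_mult sums_divide sums_of_real sums_1 m0 v0)
    have 3: "(\<lambda>m. of_real (\<psi> $ m) * (cis (x m) - (1 + \<i> * x m - (x m) ^ 2 / 2))) sums
       (cf \<theta> * cis (- \<mu> * \<theta>) - (1 - of_real (v * \<theta> ^ 2) / 2))"
      using sums_diff[OF 1 2] by (simp add: algebra_simps)
    have taylor: "norm (cis y - (1 + \<i> * y - y ^ 2 / 2)) \<le> \<bar>y\<bar> ^ 3" for y :: real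
    proof -
      have "norm (cis y - (1 + \<i> * y - y ^ 2 / 2)) \<le> \<bar>y\<bar> ^ 3 / 6"
        using iexp_approx1[of y 2] by (simp add: cis_conv_exp numeral_eq_Suc power2_eq_square algebra_simps)
      also have "\<dots> \<le> \<bar>y\<bar> ^ 3" by simp
      finally show ?thesis .
    qed
    have third': "summable (\<lambda>m. \<psi> $ m * \<bar>x m\<bar> ^ 3)" and third_sum: "(\<Sum>m. \<psi> $ m * \<bar>x m\<bar> ^ 3) = K * \<bar>\<theta>\<bar> ^ 3"
      using summable_mult2[OF third, of "\<bar>\<theta>\<bar> ^ 3"] suminf_mult2[OF third, of "\<bar>\<theta>\<bar> ^ 3"]
      by (simp_all add: x_def K_def power_mult_distrib abs_mult mult_ac)
    have "norm (cf \<theta> * cis (- \<mu> * \<theta>) - (1 - of_real (v * \<theta> ^ 2) / 2)) =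
       norm (\<Sum>m. of_real (\<psi> $ m) * (cis (x m) - (1 + \<i> * x m - (x m) ^ 2 / 2)))"
      using 3 by (simp add: sums_iff)
    also have "\<dots> \<le> (\<Sum>m. \<psi> $ m * \<bar>x m\<bar> ^ 3)"
      by (rule norm_suminf_le[OF _ third'])
         (use nonneg taylor in \<open>simp add: norm_mult mult_left_mono\<close>)
    finally have A: "norm (cf \<theta> * cis (- \<mu> * \<theta>) - (1 - of_real (v * \<theta> ^ 2) / 2)) \<le> K * \<bar>\<theta>\<bar> ^ 3"
      unfolding third_sum .
    define y where "y = v * \<theta> ^ 2 / 2"
    have "y \<ge> 0" using \<open>v \<ge> 0\<close> by (simp add: y_def)
    have "\<bar>exp (- y) - (1 - y)\<bar> \<le> y ^ 2"
    proof -
      have "exp (- y) \<ge> 1 - y" using exp_ge_add_one_self[of "- y"] by simp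
      moreover have "exp (- y) \<le> 1 - y + y ^ 2"
      proof -
        have "exp (- y) = 1 / exp y" by (simp add: exp_minus field_simps)
        also have "\<dots> \<le> 1 / (1 + y)" using \<open>y \<ge> 0\<close> exp_ge_add_one_self[of y] by (intro divide_left_mono) auto
        also have "\<dots> \<le> 1 - y + y ^ 2"
        proof -
          have "1 \<le> (1 - y + y ^ 2) * (1 + y)" using \<open>y \<ge> 0\<close> by (simp add: algebra_simps power2_eq_square)
          then show ?thesis using \<open>y \<ge> 0\<close> by (simp add: field_simps)
        qed
        finally show ?thesis .
      qed
      ultimately show ?thesis by simp
    qed
    also have "y ^ 2 \<le> v ^ 2 * \<theta> ^ 4"
      by (simp add: y_def power_divide power_mult_distrib power_mult[symmetric])
    finally have "norm (complex_of_real (exp (- y) - (1 - y))) \<le> v ^ 2 * \<theta> ^ 4"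
      unfolding norm_of_real .
    then have B: "norm ((1 - of_real (v * \<theta> ^ 2) / 2) - complex_of_real (exp (- v * \<theta> ^ 2 / 2))) \<le> v ^ 2 * \<theta> ^ 4"
      by (subst norm_minus_commute) (simp add: y_def)
    from norm_triangle_mono[OF A B] show ?thesis by simp
  qed
  show thesis
  proof (rule that[of "K + v ^ 2"])
    fix \<theta> :: real
    have "K * \<bar>\<theta>\<bar> ^ 3 + v ^ 2 * \<theta> ^ 4 \<le> (K + v ^ 2) * (\<bar>\<theta>\<bar> ^ 3 + \<theta> ^ 4)"
      using \<open>K \<ge> 0\<close> by (simp add: algebra_simps)
    with bound[of \<theta>] show "norm (cf \<theta> * cis (- \<mu> * \<theta>) - exp (- v * \<theta> ^ 2 / 2)) \<le> (K + v ^ 2) * (\<bar>\<theta>\<bar> ^ 3 + \<theta> ^ 4)"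
      by linarith
  qed
qed

lemma has_integral_gaussian:
  assumes "w > 0"
  shows "has_bochner_integral lborel (\<lambda>t. exp (- w * t ^ 2 / 2)) (sqrt (2 * pi / w))"
proof -
  have "has_bochner_integral lborel (\<lambda>t. sqrt (2 * pi / w) * normal_density 0 (1 / sqrt w) t) (sqrt (2 * pi / w) * 1)"
    using assms by (intro has_bochner_integral_mult_right) (auto simp: has_bochner_integral_iff)
  moreover have "sqrt (2 * pi / w) * normal_density 0 (1 / sqrt w) t = exp (- w * t ^ 2 / 2)" for t
    using assms by (simp add: normal_density_def power_divide real_sqrt_divide real_sqrt_mult field_simps)
  ultimately show ?thesis by simp
qed

text \<open>
  The sum of \<open>e + d * k\<close> copies of a variable with mean \<open>1 / d\<close> hits the value \<open>k\<close>, which differs from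
  its mean by the constant \<open>e / d\<close> only.  Fourier inversion, the substitution \<open>\<theta> = t / sqrt k\<close> and
  dominated convergence give the limit.
\<close>
theorem local_limit:
  assumes d: "d > 0" and pos: "\<psi> $ 0 > 0" and gcd: "Gcd {m. \<psi> $ m > 0} = 1"
    and mean: "(\<lambda>m. real m * \<psi> $ m) sums (1 / real d)"
    and var: "(\<lambda>m. (real m - 1 / real d) ^ 2 * \<psi> $ m) sums v" "v > 0"
    and third: "summable (\<lambda>m. \<bar>real m - 1 / real d\<bar> ^ 3 * \<psi> $ m)"
  shows "(\<lambda>k. sqrt (real k) * (\<psi> ^ (e + d * k)) $ k) \<longlonglongrightarrow> 1 / sqrt (2 * pi * real d * v)"
proof -
  define \<mu> where "\<mu> = 1 / real d"
  obtain C where C: "\<And>\<theta>. norm (cf \<theta> * cis (- \<mu> * \<theta>) - exp (- v * \<theta> ^ 2 / 2)) \<le> C * (\<bar>\<theta>\<bar> ^ 3 + \<theta> ^ 4)"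
    using centred_cf_approx[OF mean var(1) third] unfolding \<mu>_def by metis
  obtain \<epsilon> where eps: "\<epsilon> > 0" "\<And>\<theta>. \<bar>\<theta>\<bar> \<le> pi \<Longrightarrow> norm (cf \<theta>) \<le> exp (- \<epsilon> * \<theta> ^ 2)"
    using norm_cf_gaussian_bound[OF pos gcd] by metis
  define h where "h \<theta> = cf \<theta> * cis (- \<mu> * \<theta>)" for \<theta>
  \<comment> \<open>the value at \<open>k = 0\<close> is set to \<open>0\<close> so that the Gaussian majorant holds for every \<open>k\<close>\<close>
  define s where "s k t = (if k = 0 then 0 else indicator {-pi..pi} (t / sqrt (real k)) *\<^sub>R
      (cf (t / sqrt (real k)) ^ e * h (t / sqrt (real k)) ^ (d * k)))" for k t
  have h1: "norm (h \<theta>) \<le> 1" for \<theta> using norm_cf_le_1[of \<theta>] by (simp add: h_def norm_mult)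
  have integral_s: "integral\<^sup>L lborel (s k) = of_real (sqrt (real k) * (2 * pi * (\<psi> ^ (e + d * k)) $ k))" if "k > 0" for k
  proof -
    have sk: "s k = (\<lambda>t. indicator {-pi..pi} (t / sqrt (real k)) *\<^sub>R
      (cf (t / sqrt (real k)) ^ e * h (t / sqrt (real k)) ^ (d * k)))"
      using that by (simp add: s_def fun_eq_iff)
    have "complex_of_real (2 * pi * (\<psi> ^ (e + d * k)) $ k) =
        (\<integral>\<theta>. indicator {-pi..pi} \<theta> *\<^sub>R (cf \<theta> ^ (e + d * k) * cis (- real k * \<theta>)) \<partial>lborel)"
      using fourier_coeff[of "e + d * k" k] by simp
    also have "\<dots> = (\<integral>\<theta>. indicator {-pi..pi} \<theta> *\<^sub>R (cf \<theta> ^ e * h \<theta> ^ (d * k)) \<partial>lborel)"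
      unfolding h_def power_mult_distrib power_add Complex.DeMoivre using d by (simp add: \<mu>_def mult.assoc)
    also have "\<dots> = \<bar>1 / sqrt (real k)\<bar> *\<^sub>R (\<integral>t. s k t \<partial>lborel)"
      unfolding sk using that by (subst lborel_integral_real_affine[of "1 / sqrt (real k)" _ 0]) auto
    finally have "sqrt (real k) *\<^sub>R complex_of_real (2 * pi * (\<psi> ^ (e + d * k)) $ k) = (\<integral>t. s k t \<partial>lborel)"
      using that by simp
    then show ?thesis by (simp add: scaleR_conv_of_real)
  qed
  have "(\<lambda>k. integral\<^sup>L lborel (s k)) \<longlonglongrightarrow> (\<integral>t. complex_of_real (exp (- (real d * v) * t ^ 2 / 2)) \<partial>lborel)"
  proof (rule integral_dominated_convergence)
    show "(\<lambda>t. complex_of_real (exp (- (real d * v) * t ^ 2 / 2))) \<in> borel_measurable lborel" by measurable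
    show "s k \<in> borel_measurable lborel" for k
      unfolding s_def h_def cis_conv_exp by measurable
    show "integrable lborel (\<lambda>t. exp (- (2 * \<epsilon>) * t ^ 2 / 2))"
      using has_integral_gaussian[of "2 * \<epsilon>"] eps by (simp add: has_bochner_integral_iff)
    show "AE t in lborel. norm (s k t) \<le> exp (- (2 * \<epsilon>) * t ^ 2 / 2)" for k
    proof (cases "k = 0")
      case True
      then show ?thesis by (simp add: s_def)
    next
      case False
      have "norm (s k t) \<le> exp (- \<epsilon> * t ^ 2)" for t
      proof (cases "\<bar>t / sqrt (real k)\<bar> \<le> pi")
        case True
        define \<theta> where "\<theta> = t / sqrt (real k)"
        have "norm (s k t) \<le> norm (cf \<theta>) ^ e * norm (h \<theta>) ^ (d * k)"
          by (simp add: s_def \<theta>_def norm_mult norm_power indicator_def)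
        also have "\<dots> \<le> 1 * norm (h \<theta>) ^ k"
          using norm_cf_le_1[of \<theta>] h1[of \<theta>] d by (intro mult_mono power_le_one power_decreasing) auto
        also have "norm (h \<theta>) = norm (cf \<theta>)" by (simp add: h_def norm_mult)
        also have "1 * norm (cf \<theta>) ^ k \<le> 1 * exp (- \<epsilon> * \<theta> ^ 2) ^ k"
          using True by (intro mult_left_mono power_mono eps) (auto simp: \<theta>_def)
        also have "\<dots> = exp (- \<epsilon> * t ^ 2)"
          using False by (simp add: \<theta>_def power_divide flip: exp_of_nat_mult)
        finally show ?thesis .
      qed (auto simp: s_def indicator_def)
      then show ?thesis by simp
    qed
    show "AE t in lborel. (\<lambda>k. s k t) \<longlonglongrightarrow> complex_of_real (exp (- (real d * v) * t ^ 2 / 2))"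
    proof (intro AE_I2)
      fix t :: real
      have th0: "(\<lambda>k. t / sqrt (real k)) \<longlonglongrightarrow> 0" by real_asymp
      have "(\<lambda>k. C * (\<bar>t / sqrt (real k)\<bar> ^ 3 + (t / sqrt (real k)) ^ 4)) \<longlonglongrightarrow> C * (\<bar>0\<bar> ^ 3 + 0 ^ 4)"
        by (intro tendsto_intros th0)
      then have "(\<lambda>k. C * (\<bar>t / sqrt (real k)\<bar> ^ 3 + (t / sqrt (real k)) ^ 4)) \<longlonglongrightarrow> 0" by simp
      then have "(\<lambda>k. h (t / sqrt (real k)) - complex_of_real (exp (- v * (t / sqrt (real k)) ^ 2 / 2))) \<longlonglongrightarrow> 0"
        by (rule Lim_null_comparison[rotated]) (unfold h_def, intro always_eventually allI C)
      moreover have "(\<lambda>k. complex_of_real (exp (- v * (t / sqrt (real k)) ^ 2 / 2))) \<longlonglongrightarrow> complex_of_real (exp (- v * 0 ^ 2 / 2))"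
        by (intro tendsto_intros th0) auto
      ultimately have "(\<lambda>k. h (t / sqrt (real k))) \<longlonglongrightarrow> 1"
        using tendsto_add by fastforce
      moreover have "(\<lambda>k. cis (\<mu> * (t / sqrt (real k)))) \<longlonglongrightarrow> cis (\<mu> * 0)"
        by (intro tendsto_intros th0)
      ultimately have "(\<lambda>k. h (t / sqrt (real k)) * cis (\<mu> * (t / sqrt (real k)))) \<longlonglongrightarrow> 1 * cis (\<mu> * 0)"
        by (rule tendsto_mult)
      then have "(\<lambda>k. cf (t / sqrt (real k))) \<longlonglongrightarrow> 1"
        by (simp add: h_def mult.assoc cis_mult)
      then have "(\<lambda>k. cf (t / sqrt (real k)) ^ e) \<longlonglongrightarrow> 1 ^ e"
        by (rule tendsto_power)
      moreover have "(\<lambda>k. h (t / sqrt (real k)) ^ (d * k)) \<longlonglongrightarrow> complex_of_real (exp (- (real d * v) * t ^ 2 / 2))"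
      proof -
        have "(\<lambda>k. real d * real k * (C * (\<bar>t / sqrt (real k)\<bar> ^ 3 + (t / sqrt (real k)) ^ 4))) \<longlonglongrightarrow> 0"
        proof -
          have "(\<lambda>k. real d * C * (\<bar>t\<bar> ^ 3 * (real k / sqrt (real k) ^ 3) + t ^ 4 * (real k / sqrt (real k) ^ 4))) \<longlonglongrightarrow>
              real d * C * (\<bar>t\<bar> ^ 3 * 0 + t ^ 4 * 0)"
            by (intro tendsto_mult tendsto_add tendsto_const; real_asymp)
          then show ?thesis by (simp add: power_divide abs_divide algebra_simps)
        qed
        moreover have "eventually (\<lambda>k. norm (h (t / sqrt (real k)) ^ (d * k) - exp (- (real d * v) * t ^ 2 / 2))
            \<le> real d * real k * (C * (\<bar>t / sqrt (real k)\<bar> ^ 3 + (t / sqrt (real k)) ^ 4))) sequentially"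
          using eventually_gt_at_top[of 0]
        proof eventually_elim
          case (elim k)
          define \<theta> where "\<theta> = t / sqrt (real k)"
          have "exp (- (real d * v) * t ^ 2 / 2) = exp (- v * \<theta> ^ 2 / 2) ^ (d * k)"
            using elim by (simp add: \<theta>_def power_divide flip: exp_of_nat_mult)
          then have "norm (h \<theta> ^ (d * k) - exp (- (real d * v) * t ^ 2 / 2)) =
              norm (h \<theta> ^ (d * k) - complex_of_real (exp (- v * \<theta> ^ 2 / 2)) ^ (d * k))" by simp
          also have "\<dots> \<le> real (d * k) * norm (h \<theta> - complex_of_real (exp (- v * \<theta> ^ 2 / 2)))"
            using var(2) by (intro norm_power_diff h1) (auto simp: norm_of_real)
          also have "\<dots> \<le> real (d * k) * (C * (\<bar>\<theta>\<bar> ^ 3 + \<theta> ^ 4))"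
            unfolding h_def by (intro mult_left_mono C) auto
          finally show ?case by (simp add: \<theta>_def)
        qed
        ultimately show ?thesis by (subst Lim_null) (rule Lim_null_comparison)
      qed
      ultimately have "(\<lambda>k. cf (t / sqrt (real k)) ^ e * h (t / sqrt (real k)) ^ (d * k)) \<longlonglongrightarrow>
          1 ^ e * complex_of_real (exp (- (real d * v) * t ^ 2 / 2))" by (rule tendsto_mult)
      moreover have "eventually (\<lambda>k. cf (t / sqrt (real k)) ^ e * h (t / sqrt (real k)) ^ (d * k) = s k t) sequentially"
      proof -
        have "eventually (\<lambda>k. \<bar>t / sqrt (real k)\<bar> < pi) sequentially"
          using tendsto_rabs[OF th0] by (intro order_tendstoD) auto
        with eventually_gt_at_top[of 0] show ?thesis
        proof eventually_elim
          case (elim k)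
          then have "- pi \<le> t / sqrt (real k) \<and> t / sqrt (real k) \<le> pi" by linarith
          with elim show ?case by (simp add: s_def)
        qed
      qed
      ultimately show "(\<lambda>k. s k t) \<longlonglongrightarrow> complex_of_real (exp (- (real d * v) * t ^ 2 / 2))"
        using Lim_transform_eventually by force
    qed
  qed
  also have "(\<integral>t. complex_of_real (exp (- (real d * v) * t ^ 2 / 2)) \<partial>lborel) = complex_of_real (sqrt (2 * pi / (real d * v)))"
    using has_integral_gaussian[of "real d * v"] d var(2) by (simp add: has_bochner_integral_iff)
  finally have "(\<lambda>k. integral\<^sup>L lborel (s k)) \<longlonglongrightarrow> complex_of_real (sqrt (2 * pi / (real d * v)))" .
  moreover have "eventually (\<lambda>k. integral\<^sup>L lborel (s k) = of_real (sqrt (real k) * (2 * pi * (\<psi> ^ (e + d * k)) $ k))) sequentially"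
    using eventually_gt_at_top[of 0] by eventually_elim (rule integral_s)
  ultimately have "(\<lambda>k. complex_of_real (sqrt (real k) * (2 * pi * (\<psi> ^ (e + d * k)) $ k))) \<longlonglongrightarrow> complex_of_real (sqrt (2 * pi / (real d * v)))"
    by (rule Lim_transform_eventually)
  then have "(\<lambda>k. sqrt (real k) * (2 * pi * (\<psi> ^ (e + d * k)) $ k)) \<longlonglongrightarrow> sqrt (2 * pi / (real d * v))"
    by (simp only: tendsto_of_real_iff)
  then have "(\<lambda>k. (sqrt (real k) * (2 * pi * (\<psi> ^ (e + d * k)) $ k)) / (2 * pi)) \<longlonglongrightarrow> sqrt (2 * pi / (real d * v)) / (2 * pi)"
    by (intro tendsto_divide) auto
  moreover have "sqrt (2 * pi / (real d * v)) / (2 * pi) = 1 / sqrt (2 * pi * real d * v)"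
  proof -
    have "2 * pi = sqrt (2 * pi) * sqrt (2 * pi)" by simp
    then show ?thesis using d var(2) by (simp add: real_sqrt_divide real_sqrt_mult field_simps)
  qed
  ultimately show ?thesis by simp
qed

end

section \<open>Moment convergence and the Airy distribution\<close>

text \<open>
  Under the growth condition the Taylor polynomials of even degree converge to the characteristic
  function at every point.  Even degrees are used because the remainder involves absolute moments.
\<close>
lemma moment_sequence_determines_distribution:
  assumes M: "real_distribution M1" "real_distribution M2"
    and m1: "\<And>r. integrable M1 (\<lambda>x. x ^ r) \<and> (\<integral>x. x ^ r \<partial>M1) = m r"
    and m2: "\<And>r. integrable M2 (\<lambda>x. x ^ r) \<and> (\<integral>x. x ^ r \<partial>M2) = m r"
    and growth: "\<And>t. (\<lambda>N. (2 * \<bar>t\<bar> ^ (2 * N) / fact (2 * N)) * m (2 * N)) \<longlonglongrightarrow> 0"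
  shows "M1 = M2"
proof (rule Levy_uniqueness[OF M], rule ext)
  fix t
  define S where "S N = (\<Sum>k\<le>2 * N. ((\<i> * complex_of_real t) ^ k / fact k) * complex_of_real (m k))" for N :: nat
  have lim: "S \<longlonglongrightarrow> char M t" if "real_distribution M" "\<And>r. integrable M (\<lambda>x. x ^ r) \<and> (\<integral>x. x ^ r \<partial>M) = m r" for M
  proof -
    have "(\<lambda>N. S N - char M t) \<longlonglongrightarrow> 0"
    proof (rule Lim_null_comparison[OF _ growth[of t]], rule always_eventually, rule allI)
      fix N
      show "norm (S N - char M t) \<le> (2 * \<bar>t\<bar> ^ (2 * N) / fact (2 * N)) * m (2 * N)"
        using real_distribution.char_approx1[OF that(1), of "2 * N" t] that(2)
        by (simp add: S_def norm_minus_commute power_abs[symmetric])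
    qed
    then show ?thesis by (simp add: LIM_zero_iff)
  qed
  show "char M1 t = char M2 t"
    by (rule LIMSEQ_unique[OF lim[OF M(1) m1] lim[OF M(2) m2]])
qed

lemma Bseq_bounded_above: "Bseq f \<Longrightarrow> \<exists>B. \<forall>n. f n \<le> B" for f :: "nat \<Rightarrow> real"
  unfolding Bseq_def by (auto intro: order_trans[OF abs_ge_self])

text \<open>
  Weak convergence only sees bounded continuous functions.  Truncation at a level \<open>K\<close> costs at most twice the
  moment of order \<open>2 * r\<close> divided by \<open>K ^ r\<close>, uniformly along the sequence, and the same bound passes
  to the limit.
\<close>
lemma weak_limit_moments:
  fixes \<mu> :: "nat \<Rightarrow> real measure"
  assumes \<mu>: "\<And>n. real_distribution (\<mu> n)" and L: "real_distribution L" "weak_conv_m \<mu> L"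
    and int: "\<And>n r. integrable (\<mu> n) (\<lambda>x. x ^ r)"
    and lim: "\<And>r. (\<lambda>n. \<integral>x. x ^ r \<partial>\<mu> n) \<longlonglongrightarrow> m r"
  shows "integrable L (\<lambda>x. x ^ r) \<and> (\<integral>x. x ^ r \<partial>L) = m r"
proof -
  interpret L: real_distribution L by fact
  interpret \<mu>: real_distribution "\<mu> n" for n by fact
  have even_nonneg: "0 \<le> x ^ (2 * r)" for x :: real and r by simp
  have "Bseq (\<lambda>n. \<integral>x. x ^ (2 * r) \<partial>\<mu> n)" for r
    using lim by (intro convergent_imp_Bseq convergentI)
  then have "\<exists>B. \<forall>n. (\<integral>x. x ^ (2 * r) \<partial>\<mu> n) \<le> B" for r
    by (intro Bseq_bounded_above)
  then obtain B where B: "\<And>r n. (\<integral>x. x ^ (2 * r) \<partial>\<mu> n) \<le> B r" by metis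
  have B0: "B r \<ge> 0" for r
  proof -
    have "0 \<le> (\<integral>x. x ^ (2 * r) \<partial>\<mu> 0)" by (rule Bochner_Integration.integral_nonneg) simp
    with B[of 0 r] show ?thesis by linarith
  qed
  have even: "integrable L (\<lambda>x. x ^ (2 * r)) \<and> (\<integral>x. x ^ (2 * r) \<partial>L) \<le> B r" for r
  proof -
    have trunc: "(\<integral>\<^sup>+x. ennreal (min (x ^ (2 * r)) (real K)) \<partial>L) \<le> ennreal (B r)" for K :: nat
    proof -
      have b: "norm (min (x ^ (2 * r)) (real K)) \<le> real K" for x :: real using even_nonneg[of x r] by simp
      have iL: "integrable L (\<lambda>x. min (x ^ (2 * r)) (real K))"
        using b by (intro L.integrable_const_bound[where B = "real K"]) auto
      have "(\<lambda>n. \<integral>x. min (x ^ (2 * r)) (real K) \<partial>\<mu> n) \<longlonglongrightarrow> (\<integral>x. min (x ^ (2 * r)) (real K) \<partial>L)"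
        by (rule weak_conv_imp_integral_bdd_continuous_conv[OF \<mu> L _ b]) (intro continuous_intros)
      moreover have "(\<integral>x. min (x ^ (2 * r)) (real K) \<partial>\<mu> n) \<le> B r" for n
      proof -
        have "integrable (\<mu> n) (\<lambda>x. min (x ^ (2 * r)) (real K))"
          using b by (intro \<mu>.integrable_const_bound[where B = "real K"]) auto
        then have "(\<integral>x. min (x ^ (2 * r)) (real K) \<partial>\<mu> n) \<le> (\<integral>x. x ^ (2 * r) \<partial>\<mu> n)"
          using int by (intro integral_mono) auto
        with B[of n r] show ?thesis by linarith
      qed
      ultimately have "(\<integral>x. min (x ^ (2 * r)) (real K) \<partial>L) \<le> B r"
        by (intro LIMSEQ_le_const2) auto
      then show ?thesis
        by (subst nn_integral_eq_integral[OF iL]) (auto intro!: ennreal_leI)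
    qed
    have "(\<integral>\<^sup>+x. ennreal (x ^ (2 * r)) \<partial>L) = (\<integral>\<^sup>+x. (SUP K. ennreal (min (x ^ (2 * r)) (real K))) \<partial>L)"
    proof (intro nn_integral_cong antisym)
      fix x :: real
      obtain K where "x ^ (2 * r) \<le> real K" using real_arch_simple by blast
      then show "ennreal (x ^ (2 * r)) \<le> (SUP K. ennreal (min (x ^ (2 * r)) (real K)))"
        by (intro SUP_upper2[of K]) auto
      show "(SUP K. ennreal (min (x ^ (2 * r)) (real K))) \<le> ennreal (x ^ (2 * r))"
        by (intro SUP_least ennreal_leI) auto
    qed
    also have "\<dots> = (SUP K. \<integral>\<^sup>+x. ennreal (min (x ^ (2 * r)) (real K)) \<partial>L)"
      by (intro nn_integral_monotone_convergence_SUP)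
         (auto simp: incseq_def le_fun_def intro!: ennreal_leI min.mono)
    also have "\<dots> \<le> ennreal (B r)" by (intro SUP_least trunc)
    finally have *: "(\<integral>\<^sup>+x. ennreal (x ^ (2 * r)) \<partial>L) \<le> ennreal (B r)" .
    then have i: "integrable L (\<lambda>x. x ^ (2 * r))"
      by (intro integrableI_nonneg) (auto simp: less_top[symmetric] top_unique)
    with * B0 show ?thesis by (simp add: nn_integral_eq_integral ennreal_le_iff)
  qed
  have iL: "integrable L (\<lambda>x. x ^ r)" for r
  proof (rule Bochner_Integration.integrable_bound)
    show "integrable L (\<lambda>x. 1 + x ^ (2 * r))" using even by auto
    have "\<bar>x ^ r\<bar> \<le> 1 + x ^ (2 * r)" for x :: real
    proof -
      have "x ^ (2 * r) = \<bar>x ^ r\<bar> ^ 2" by (simp add: power_mult[symmetric] mult.commute)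
      moreover have "\<bar>x ^ r\<bar> \<le> 1 + \<bar>x ^ r\<bar> ^ 2"
        using sum_squares_bound[of "\<bar>x ^ r\<bar>" 1] by simp
      ultimately show ?thesis by simp
    qed
    then show "AE x in L. norm (x ^ r) \<le> norm (1 + x ^ (2 * r))"
      by (auto intro!: AE_I2 simp: abs_of_nonneg[OF add_nonneg_nonneg[OF zero_le_one even_nonneg]])
  qed auto
  have "(\<integral>x. x ^ r \<partial>L) = m r"
  proof (cases "r = 0")
    case True
    have "(\<lambda>n. \<integral>x. x ^ 0 \<partial>\<mu> n) \<longlonglongrightarrow> 1" using \<mu>.prob_space by simp
    with lim[of 0] have "m 0 = 1" using LIMSEQ_unique by blast
    then show ?thesis using True L.prob_space by simp
  next
    case r: False
    \<comment> \<open>the truncated power, bounded and continuous\<close>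
    define f where "f K x = (max (- K) (min x K)) ^ r" for K x :: real
    have f_bound: "norm (f K x) \<le> K ^ r" if "K \<ge> 0" for K x
      unfolding f_def power_abs real_norm_def using that by (intro power_mono) auto
    have f_diff: "\<bar>x ^ r - f K x\<bar> \<le> 2 * x ^ (2 * r) / K ^ r" if "K > 0" for K x
    proof (cases "\<bar>x\<bar> \<le> K")
      case True
      then have "max (- K) (min x K) = x" by linarith
      then have "f K x = x ^ r" by (simp add: f_def)
      then show ?thesis using that even_nonneg[of x r] by simp
    next
      case False
      have "\<bar>f K x\<bar> \<le> K ^ r" using f_bound[of K x] that by simp
      also have "K ^ r \<le> \<bar>x\<bar> ^ r" using False that by (intro power_mono) auto
      finally have "\<bar>f K x\<bar> \<le> \<bar>x ^ r\<bar>" by (simp add: power_abs)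
      then have "\<bar>x ^ r - f K x\<bar> \<le> 2 * \<bar>x ^ r\<bar>" by linarith
      then have "\<bar>x ^ r - f K x\<bar> \<le> 2 * \<bar>x\<bar> ^ r" by (simp add: power_abs)
      also have "\<bar>x\<bar> ^ r \<le> \<bar>x\<bar> ^ r * (\<bar>x\<bar> ^ r / K ^ r)"
      proof -
        have "1 \<le> \<bar>x\<bar> ^ r / K ^ r" using \<open>K ^ r \<le> \<bar>x\<bar> ^ r\<close> that by simp
        from mult_left_mono[OF this, of "\<bar>x\<bar> ^ r"] show ?thesis by simp
      qed
      also have "\<bar>x\<bar> ^ r * (\<bar>x\<bar> ^ r / K ^ r) = x ^ (2 * r) / K ^ r"
        by (simp add: power_add[symmetric] mult_2[symmetric] power_even_abs)
      finally show ?thesis by simp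
    qed
    have approx: "\<bar>(\<integral>x. x ^ r \<partial>M) - (\<integral>x. f K x \<partial>M)\<bar> \<le> 2 * B r / K ^ r"
      if M: "real_distribution M" "\<And>r. integrable M (\<lambda>x. x ^ r)" "(\<integral>x. x ^ (2 * r) \<partial>M) \<le> B r" and K: "K > 0" for M K
    proof -
      interpret M: real_distribution M by fact
      have "f K \<in> borel_measurable borel" unfolding f_def by measurable
      then have [measurable]: "f K \<in> borel_measurable M" by simp
      have if': "integrable M (f K)"
        using f_bound[of K] K by (intro M.integrable_const_bound[where B = "K ^ r"]) auto
      have "\<bar>(\<integral>x. x ^ r \<partial>M) - (\<integral>x. f K x \<partial>M)\<bar> = \<bar>\<integral>x. x ^ r - f K x \<partial>M\<bar>"
        using M(2) if' by simp
      also have "\<dots> \<le> (\<integral>x. \<bar>x ^ r - f K x\<bar> \<partial>M)" by (rule integral_abs_bound)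
      also have "\<dots> \<le> (\<integral>x. 2 * x ^ (2 * r) / K ^ r \<partial>M)"
        using M(2) if' K f_diff by (intro integral_mono) auto
      also have "\<dots> = 2 * (\<integral>x. x ^ (2 * r) \<partial>M) / K ^ r" by simp
      also have "\<dots> \<le> 2 * B r / K ^ r" using M(3) K by (intro divide_right_mono mult_left_mono) auto
      finally show ?thesis .
    qed
    have "\<bar>(\<integral>x. x ^ r \<partial>L) - m r\<bar> \<le> 4 * B r / K ^ r" if K: "K > 0" for K
    proof -
      have cv: "(\<lambda>n. \<integral>x. f K x \<partial>\<mu> n) \<longlonglongrightarrow> (\<integral>x. f K x \<partial>L)"
        by (rule weak_conv_imp_integral_bdd_continuous_conv[OF \<mu> L _ f_bound])
           (use K in \<open>auto simp: f_def intro!: continuous_intros\<close>)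
      have "(\<lambda>n. \<bar>(\<integral>x. x ^ r \<partial>\<mu> n) - (\<integral>x. f K x \<partial>\<mu> n)\<bar>) \<longlonglongrightarrow> \<bar>m r - (\<integral>x. f K x \<partial>L)\<bar>"
        by (intro tendsto_intros lim cv)
      then have "\<bar>m r - (\<integral>x. f K x \<partial>L)\<bar> \<le> 2 * B r / K ^ r"
        by (rule LIMSEQ_le_const2) (use approx[OF \<mu> int B K] in blast)
      moreover have "\<bar>(\<integral>x. x ^ r \<partial>L) - (\<integral>x. f K x \<partial>L)\<bar> \<le> 2 * B r / K ^ r"
        using even by (intro approx L iL K) auto
      ultimately show ?thesis by linarith
    qed
    moreover have "((\<lambda>K. 4 * B r / K ^ r) \<longlongrightarrow> 0) at_top"
      using r by (intro tendsto_divide_0[OF tendsto_const] filterlim_at_top_imp_at_infinity filterlim_pow_at_top filterlim_ident) auto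
    ultimately have "\<bar>(\<integral>x. x ^ r \<partial>L) - m r\<bar> \<le> 0"
      by (intro tendsto_lowerbound[of "\<lambda>K. 4 * B r / K ^ r" 0 at_top]) (auto intro: eventually_mono[OF eventually_gt_at_top[of 0]])
    then show ?thesis by simp
  qed
  with iL show ?thesis by blast
qed

text \<open>
  Bounded second moments give tightness; every weak limit point has the prescribed moments, and the
  growth condition leaves one candidate.  The limit distribution is obtained, not assumed.
\<close>
theorem method_of_moments:
  fixes \<mu> :: "nat \<Rightarrow> real measure"
  assumes \<mu>: "\<And>n. real_distribution (\<mu> n)"
    and int: "\<And>n r. integrable (\<mu> n) (\<lambda>x. x ^ r)"
    and lim: "\<And>r. (\<lambda>n. \<integral>x. x ^ r \<partial>\<mu> n) \<longlonglongrightarrow> m r"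
    and growth: "\<And>t. (\<lambda>N. (2 * \<bar>t\<bar> ^ (2 * N) / fact (2 * N)) * m (2 * N)) \<longlonglongrightarrow> 0"
  obtains L where "real_distribution L" "weak_conv_m \<mu> L"
    "\<And>r. integrable L (\<lambda>x. x ^ r) \<and> (\<integral>x. x ^ r \<partial>L) = m r"
proof -
  interpret \<mu>: real_distribution "\<mu> n" for n by fact
  have tight: "tight \<mu>"
    unfolding tight_def
  proof (intro conjI allI impI \<mu>)
    fix \<epsilon> :: real assume "\<epsilon> > 0"
    have "Bseq (\<lambda>n. \<integral>x. x ^ 2 \<partial>\<mu> n)" using lim by (intro convergent_imp_Bseq convergentI)
    then obtain B where B: "B > 0" "\<And>n. (\<integral>x. x ^ 2 \<partial>\<mu> n) \<le> B"
      unfolding Bseq_def by (auto intro: order_trans[OF abs_ge_self])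
    \<comment> \<open>then Chebyshev bounds the mass outside \<open>{- a<..a}\<close> by \<open>\<epsilon> / 2\<close>\<close>
    define a where "a = sqrt (2 * B / \<epsilon>)"
    have a: "a > 0" "a ^ 2 = 2 * B / \<epsilon>" using B \<open>\<epsilon> > 0\<close> by (auto simp: a_def)
    have "measure (\<mu> n) {- a<..a} > 1 - \<epsilon>" for n
    proof -
      have "measure (\<mu> n) {x \<in> space (\<mu> n). a \<le> \<bar>x\<bar>} \<le> (\<integral>x. x ^ 2 \<partial>\<mu> n) / a ^ 2"
        using \<mu>.second_moment_method[of "\<lambda>x. x" n a] int[of n 2] a \<open>\<epsilon> > 0\<close> B(1) by simp
      also have "\<dots> \<le> B / a ^ 2" by (intro divide_right_mono B zero_le_power2)
      also have "\<dots> < \<epsilon>" unfolding a(2) using B \<open>\<epsilon> > 0\<close> by simp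
      finally have 1: "measure (\<mu> n) {x \<in> space (\<mu> n). a \<le> \<bar>x\<bar>} < \<epsilon>" .
      have "1 - measure (\<mu> n) {x \<in> space (\<mu> n). a \<le> \<bar>x\<bar>} = measure (\<mu> n) (space (\<mu> n) - {x \<in> space (\<mu> n). a \<le> \<bar>x\<bar>})"
        by (subst \<mu>.prob_compl) auto
      also have "\<dots> \<le> measure (\<mu> n) {- a<..a}"
        by (intro \<mu>.finite_measure_mono) auto
      finally show ?thesis using 1 by linarith
    qed
    then show "\<exists>a b. a < b \<and> (\<forall>n. 1 - \<epsilon> < measure (\<mu> n) {a<..b})"
      using a by (intro exI[of _ "- a"] exI[of _ a]) auto
  qed
  have moments: "integrable \<nu> (\<lambda>x. x ^ r) \<and> (\<integral>x. x ^ r \<partial>\<nu>) = m r"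
    if "strict_mono s" "real_distribution \<nu>" "weak_conv_m (\<mu> \<circ> s) \<nu>" for s \<nu> r
  proof (rule weak_limit_moments[OF _ that(2,3)])
    show "(\<lambda>n. \<integral>x. x ^ r \<partial>(\<mu> \<circ> s) n) \<longlonglongrightarrow> m r" for r
      using LIMSEQ_subseq_LIMSEQ[OF lim that(1)] by (simp add: comp_def)
  qed (auto simp: \<mu> int)
  obtain s L where sL: "strict_mono s" "real_distribution L" "weak_conv_m (\<mu> \<circ> id \<circ> s) L"
    using tight_imp_convergent_subsubsequence[OF tight strict_mono_id] by metis
  have mL: "integrable L (\<lambda>x. x ^ r) \<and> (\<integral>x. x ^ r \<partial>L) = m r" for r
    using sL by (intro moments[of s]) auto
  have "weak_conv_m \<mu> L"
  proof (rule tight_subseq_weak_converge[OF \<mu> sL(2) tight])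
    fix s' \<nu> assume s': "strict_mono s'" "real_distribution \<nu>" "weak_conv_m (\<mu> \<circ> s') \<nu>"
    have "\<nu> = L"
      by (rule moment_sequence_determines_distribution[OF s'(2) sL(2) moments[OF s'] mL growth])
    with s' show "weak_conv_m (\<mu> \<circ> s') L" by simp
  qed
  with sL mL that show thesis by blast
qed

text \<open>
  The moments of the Airy distribution, completed by the total mass \<open>1\<close> at order \<open>0\<close>, where \<open>airy_C\<close> has
  a dummy value.
\<close>
definition airy_moment :: "nat \<Rightarrow> real" where
  "airy_moment r = (if r = 0 then 1 else 2 * sqrt pi / Gamma ((3 * real r - 1) / 2) * airy_C r)"

lemma airy_C_1: "airy_C 1 = 1 / 2"
  by (simp add: airy_C.simps)

lemma airy_C_rec:
  assumes "r \<ge> 2"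
  shows "2 * airy_C r = (3 * real r - 4) * real r * airy_C (r - 1)
            + (\<Sum>j\<in>{1..r-1}. real (r choose j) * airy_C j * airy_C (r - j))"
  using assms by (subst airy_C.simps) auto

text \<open>
  Dividing by \<open>r!\<close> turns the binomial convolution in the recursion for \<open>airy_C\<close> into an ordinary one.
\<close>
definition airy_c :: "nat \<Rightarrow> real" where
  "airy_c r = airy_C r / fact r"

lemma airy_c_rec:
  assumes "r \<ge> 2"
  shows "2 * airy_c r = (3 * real r - 4) * airy_c (r - 1) + (\<Sum>j\<in>{1..r-1}. airy_c j * airy_c (r - j))"
proof -
  have "(\<Sum>j\<in>{1..r-1}. airy_c j * airy_c (r - j)) =
        (\<Sum>j\<in>{1..r-1}. real (r choose j) * airy_C j * airy_C (r - j)) / fact r"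
    unfolding sum_divide_distrib airy_c_def
    by (intro sum.cong refl) (auto simp: binomial_fact field_simps)
  moreover have "airy_c (r - 1) = real r * airy_C (r - 1) / fact r"
    using assms by (simp add: airy_c_def fact_reduce[of r])
  moreover have "2 * airy_c r = (3 * real r - 4) * (real r * airy_C (r - 1) / fact r) +
      (\<Sum>j\<in>{1..r-1}. real (r choose j) * airy_C j * airy_C (r - j)) / fact r"
  proof -
    have "2 * airy_c r = 2 * airy_C r / fact r" by (simp add: airy_c_def)
    also have "\<dots> = ((3 * real r - 4) * real r * airy_C (r - 1)
            + (\<Sum>j\<in>{1..r-1}. real (r choose j) * airy_C j * airy_C (r - j))) / fact r"
      by (simp only: airy_C_rec[OF assms])
    finally show ?thesis by (simp add: add_divide_distrib)
  qed
  ultimately show ?thesis by simp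
qed

text \<open>
  The bound is chosen so that each of the \<open>r - 1\<close> terms of the convolution is at most
  \<open>3 ^ r * (r - 2)!\<close>; the factor \<open>3\<close> absorbs the linear term.
\<close>
lemma airy_c_bounds:
  assumes "r \<ge> 1"
  shows "0 \<le> airy_c r \<and> airy_c r \<le> 3 ^ r * fact (r - 1)"
  using assms
proof (induction r rule: less_induct)
  case (less r)
  show ?case
  proof (cases "r = 1")
    case True
    then show ?thesis using airy_C_1 by (simp add: airy_c_def)
  next
    case False
    with less.prems have r: "r \<ge> 2" by simp
    have IH: "0 \<le> airy_c j" "airy_c j \<le> 3 ^ j * fact (j - 1)" if "1 \<le> j" "j < r" for j
      using less.IH[of j] that by auto
    have f: "real (r - 1) * fact (r - 2) = (fact (r - 1) :: real)"
      using r fact_reduce[of "r - 1", where 'a = real] by (simp add: numeral_2_eq_2)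
    have "2 * airy_c r \<ge> 0"
      unfolding airy_c_rec[OF r] using r IH by (intro add_nonneg_nonneg sum_nonneg mult_nonneg_nonneg) auto
    moreover have "2 * airy_c r \<le> 2 * (3 ^ r * fact (r - 1))"
    proof -
      have "(3 * real r - 4) * airy_c (r - 1) \<le> (3 * real (r - 1)) * (3 ^ (r - 1) * fact (r - 1 - 1))"
        using r IH[of "r - 1"] by (intro mult_mono) (auto simp: of_nat_diff)
      also have "\<dots> = 3 ^ r * (real (r - 1) * fact (r - 2))"
        using r power_Suc[of "3::real" "r - 1"] by (simp add: numeral_2_eq_2)
      finally have 1: "(3 * real r - 4) * airy_c (r - 1) \<le> 3 ^ r * fact (r - 1)" unfolding f .
      have "(\<Sum>j\<in>{1..r-1}. airy_c j * airy_c (r - j)) \<le> (\<Sum>j\<in>{1..r-1}. 3 ^ r * fact (r - 2))"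
      proof (intro sum_mono)
        fix j assume j: "j \<in> {1..r-1}"
        have "airy_c j * airy_c (r - j) \<le> (3 ^ j * fact (j - 1)) * (3 ^ (r - j) * fact (r - j - 1))"
          using j IH[of j] IH[of "r - j"] by (intro mult_mono) auto
        also have "\<dots> = 3 ^ r * (fact (j - 1) * fact (r - j - 1))"
        proof -
          have "r = j + (r - j)" using j by auto
          then have "(3::real) ^ r = 3 ^ j * 3 ^ (r - j)" by (metis power_add)
          then show ?thesis by (simp only: mult_ac)
        qed
        also have "fact (j - 1) * fact (r - j - 1) \<le> (fact (r - 2) :: real)"
        proof -
          have "j - 1 + (r - j - 1) = r - 2" using j by auto
          then have "fact (j - 1) * fact (r - j - 1) dvd (fact (r - 2) :: nat)"
            using fact_fact_dvd_fact[of "j - 1" "r - j - 1"] by metis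
          then have "fact (j - 1) * fact (r - j - 1) \<le> (fact (r - 2) :: nat)" by (rule dvd_imp_le) simp
          then have "real (fact (j - 1) * fact (r - j - 1)) \<le> real (fact (r - 2))" by (rule of_nat_mono)
          then show ?thesis by simp
        qed
        finally show "airy_c j * airy_c (r - j) \<le> 3 ^ r * fact (r - 2)" by simp
      qed
      also have "\<dots> = 3 ^ r * fact (r - 1)" unfolding f[symmetric] using r by simp
      finally show ?thesis unfolding airy_c_rec[OF r] using 1 by linarith
    qed
    ultimately show ?thesis by simp
  qed
qed

text \<open>
  By \<open>airy_c_bounds\<close> the moment of order \<open>2 * N\<close>, divided by \<open>(2 * N)!\<close>, is at most a geometric term times
  \<open>(2 * N - 1)! / Gamma (3 * N - 1 / 2)\<close>, and the quotient is at most \<open>1 / (N - 1)!\<close>.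
\<close>
lemma airy_moment_growth: "(\<lambda>N. (2 * \<bar>t\<bar> ^ (2 * N) / fact (2 * N)) * airy_moment (2 * N)) \<longlonglongrightarrow> 0"
proof (rule Lim_null_comparison)
  have "(\<lambda>N. ((3 * t) ^ 2) ^ N / fact N) \<longlonglongrightarrow> 0"
    using summable_exp_generic[of "(3 * t) ^ 2"] by (intro summable_LIMSEQ_zero) (simp add: field_simps)
  then have "(\<lambda>N. ((3 * t) ^ 2) ^ (N - 1) / fact (N - 1)) \<longlonglongrightarrow> 0"
    by (rule filterlim_compose) (rule filterlim_minus_const_nat_at_top)
  from tendsto_mult_left[OF this, of "4 * sqrt pi * (3 * t) ^ 2"]
  show "(\<lambda>N. 4 * sqrt pi * (3 * t) ^ 2 * (((3 * t) ^ 2) ^ (N - 1) / fact (N - 1))) \<longlonglongrightarrow> 0" by simp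
  show "eventually (\<lambda>N. norm ((2 * \<bar>t\<bar> ^ (2 * N) / fact (2 * N)) * airy_moment (2 * N)) \<le>
      4 * sqrt pi * (3 * t) ^ 2 * (((3 * t) ^ 2) ^ (N - 1) / fact (N - 1))) sequentially"
    using eventually_gt_at_top[of 0]
  proof eventually_elim
    case (elim N)
    define G where "G = Gamma ((3 * real (2 * N) - 1) / 2)"
    have "fact (3 * N - 2) \<le> G"
    proof -
      have "Gamma (real (Suc (3 * N - 2))) \<le> G" unfolding G_def
        using elim by (intro less_imp_le Gamma_real_strict_mono) auto
      then show ?thesis unfolding of_nat_Suc Gamma_fact .
    qed
    have "fact (2 * N - 1) * fact (N - 1) \<le> (fact (3 * N - 2) :: real)"
    proof -
      have "2 * N - 1 + (N - 1) = 3 * N - 2" using elim by auto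
      then have "fact (2 * N - 1) * fact (N - 1) dvd (fact (3 * N - 2) :: nat)"
        using fact_fact_dvd_fact[of "2 * N - 1" "N - 1"] by metis
      then have "fact (2 * N - 1) * fact (N - 1) \<le> (fact (3 * N - 2) :: nat)" by (rule dvd_imp_le) simp
      then have "real (fact (2 * N - 1) * fact (N - 1)) \<le> real (fact (3 * N - 2))" by (rule of_nat_mono)
      then show ?thesis by simp
    qed
    with \<open>fact (3 * N - 2) \<le> G\<close> have G: "fact (2 * N - 1) * fact (N - 1) \<le> G" by linarith
    have G0: "G > 0" using G by (rule less_le_trans[rotated]) simp
    have c: "0 \<le> airy_c (2 * N)" "airy_c (2 * N) \<le> 3 ^ (2 * N) * fact (2 * N - 1)"
      using airy_c_bounds[of "2 * N"] elim by auto
    have eq: "(2 * \<bar>t\<bar> ^ (2 * N) / fact (2 * N)) * airy_moment (2 * N) = 4 * sqrt pi * t ^ (2 * N) * (airy_c (2 * N) / G)"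
      using elim by (simp add: airy_moment_def G_def airy_c_def power_even_abs)
    have "airy_c (2 * N) / G \<le> (3 ^ (2 * N) * fact (2 * N - 1)) / (fact (2 * N - 1) * fact (N - 1))"
      using c G G0 by (intro frac_le) auto
    also have "\<dots> = 3 ^ (2 * N) / fact (N - 1)" by simp
    finally have "4 * sqrt pi * t ^ (2 * N) * (airy_c (2 * N) / G) \<le> 4 * sqrt pi * t ^ (2 * N) * (3 ^ (2 * N) / fact (N - 1))"
      by (intro mult_left_mono) auto
    also have "\<dots> = 4 * sqrt pi * (3 * t) ^ 2 * (((3 * t) ^ 2) ^ (N - 1) / fact (N - 1))"
    proof -
      have "(3 * t) ^ (2 * N) = (3 * t) ^ 2 * ((3 * t) ^ 2) ^ (N - 1)"
        unfolding power_mult using power_minus_mult[OF elim, of "(3 * t) ^ 2"] by (simp only: mult.commute)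
      then show ?thesis by (simp only: power_mult_distrib times_divide_eq_right mult_ac)
    qed
    finally show ?case unfolding eq using c G0 by (simp add: abs_mult)
  qed
qed

theorem airy_distribution_unique:
  assumes "real_distribution L" "\<And>r. integrable L (\<lambda>x. x ^ r) \<and> (\<integral>x. x ^ r \<partial>L) = airy_moment r"
  shows "airy_distribution = L"
  unfolding airy_distribution_def
proof (rule the_equality)
  show "real_distribution L \<and> has_airy_moments L"
    using assms by (auto simp: has_airy_moments_def airy_moment_def)
next
  fix M assume M: "real_distribution M \<and> has_airy_moments M"
  then interpret M: real_distribution M by simp
  have "integrable M (\<lambda>x. x ^ r) \<and> (\<integral>x. x ^ r \<partial>M) = airy_moment r" for r
  proof (cases "r = 0")
    case True
    then show ?thesis using M.prob_space by (simp add: airy_moment_def)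
  next
    case False
    then have "r \<ge> 1" by simp
    then show ?thesis using M by (auto simp: has_airy_moments_def airy_moment_def)
  qed
  then show "M = L"
    using moment_sequence_determines_distribution[OF _ assms(1) _ assms(2) airy_moment_growth] M by blast
qed

section \<open>Moments of the number of inversions under critical weights\<close>

text \<open>
  A quantitative form of the strict convexity of \<open>s \<mapsto> s ^ l\<close> at \<open>s = 1\<close>.
\<close>
lemma bernoulli_quadratic:
  assumes "(s::real) \<ge> 0" "l \<ge> 2"
  shows "s ^ l \<ge> 1 + real l * (s - 1) + (s - 1) ^ 2"
  using assms(2)
proof (induction l rule: dec_induct)
  case base
  then show ?case by (simp add: power2_eq_square algebra_simps)
next
  case (step l)
  have "1 + real (Suc l) * (s - 1) + (s - 1) ^ 2 \<le> s * (1 + real l * (s - 1) + (s - 1) ^ 2)"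
  proof -
    have "s * (1 + real l * (s - 1) + (s - 1) ^ 2) - (1 + real (Suc l) * (s - 1) + (s - 1) ^ 2) =
       (s - 1) ^ 2 * (real l + (s - 1))" by (simp add: power2_eq_square algebra_simps)
    also have "\<dots> \<ge> 0" using step.hyps assms(1) by (intro mult_nonneg_nonneg) auto
    finally show ?thesis by simp
  qed
  also have "\<dots> \<le> s * s ^ l" using step.IH assms(1) by (intro mult_left_mono) auto
  finally show ?case by simp
qed

text \<open>
  A critical offspring distribution with span \<open>d\<close>.  Since the mean is \<open>1\<close>, the second factorial moment
  \<open>v\<close> is also the variance.
\<close>
locale critical_offspring =
  fixes p :: "nat \<Rightarrow> real" and d :: nat and v :: real
  assumes p_nonneg: "p l \<ge> 0" and p_0: "p 0 > 0"
    and d_def: "d = Gcd {l. p l > 0}" and d_pos: "d > 0"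
    and p_sums: "p sums 1"
    and p_mean: "(\<lambda>l. real l * p l) sums 1"
    and p_var: "(\<lambda>l. real l * (real l - 1) * p l) sums v" and v_pos: "v > 0"
    and p_moments: "summable (\<lambda>l. real l ^ j * p l)"
begin

definition psi :: "real fps" where "psi = Abs_fps (\<lambda>m. p (d * m))"

text \<open>
  \<open>mgf $ r\<close> is the generating function of the moments of order \<open>r\<close>, divided by \<open>r!\<close>, in the variable
  counting \<open>k\<close> where the size is \<open>k * d + 1\<close>; its term of order \<open>0\<close> gives the total weights.
\<close>
abbreviation mgf :: "real fps fps" where "mgf \<equiv> moment_gf p d"
abbreviation T :: "real fps" where "T \<equiv> mgf $ 0"

lemma p_support: "p l \<noteq> 0 \<Longrightarrow> d dvd l"
  using p_nonneg[of l] unfolding d_def by (intro Gcd_dvd) auto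

text \<open>
  Sums over the offspring distribution may be reindexed by the multiples of \<open>d\<close>.
\<close>
lemma sums_support:
  assumes "\<And>l. p l = 0 \<Longrightarrow> f l = 0"
  shows "(\<lambda>m. f (d * m)) sums S \<longleftrightarrow> f sums S"
proof (rule sums_mono_reindex)
  show "strict_mono (\<lambda>m. d * m)" using d_pos by (auto simp: strict_mono_def)
  fix n assume "n \<notin> range (\<lambda>m. d * m)"
  then have "\<not> d dvd n" by (auto simp: dvd_def)
  with p_support have "p n = 0" by blast
  then show "f n = 0" by (rule assms)
qed

sublocale lattice_distribution psi
proof
  show "psi $ m \<ge> 0" for m by (simp add: psi_def p_nonneg)
  show "(\<lambda>m. psi $ m) sums 1" using sums_support[of p] p_sums by (simp add: psi_def)
qed

lemma psi_mean: "(\<lambda>m. real m * psi $ m) sums (1 / real d)"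
proof -
  have "(\<lambda>m. real (d * m) * p (d * m)) sums 1"
    using sums_support[of "\<lambda>l. real l * p l"] p_mean by simp
  from sums_divide[OF this, of "real d"] show ?thesis using d_pos by (simp add: psi_def)
qed

lemma psi_var: "(\<lambda>m. (real m - 1 / real d) ^ 2 * psi $ m) sums (v / real d ^ 2)"
proof -
  have "(\<lambda>l. real l * (real l - 1) * p l - real l * p l + p l) sums (v - 1 + 1)"
    by (intro sums_add sums_diff p_var p_mean p_sums)
  moreover have "real l * (real l - 1) * p l - real l * p l + p l = (real l - 1) ^ 2 * p l" for l
    by (simp add: power2_eq_square algebra_simps)
  ultimately have "(\<lambda>l. (real l - 1) ^ 2 * p l) sums v" by simp
  then have "(\<lambda>m. (real (d * m) - 1) ^ 2 * p (d * m)) sums v"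
    using sums_support[of "\<lambda>l. (real l - 1) ^ 2 * p l"] by simp
  from sums_divide[OF this, of "real d ^ 2"]
  have "(\<lambda>m. (real (d * m) - 1) ^ 2 * p (d * m) / real d ^ 2) sums (v / real d ^ 2)" .
  moreover have "(real (d * m) - 1) ^ 2 * p (d * m) / real d ^ 2 = (real m - 1 / real d) ^ 2 * psi $ m" for m
  proof -
    have "real m - 1 / real d = (real (d * m) - 1) / real d" using d_pos by (simp add: field_simps)
    then show ?thesis by (simp add: psi_def power_divide)
  qed
  ultimately show ?thesis by simp
qed

lemma psi_third: "summable (\<lambda>m. \<bar>real m - 1 / real d\<bar> ^ 3 * psi $ m)"
proof (rule summable_comparison_test'[where N = 0])
  have "summable (\<lambda>l. real l ^ 3 * p l)" by (rule p_moments)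
  then have "(\<lambda>m. real (d * m) ^ 3 * p (d * m)) sums (\<Sum>l. real l ^ 3 * p l)"
    using sums_support[of "\<lambda>l. real l ^ 3 * p l"] by (simp add: summable_sums)
  then have "summable (\<lambda>m. real (d * m) ^ 3 * p (d * m))" by (rule sums_summable)
  then show "summable (\<lambda>m. real (d * m) ^ 3 * p (d * m) + psi $ m)"
    using sums_1 by (intro summable_add) (auto simp: sums_iff)
  fix m
  have "\<bar>real m - 1 / real d\<bar> ^ 3 \<le> real (d * m) ^ 3 + 1"
  proof (cases "m = 0")
    case True
    have "\<bar>1 / real d\<bar> ^ 3 \<le> 1" using d_pos by (intro power_le_one) auto
    then show ?thesis using True by simp
  next
    case False
    have "1 / real d \<le> 1" using d_pos by simp
    moreover have "1 \<le> real m" using False by simp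
    ultimately have "\<bar>real m - 1 / real d\<bar> \<le> real m" by (simp add: abs_le_iff)
    moreover have "m \<le> d * m" using d_pos by simp
    then have "real m \<le> real (d * m)" by linarith
    ultimately have "\<bar>real m - 1 / real d\<bar> \<le> real (d * m)" by linarith
    then have "\<bar>real m - 1 / real d\<bar> ^ 3 \<le> real (d * m) ^ 3" by (intro power_mono) auto
    then show ?thesis by linarith
  qed
  from mult_right_mono[OF this nonneg[of m]]
  show "norm (\<bar>real m - 1 / real d\<bar> ^ 3 * psi $ m) \<le> real (d * m) ^ 3 * p (d * m) + psi $ m"
    using nonneg[of m] by (simp add: abs_mult distrib_right power_abs psi_def)
qed

lemma psi_gcd: "Gcd {m. psi $ m > 0} = 1"
proof -
  have "{l. p l > 0} = (*) d ` {m. psi $ m > 0}"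
    using p_support by (force simp: psi_def dvd_def)
  then have "d = d * Gcd {m. psi $ m > 0}"
    using d_def Gcd_mult[of d "{m. psi $ m > 0}"] by simp
  then show ?thesis using d_pos by simp
qed

lemma uniform_moment_0: "uniform_moment (Suc n) 0 = 1"
  by (simp add: uniform_moment_def del: of_nat_Suc)

sublocale tree_equation psi d T
proof
  show "d > 0" by (rule d_pos)
  show "psi $ 0 \<noteq> 0" using p_0 by (simp add: psi_def)
  show "T = twisted_sum (fps_nth psi) (\<lambda>m. T ^ (d * m))"
  proof (rule fps_ext)
    fix k
    show "T $ k = twisted_sum (fps_nth psi) (\<lambda>m. T ^ (d * m)) $ k"
      by (subst moment_gf_recursion[OF d_pos p_support])
         (simp_all add: uniform_moment_0 fps_nth_power_0 psi_def twisted_sum_nth)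
  qed
qed

text \<open>
  The constant of the local limit theorem in the normalisation of \<open>coeff_order\<close>.
\<close>
definition \<kappa> :: real where "\<kappa> = sqrt (real d / (2 * v))"

lemma kappa_pos: "\<kappa> > 0" using d_pos v_pos by (simp add: \<kappa>_def)
lemma kappa_sq: "\<kappa> ^ 2 = real d / (2 * v)" using d_pos v_pos by (simp add: \<kappa>_def)

lemma lag_order: "coeff_order (1 / 2) \<kappa> (fps_nth (lag e))"
proof -
  have "(\<lambda>k. sqrt (real k) * (psi ^ (e + d * k)) $ k) \<longlonglongrightarrow> 1 / sqrt (2 * pi * real d * (v / real d ^ 2))"
    using d_pos v_pos p_0 by (intro local_limit psi_gcd psi_mean psi_var psi_third) (auto simp: psi_def)
  moreover have "(\<lambda>n. bin_coeff (1 / 2) n / real n powr (1 / 2 - 1)) \<longlonglongrightarrow> 1 / Gamma (1 / 2)"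
    by (rule bin_coeff_asymp) simp
  ultimately have "(\<lambda>k. (sqrt (real k) * (psi ^ (e + d * k)) $ k) / (bin_coeff (1 / 2) k / real k powr (1 / 2 - 1)))
      \<longlonglongrightarrow> (1 / sqrt (2 * pi * real d * (v / real d ^ 2))) / (1 / Gamma (1 / 2))"
    by (rule tendsto_divide) (simp add: Gamma_one_half_real)
  moreover have "(1 / sqrt (2 * pi * real d * (v / real d ^ 2))) / (1 / Gamma (1 / 2)) = \<kappa>"
    using d_pos v_pos
    by (simp add: \<kappa>_def Gamma_one_half_real real_sqrt_divide real_sqrt_mult power2_eq_square field_simps)
  moreover have "eventually (\<lambda>k. (sqrt (real k) * (psi ^ (e + d * k)) $ k) / (bin_coeff (1 / 2) k / real k powr (1 / 2 - 1)) =
     lag e $ k / bin_coeff (1 / 2) k) sequentially"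
    using eventually_gt_at_top[of 0]
  proof eventually_elim
    case (elim k)
    then have "sqrt (real k) * real k powr (1 / 2 - 1) = 1"
      by (simp add: powr_half_sqrt[symmetric] powr_add[symmetric])
    then show ?case by (simp add: lag_nth field_simps)
  qed
  ultimately show ?thesis unfolding coeff_order_def using Lim_transform_eventually by force
qed

lemma lag_nonneg: "lag e $ k \<ge> 0"
  by (simp add: lag_nth fps_power_nonneg[OF nonneg])

lemma T_nonneg: "T $ k \<ge> 0"
  unfolding T_nth using lag_nonneg[of 1 k] by simp

lemma T_summable: "summable (\<lambda>k. T $ k)"
proof -
  obtain K where K: "K > 0" "\<And>n. \<bar>lag 1 $ n\<bar> \<le> K * bin_coeff (1 / 2) n"
    using coeff_order_bounded[OF lag_order[of 1], of thesis] by simp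
  have "(\<lambda>n. bin_coeff (1 / 2) n / real n powr (1 / 2 - 1)) \<longlonglongrightarrow> 1 / Gamma (1 / 2)"
    by (rule bin_coeff_asymp) simp
  then have "Bseq (\<lambda>n. bin_coeff (1 / 2) n / real n powr (1 / 2 - 1))"
    by (intro convergent_imp_Bseq convergentI)
  then obtain L where L: "L > 0" "\<And>n. \<bar>bin_coeff (1 / 2) n / real n powr (1 / 2 - 1)\<bar> \<le> L"
    unfolding Bseq_def by auto
  have "summable (\<lambda>k. K * L * real k powr (- 3 / 2))"
    by (intro summable_mult) (simp add: summable_real_powr_iff)
  then show ?thesis
  proof (rule summable_comparison_test'[where N = 1])
    fix k :: nat assume k: "1 \<le> k"
    have "k \<le> d * k" using d_pos by simp
    then have kd: "real k \<le> real (d * k + 1)" by linarith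
    have "bin_coeff (1 / 2) k \<le> L * real k powr (- 1 / 2)"
      using L(2)[of k] bin_coeff_pos[of "1 / 2" k] k by (simp add: abs_divide field_simps)
    then have "K * bin_coeff (1 / 2) k \<le> K * (L * real k powr (- 1 / 2))"
      using K by (intro mult_left_mono) auto
    with K(2)[of k] lag_nonneg[of 1 k] have "lag 1 $ k \<le> K * L * real k powr (- 1 / 2)" by simp
    then have "lag 1 $ k / real (d * k + 1) \<le> K * L * real k powr (- 1 / 2) / real k"
      using lag_nonneg[of 1 k] k kd by (intro frac_le) auto
    also have "\<dots> = K * L * real k powr (- 3 / 2)"
      using k by (simp add: powr_diff[of "real k" "- 1 / 2" 1, simplified])
    finally show "norm (T $ k) \<le> K * L * real k powr (- 3 / 2)"
      unfolding T_nth using lag_nonneg[of 1 k] by simp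
  qed
qed

lemma T_power_nonneg: "(T ^ q) $ k \<ge> 0"
  by (rule fps_power_nonneg[OF T_nonneg])

lemma T_power_sums: "(\<lambda>k. (T ^ q) $ k) sums ((\<Sum>k. T $ k) ^ q)"
  using fps_power_sums[of T q] T_summable T_nonneg by simp

text \<open>
  A critical branching process dies out.  The sum \<open>Z\<close> is a fixed point of the offspring generating
  function, and a strictly convex function that touches the diagonal at \<open>1\<close> has no other fixed point.
\<close>
lemma T_sums_1: "(\<lambda>k. T $ k) sums 1"
proof -
  define Z where "Z = (\<Sum>k. T $ k)"
  have Z: "(\<lambda>k. T $ k) sums Z" unfolding Z_def by (rule summable_sums[OF T_summable])
  have Z0: "Z \<ge> 0" unfolding Z_def by (intro suminf_nonneg T_summable T_nonneg)
  have "(\<lambda>m. psi $ m * Z ^ (d * m)) sums Z"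
    using Z T_eq twisted_sum_sums[of "fps_nth psi" "\<lambda>m. T ^ (d * m)" "\<lambda>m. Z ^ (d * m)" Z]
      nonneg T_power_nonneg T_power_sums unfolding Z_def by metis
  then have "(\<lambda>l. p l * Z ^ l) sums Z"
    using sums_support[of "\<lambda>l. p l * Z ^ l"] by (simp add: psi_def)
  then have "(\<lambda>l. p l * Z ^ l - p l - real l * p l * (Z - 1)) sums (Z - 1 - 1 * (Z - 1))"
    by (intro sums_diff sums_mult2 p_sums p_mean)
  then have s: "(\<lambda>l. p l * (Z ^ l - 1 - real l * (Z - 1))) sums 0" by (simp add: algebra_simps)
  have "Z ^ l - 1 - real l * (Z - 1) \<ge> 0" for l
  proof -
    consider "l = 0" | "l = 1" | "l \<ge> 2" by linarith
    then show ?thesis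
    proof cases
      case 3
      from bernoulli_quadratic[OF Z0 3] show ?thesis using zero_le_power2[of "Z - 1"] by linarith
    qed auto
  qed
  then have nn: "p l * (Z ^ l - 1 - real l * (Z - 1)) \<ge> 0" for l using p_nonneg by simp
  have z: "p l * (Z ^ l - 1 - real l * (Z - 1)) = 0" for l
    using suminf_eq_zero_iff[OF sums_summable[OF s] nn] s by (simp add: sums_iff)
  have "\<exists>l\<ge>2. p l \<noteq> 0"
  proof (rule ccontr)
    assume "\<not> ?thesis"
    then have "p l = 0" if "l \<ge> 2" for l using that by blast
    then have "real l * (real l - 1) * p l = 0" for l
      by (cases "l \<ge> 2") (auto simp: not_le less_2_cases_iff)
    with p_var have "(\<lambda>_. 0) sums v" by simp
    with sums_unique2[OF sums_zero] v_pos show False by blast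
  qed
  then obtain l where l: "l \<ge> 2" "p l \<noteq> 0" by blast
  then have "Z ^ l - 1 - real l * (Z - 1) = 0" using z[of l] by simp
  with bernoulli_quadratic[OF Z0 l(1)] have "(Z - 1) ^ 2 \<le> 0" by linarith
  then have "Z = 1" by simp
  with Z show ?thesis by simp
qed

text \<open>
  At \<open>x = 1\<close> the series \<open>T\<close> has the value \<open>1\<close>, so \<open>Psi j\<close> sums to the binomial moment of order \<open>j\<close> of the
  offspring distribution.
\<close>
lemma Psi_sums: "(\<lambda>n. Psi j $ n) sums S \<longleftrightarrow> (\<lambda>l. real (l choose j) * p l) sums S"
proof -
  have "(\<lambda>n. Psi j $ n) sums S \<longleftrightarrow> (\<lambda>m. psi $ m * real ((d * m) choose j) * 1) sums S"
    unfolding Psi_def using T_power_sums T_sums_1 nonneg T_power_nonneg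
    by (intro twisted_sum_sums) (auto simp: sums_iff)
  also have "\<dots> \<longleftrightarrow> (\<lambda>l. real (l choose j) * p l) sums S"
    using sums_support[of "\<lambda>l. real (l choose j) * p l"] by (simp add: psi_def mult.commute)
  finally show ?thesis .
qed

lemma Psi_nonneg: "Psi j $ n \<ge> 0"
  unfolding Psi_def twisted_sum_nth by (intro sum_nonneg mult_nonneg_nonneg nonneg T_power_nonneg) auto

lemma Psi_1_sums: "(\<lambda>n. Psi 1 $ n) sums 1"
  unfolding Psi_sums using p_mean by simp

lemma Psi_2_sums: "(\<lambda>n. Psi 2 $ n) sums (v / 2)"
proof -
  have "real (l choose 2) * p l = real l * (real l - 1) * p l / 2" for l
  proof -
    have "2 * (l choose 2) = l * (l - 1)" by (cases l) (simp_all add: choose_two)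
    then have "2 * real (l choose 2) = real l * real (l - 1)" by (metis of_nat_mult of_nat_numeral)
    then have "2 * real (l choose 2) = real l * (real l - 1)" by (cases l) auto
    then show ?thesis by simp
  qed
  then show ?thesis unfolding Psi_sums using sums_divide[OF p_var, of 2] by (simp only:)
qed

lemma Psi_summable: "\<exists>S. (\<lambda>n. Psi j $ n) sums S"
proof -
  have "summable (\<lambda>l. real (l choose j) * p l)"
  proof (rule summable_comparison_test'[OF p_moments[of j], where N = 0])
    fix l
    have "real (l choose j) \<le> real l ^ j"
      by (cases "j \<le> l") (auto simp: binomial_eq_0 simp flip: of_nat_power intro: binomial_le_pow)
    then show "norm (real (l choose j) * p l) \<le> real l ^ j * p l"
      using p_nonneg by (simp add: abs_mult mult_right_mono)
  qed
  then show ?thesis unfolding Psi_sums by (auto intro: summable_sums)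
qed

text \<open>
  Separating the constant term in \<open>u\<close> allows a Taylor expansion around \<open>T\<close> that is finite in each
  order, because powers of this part start late.
\<close>
definition positive_part :: "real fps fps" where
  "positive_part = Abs_fps (\<lambda>r. if r = 0 then 0 else mgf $ r)"

text \<open>
  The coefficient of \<open>u ^ r\<close> in the series of the forests below the root.
\<close>
definition forest_gf :: "nat \<Rightarrow> real fps" where
  "forest_gf r = twisted_sum (fps_nth psi) (\<lambda>m. (mgf ^ (d * m)) $ r)"

lemma positive_part_nth: "positive_part $ r = (if r = 0 then 0 else mgf $ r)"
  by (simp add: positive_part_def)

lemma mgf_decomp: "mgf = positive_part + fps_const T"
  by (rule fps_ext) (simp add: positive_part_nth)

lemma positive_part_power_zero: "r < j \<Longrightarrow> (positive_part ^ j) $ r = 0"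
  using startsby_zero_power_prefix[of positive_part j] by (simp add: positive_part_nth)

text \<open>
  The binomial theorem for \<open>mgf = positive_part + T\<close>; the terms with \<open>j > r\<close> vanish.
\<close>
lemma mgf_power_nth: "(mgf ^ q) $ r = (\<Sum>j\<le>r. fps_const (real (q choose j)) * (T ^ (q - j) * (positive_part ^ j) $ r))"
proof -
  have "(mgf ^ q) $ r = (\<Sum>j\<le>q. of_nat (q choose j) * positive_part ^ j * fps_const T ^ (q - j)) $ r"
    unfolding binomial_ring[symmetric] by (subst mgf_decomp) (rule refl)
  also have "\<dots> = (\<Sum>j\<le>q. fps_const (real (q choose j)) * (T ^ (q - j) * (positive_part ^ j) $ r))"
    by (simp add: fps_sum_nth fps_const_power mult_ac flip: fps_of_nat)
  also have "\<dots> = (\<Sum>j\<le>max q r. fps_const (real (q choose j)) * (T ^ (q - j) * (positive_part ^ j) $ r))"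
    by (rule sum.mono_neutral_left) (auto simp: binomial_eq_0)
  also have "\<dots> = (\<Sum>j\<le>r. fps_const (real (q choose j)) * (T ^ (q - j) * (positive_part ^ j) $ r))"
    by (rule sum.mono_neutral_right) (auto simp: positive_part_power_zero)
  finally show ?thesis .
qed

lemma forest_gf_expansion: "forest_gf r = (\<Sum>j\<le>r. Psi j * (positive_part ^ j) $ r)"
proof (rule fps_ext)
  fix k
  have "forest_gf r $ k = (\<Sum>m\<le>k. \<Sum>j\<le>r. psi $ m * (real ((d * m) choose j) * (T ^ (d * m - j) * (positive_part ^ j) $ r) $ (k - m)))"
    by (simp add: forest_gf_def twisted_sum_nth mgf_power_nth fps_sum_nth sum_distrib_left)
  also have "\<dots> = (\<Sum>j\<le>r. \<Sum>m\<le>k. psi $ m * real ((d * m) choose j) * (T ^ (d * m - j) * (positive_part ^ j) $ r) $ (k - m))"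
    by (subst sum.swap) (simp add: mult.assoc)
  also have "\<dots> = (\<Sum>j\<le>r. Psi j * (positive_part ^ j) $ r) $ k"
    unfolding Psi_def twisted_sum_mult by (simp add: fps_sum_nth twisted_sum_nth)
  finally show "forest_gf r $ k = (\<Sum>j\<le>r. Psi j * (positive_part ^ j) $ r) $ k" .
qed

lemma forest_gf_0: "forest_gf 0 = T"
  using T_eq by (simp add: forest_gf_def fps_nth_power_0)

lemma mgf_recursion: "mgf $ r $ k = (\<Sum>i\<le>r. uniform_moment (k * d + 1) i * forest_gf (r - i) $ k)"
  using moment_gf_recursion[OF d_pos, of p r k] p_support by (simp add: forest_gf_def psi_def twisted_sum_nth)

text \<open>
  Everything in the recursion for \<open>mgf $ r\<close> except the term linear in \<open>mgf $ r\<close> itself.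
\<close>
definition source :: "nat \<Rightarrow> real fps" where
  "source r = Abs_fps (\<lambda>k. \<Sum>i=1..r. uniform_moment (k * d + 1) i * forest_gf (r - i) $ k) + (\<Sum>j=2..r. Psi j * (positive_part ^ j) $ r)"

lemma mgf_eq_lag_source:
  assumes "r \<ge> 1"
  shows "mgf $ r = lag 0 * source r"
proof -
  have "mgf $ r = Psi 1 * mgf $ r + source r"
  proof (rule fps_ext)
    fix k
    have "mgf $ r $ k = forest_gf r $ k + (\<Sum>i=1..r. uniform_moment (k * d + 1) i * forest_gf (r - i) $ k)"
      unfolding mgf_recursion[of r k]
      by (subst atMost_atLeast0, subst sum.atLeast_Suc_atMost) (auto simp: uniform_moment_0)
    moreover have "forest_gf r = Psi 1 * mgf $ r + (\<Sum>j=2..r. Psi j * (positive_part ^ j) $ r)"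
    proof -
      have "{..r} = insert 0 (insert 1 {2..r})" using assms by auto
      then show ?thesis unfolding forest_gf_expansion using assms by (simp add: positive_part_nth)
    qed
    ultimately show "mgf $ r $ k = (Psi 1 * mgf $ r + source r) $ k"
      by (simp add: source_def fps_sum_nth)
  qed
  then have "(1 - Psi 1) * mgf $ r = source r" by (simp add: algebra_simps)
  then have "lag 0 * source r = ((1 - Psi 1) * lag 0) * mgf $ r" by (simp add: mult_ac)
  then show ?thesis unfolding Psi_lag by simp
qed

lemma uniform_moment_1: "uniform_moment (k * d + 1) 1 = real d / 2 * real k"
proof -
  have "(\<Sum>i<Suc n. real i) = real n * real (Suc n) / 2" for n
    by (induction n) (auto simp: field_simps)
  then have "uniform_moment (Suc n) 1 = real n / 2" for n
    unfolding uniform_moment_def power_one_right fact_1 div_by_1 by (simp del: of_nat_Suc sum.lessThan_Suc)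
  from this[of "k * d"] show ?thesis by simp
qed

lemma uniform_moment_bound: "\<bar>uniform_moment (Suc n) i\<bar> \<le> real (Suc n) ^ i"
proof -
  have "(\<Sum>j<Suc n. real j ^ i / fact i) \<le> (\<Sum>j<Suc n. real (Suc n) ^ i)"
  proof (rule sum_mono)
    fix j assume "j \<in> {..<Suc n}"
    then have "real j ^ i \<le> real (Suc n) ^ i" by (intro power_mono) auto
    moreover have "real j ^ i / fact i \<le> real j ^ i / 1" by (intro divide_left_mono) auto
    ultimately show "real j ^ i / fact i \<le> real (Suc n) ^ i" by linarith
  qed
  also have "\<dots> = real (Suc n) * real (Suc n) ^ i" by simp
  finally have "(\<Sum>j<Suc n. real j ^ i / fact i) / real (Suc n) \<le> real (Suc n) ^ i"
    by (simp add: pos_divide_le_eq mult.commute del: of_nat_Suc sum.lessThan_Suc)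
  moreover have "(\<Sum>j<Suc n. real j ^ i / fact i) / real (Suc n) \<ge> 0"
    by (intro divide_nonneg_nonneg sum_nonneg) auto
  ultimately show ?thesis unfolding uniform_moment_def by linarith
qed

text \<open>
  The factors are fitted to \<open>limit_const_1\<close> and \<open>limit_const_rec\<close>: the root term fixes the base of the
  power, the quadratic term the remaining factor.
\<close>
definition limit_const :: "nat \<Rightarrow> real" where
  "limit_const r = (\<kappa> * real d / 2) ^ r * (1 / (\<kappa> * v)) * airy_c r"

lemma limit_const_1: "limit_const 1 = \<kappa> ^ 2 / 2"
  using kappa_pos v_pos kappa_sq by (simp add: limit_const_def airy_c_def airy_C_1[unfolded One_nat_def] field_simps power2_eq_square)

text \<open>
  The recursion forced by \<open>source_order\<close> and \<open>lag_order\<close>; it is the recursion of \<open>airy_c\<close> rescaled.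
\<close>
lemma limit_const_rec:
  assumes "r \<ge> 2"
  shows "limit_const r = \<kappa> * (real d / 2 * ((3 * real r - 4) / 2 * limit_const (r - 1)) + v / 2 * (\<Sum>i=1..r-1. limit_const i * limit_const (r - i)))"
proof -
  define l where "l = \<kappa> * real d / 2"
  define m where "m = 1 / (\<kappa> * v)"
  have m: "\<kappa> * v * m = 1" using kappa_pos v_pos by (simp add: m_def)
  have "(\<Sum>i=1..r-1. limit_const i * limit_const (r - i)) = (\<Sum>i=1..r-1. l ^ r * m ^ 2 * (airy_c i * airy_c (r - i)))"
  proof (intro sum.cong refl)
    fix i assume "i \<in> {1..r-1}"
    then have "r = i + (r - i)" by auto
    then have "l ^ r = l ^ i * l ^ (r - i)" by (metis power_add)
    then show "limit_const i * limit_const (r - i) = l ^ r * m ^ 2 * (airy_c i * airy_c (r - i))"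
      unfolding limit_const_def l_def[symmetric] m_def[symmetric] by (simp add: power2_eq_square mult_ac)
  qed
  then have S: "(\<Sum>i=1..r-1. limit_const i * limit_const (r - i)) = l ^ r * m ^ 2 * (\<Sum>i=1..r-1. airy_c i * airy_c (r - i))"
    by (simp only: sum_distrib_left)
  have lr: "l ^ r = l * l ^ (r - 1)" using assms by (simp add: power_eq_if)
  have "\<kappa> * (real d / 2 * ((3 * real r - 4) / 2 * limit_const (r - 1)) + v / 2 * (\<Sum>i=1..r-1. limit_const i * limit_const (r - i))) =
     l ^ r * m / 2 * ((3 * real r - 4) * airy_c (r - 1)) +
     (\<kappa> * v * m) * (l ^ r * m / 2 * (\<Sum>i=1..r-1. airy_c i * airy_c (r - i)))"
  proof -
    have "\<kappa> * (real d / 2 * X + v / 2 * W) = l * X + \<kappa> * v / 2 * W" for X W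
      by (simp add: l_def algebra_simps)
    note key = this
    have Ar: "limit_const (r - 1) = l ^ (r - 1) * m * airy_c (r - 1)" by (simp only: limit_const_def l_def m_def)
    show ?thesis
      unfolding S lr key Ar by (simp add: power2_eq_square field_simps)
  qed
  also have "\<dots> = l ^ r * m / 2 * (2 * airy_c r)"
    unfolding m airy_c_rec[OF assms] by (simp add: algebra_simps)
  also have "\<dots> = limit_const r" by (simp add: limit_const_def l_def m_def)
  finally show ?thesis ..
qed

text \<open>
  The induction hypothesis of \<open>mgf_order\<close>, as a predicate so that it can be passed to the lemmas on
  the individual terms.
\<close>
definition orders_below :: "nat \<Rightarrow> bool" where
  "orders_below r \<longleftrightarrow>
     (\<forall>s. 1 \<le> s \<longrightarrow> s < r \<longrightarrow> coeff_order ((3 * real s - 1) / 2) (limit_const s) (fps_nth (mgf $ s)))"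

lemma orders_belowD:
  "orders_below r \<Longrightarrow> 1 \<le> s \<Longrightarrow> s < r \<Longrightarrow> coeff_order ((3 * real s - 1) / 2) (limit_const s) (fps_nth (mgf $ s))"
  by (simp add: orders_below_def)

text \<open>
  Each additional factor lowers the exponent by \<open>1/2\<close>, because the factors contribute
  \<open>(3 * s - 1) / 2\<close> each with the orders \<open>s\<close> adding up.  The bound on \<open>s\<close> ensures that only
  moments covered by the hypothesis occur: \<open>j\<close> factors of positive order leave at most \<open>s - (j - 1)\<close>
  for any of them.
\<close>
lemma positive_part_power_order:
  assumes IH: "orders_below r"
  shows "1 \<le> j \<Longrightarrow> j \<le> s \<Longrightarrow> s < r + (j - 1) \<Longrightarrow> \<exists>B. coeff_order ((3 * real s - real j) / 2) B (fps_nth ((positive_part ^ j) $ s))"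
proof (induction j arbitrary: s rule: nat_induct_at_least)
  case base
  then have "positive_part $ s = mgf $ s" by (simp add: positive_part_nth)
  then show ?case using orders_belowD[OF IH, of s] base by auto
next
  case (Suc j)
  have "\<exists>B. coeff_order ((3 * real s - real (Suc j)) / 2) B (fps_nth (positive_part $ i * (positive_part ^ j) $ (s - i)))" if "i \<in> {0..s}" for i
  proof (cases "1 \<le> i \<and> j \<le> s - i")
    case False
    then have "positive_part $ i * (positive_part ^ j) $ (s - i) = 0" by (auto simp: positive_part_nth positive_part_power_zero not_le)
    then have "fps_nth (positive_part $ i * (positive_part ^ j) $ (s - i)) = (\<lambda>n. 0)" by (auto simp: fun_eq_iff)
    then show ?thesis using coeff_order_zero by auto
  next
    case True
    then have i: "1 \<le> i" "j \<le> s - i" "i < r" "s - i < r + (j - 1)" "i \<le> s" using Suc by auto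
    from Suc.IH[OF i(2,4)] obtain B where
      B: "coeff_order ((3 * real (s - i) - real j) / 2) B (fps_nth ((positive_part ^ j) $ (s - i)))" by blast
    have "coeff_order ((3 * real i - 1) / 2) (limit_const i) (fps_nth (positive_part $ i))"
      using orders_belowD[OF IH, OF i(1,3)] i(1) by (simp add: positive_part_nth)
    moreover have "1 \<le> real i" "1 \<le> real j" "real j \<le> real (s - i)"
      using i Suc.hyps by auto
    then have "0 < (3 * real i - 1) / 2" "0 < (3 * real (s - i) - real j) / 2"
      by auto
    moreover have "(3 * real s - real (Suc j)) / 2 = (3 * real i - 1) / 2 + (3 * real (s - i) - real j) / 2"
      using i by (simp add: of_nat_diff field_simps)
    ultimately have "coeff_order ((3 * real s - real (Suc j)) / 2) (limit_const i * B) (fps_nth (positive_part $ i * (positive_part ^ j) $ (s - i)))"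
      using B by (intro coeff_order_fps_mult)
    then show ?thesis by blast
  qed
  then have "\<exists>B. coeff_order ((3 * real s - real (Suc j)) / 2) B (\<lambda>n. \<Sum>i\<in>{0..s}. (positive_part $ i * (positive_part ^ j) $ (s - i)) $ n)"
    by (rule coeff_order_sum_ex)
  also have "(\<lambda>n. \<Sum>i\<in>{0..s}. (positive_part $ i * (positive_part ^ j) $ (s - i)) $ n) = fps_nth ((positive_part ^ Suc j) $ s)"
    by (simp add: fps_mult_nth fps_sum_nth fun_eq_iff)
  finally show ?case .
qed

lemma positive_part_square_order:
  assumes IH: "orders_below r"
    and r: "r \<ge> 2"
  shows "coeff_order ((3 * real r - 2) / 2) (\<Sum>i=1..r-1. limit_const i * limit_const (r - i)) (fps_nth ((positive_part ^ 2) $ r))"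
proof -
  have "coeff_order ((3 * real r - 2) / 2) (limit_const i * limit_const (r - i)) (fps_nth (positive_part $ i * positive_part $ (r - i)))" if i: "i \<in> {1..r-1}" for i
  proof -
    have i': "1 \<le> i" "i < r" "1 \<le> r - i" "r - i < r" using i r by auto
    have Yi: "positive_part $ i = mgf $ i" "positive_part $ (r - i) = mgf $ (r - i)" using i' by (auto simp: positive_part_nth)
    show ?thesis unfolding Yi
      using i' by (intro coeff_order_fps_mult[OF _ _ orders_belowD[OF IH, OF i'(1,2)] orders_belowD[OF IH, OF i'(3,4)]]) (auto simp: of_nat_diff field_simps)
  qed
  then have "coeff_order ((3 * real r - 2) / 2) (\<Sum>i=1..r-1. limit_const i * limit_const (r - i)) (\<lambda>n. \<Sum>i=1..r-1. (positive_part $ i * positive_part $ (r - i)) $ n)"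
    by (rule coeff_order_sum)
  also have "(\<lambda>n. \<Sum>i=1..r-1. (positive_part $ i * positive_part $ (r - i)) $ n) = fps_nth ((positive_part ^ 2) $ r)"
  proof
    fix n
    have "(positive_part ^ 2) $ r $ n = (\<Sum>i=0..r. (positive_part $ i * positive_part $ (r - i)) $ n)"
      by (simp add: power2_eq_square fps_mult_nth[of positive_part positive_part] fps_sum_nth)
    also have "\<dots> = (\<Sum>i=1..r-1. (positive_part $ i * positive_part $ (r - i)) $ n)"
      using r by (intro sum.mono_neutral_right) (auto simp: positive_part_nth)
    finally show "(\<Sum>i=1..r-1. (positive_part $ i * positive_part $ (r - i)) $ n) = (positive_part ^ 2) $ r $ n" ..
  qed
  finally show ?thesis .
qed

lemma Psi_positive_part_lower:
  assumes IH: "orders_below r"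
    and j: "2 \<le> j" "j \<le> s" "s < r + (j - 1)" and \<beta>: "(3 * real s - real j) / 2 < \<beta>"
  shows "coeff_order \<beta> 0 (fps_nth (Psi j * (positive_part ^ j) $ s))"
proof -
  obtain B where B: "coeff_order ((3 * real s - real j) / 2) B (fps_nth ((positive_part ^ j) $ s))"
    using positive_part_power_order[OF IH, of j s] j by auto
  obtain S where S: "(\<lambda>n. Psi j $ n) sums S" using Psi_summable by blast
  have "3 * real s - real j \<ge> 2" using j by linarith
  then have ge: "1 \<le> (3 * real s - real j) / 2" by simp
  have "coeff_order ((3 * real s - real j) / 2) (S * B) (fps_nth (Psi j * (positive_part ^ j) $ s))"
    by (rule coeff_order_fps_mult_summable[OF ge B S Psi_nonneg])
  then show ?thesis using ge \<beta> by (intro coeff_order_lower) auto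
qed

lemma forest_gf_order:
  assumes IH: "orders_below r"
    and s: "1 \<le> s" "s < r"
  shows "coeff_order ((3 * real s - 1) / 2) (limit_const s) (fps_nth (forest_gf s))"
proof -
  have "coeff_order ((3 * real s - 1) / 2) (1 * limit_const s) (fps_nth (Psi 1 * mgf $ s))"
    using s by (intro coeff_order_fps_mult_summable[OF _ orders_belowD[OF IH, OF s] Psi_1_sums Psi_nonneg]) auto
  moreover have "coeff_order ((3 * real s - 1) / 2) (\<Sum>j=2..s. 0) (\<lambda>n. \<Sum>j=2..s. (Psi j * (positive_part ^ j) $ s) $ n)"
    using s by (intro coeff_order_sum Psi_positive_part_lower[OF IH]) auto
  ultimately have "coeff_order ((3 * real s - 1) / 2) (1 * limit_const s + (\<Sum>j=2..s. 0))
     (\<lambda>n. (Psi 1 * mgf $ s) $ n + (\<Sum>j=2..s. (Psi j * (positive_part ^ j) $ s) $ n))"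
    by (rule coeff_order_add)
  also have "(\<lambda>n. (Psi 1 * mgf $ s) $ n + (\<Sum>j=2..s. (Psi j * (positive_part ^ j) $ s) $ n)) = fps_nth (forest_gf s)"
  proof -
    have "{..s} = insert 0 (insert 1 {2..s})" using s by auto
    then show ?thesis unfolding forest_gf_expansion using s by (simp add: positive_part_nth fps_sum_nth fun_eq_iff)
  qed
  finally show ?thesis by simp
qed

text \<open>
  Every power of \<open>u\<close> taken at the root gains an exponent \<open>1\<close> but loses \<open>3/2\<close> in the order of the
  remaining moment, so \<open>i \<ge> 2\<close> is negligible against \<open>i = 1\<close>.  The case \<open>i = r\<close> is separate: there the
  forest series is \<open>T\<close>, whose exponent \<open>-1/2\<close> is not positive, and a factor of the size is first
  absorbed into \<open>lag 1\<close>.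
\<close>
lemma uniform_moment_forest_gf_lower:
  assumes IH: "orders_below r"
    and i: "2 \<le> i" "i \<le> r"
  shows "coeff_order ((3 * real r - 2) / 2) 0 (\<lambda>k. uniform_moment (k * d + 1) i * forest_gf (r - i) $ k)"
proof -
  have "coeff_order ((3 * real r - 2) / 2) 0 (\<lambda>k. real (k * d + 1) ^ i * forest_gf (r - i) $ k)"
  proof (cases "i = r")
    case False
    have "1 \<le> r - i" "r - i < r" using i False by auto
    then have "1 \<le> real (r - i)" by linarith
    then have ge1: "0 < (3 * real (r - i) - 1) / 2" by simp
    have "1 \<le> r - i" "r - i < r" using i False by auto
    from coeff_order_times_linear_power[OF forest_gf_order[OF IH this] ge1, of i d] obtain B where
      B: "coeff_order ((3 * real (r - i) - 1) / 2 + real i) B (\<lambda>k. real (k * d + 1) ^ i * forest_gf (r - i) $ k)"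
      by blast
    then show ?thesis
      by (rule coeff_order_lower) (use i in \<open>auto simp: of_nat_diff field_simps\<close>)
  next
    case True
    obtain i' where i': "i = Suc i'" using i by (cases i) auto
    from coeff_order_times_linear_power[OF lag_order[of 1], of i' d] obtain B where
      B: "coeff_order (1 / 2 + real i') B (\<lambda>k. real (k * d + 1) ^ i' * lag 1 $ k)" by auto
    also have "(\<lambda>k. real (k * d + 1) ^ i' * lag 1 $ k) = (\<lambda>k. real (k * d + 1) ^ i * forest_gf (r - i) $ k)"
    proof
      fix k
      define x where "x = real (k * d + 1)"
      have "x \<noteq> 0" unfolding x_def by linarith
      moreover have "forest_gf (r - i) $ k = lag 1 $ k / x"
        using True by (simp add: forest_gf_0 T_nth x_def mult.commute[of d])
      moreover have "x ^ i = x ^ i' * x"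
        unfolding i' by (rule power_Suc2)
      ultimately show "real (k * d + 1) ^ i' * lag 1 $ k = real (k * d + 1) ^ i * forest_gf (r - i) $ k"
        unfolding x_def[symmetric] by simp
    qed
    finally show ?thesis
      by (rule coeff_order_lower) (use i i' True in auto)
  qed
  then show ?thesis
  proof (rule coeff_order_dominated)
    show "0 < (3 * real r - 2) / 2" using i by simp
    fix k
    show "\<bar>uniform_moment (k * d + 1) i * forest_gf (r - i) $ k\<bar> \<le> 1 * \<bar>real (k * d + 1) ^ i * forest_gf (r - i) $ k\<bar>"
      using uniform_moment_bound[of "k * d" i]
      by (simp add: abs_mult mult_right_mono power_abs del: of_nat_Suc)
  qed
qed

text \<open>
  Two terms have the maximal exponent: one power of \<open>u\<close> taken at the root, and the product of two
  positive-order factors, weighted with \<open>v / 2\<close>.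
\<close>
lemma source_order:
  assumes IH: "orders_below r"
    and r: "r \<ge> 2"
  shows "coeff_order ((3 * real r - 2) / 2)
     (real d / 2 * ((3 * real r - 4) / 2 * limit_const (r - 1)) + v / 2 * (\<Sum>i=1..r-1. limit_const i * limit_const (r - i))) (fps_nth (source r))"
proof -
  have r1: "1 \<le> r - 1" "r - 1 < r" using r by auto
  have "coeff_order ((3 * real (r - 1) - 1) / 2 + 1) ((3 * real (r - 1) - 1) / 2 * limit_const (r - 1))
      (\<lambda>k. real k * forest_gf (r - 1) $ k)"
    using r by (intro coeff_order_times_index forest_gf_order[OF IH r1]) auto
  moreover have "(3 * real (r - 1) - 1) / 2 = (3 * real r - 4) / 2" "(3 * real r - 4) / 2 + 1 = (3 * real r - 2) / 2"
    using r by (auto simp: of_nat_diff field_simps)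
  ultimately have "coeff_order ((3 * real r - 2) / 2) ((3 * real r - 4) / 2 * limit_const (r - 1)) (\<lambda>k. real k * forest_gf (r - 1) $ k)"
    by (simp only:)
  from coeff_order_cmult[OF this, of "real d / 2"]
  have 1: "coeff_order ((3 * real r - 2) / 2) (real d / 2 * ((3 * real r - 4) / 2 * limit_const (r - 1)))
      (\<lambda>k. uniform_moment (k * d + 1) 1 * forest_gf (r - 1) $ k)"
    unfolding uniform_moment_1 by (simp add: mult.assoc)
  have 2: "coeff_order ((3 * real r - 2) / 2) (\<Sum>i=2..r. 0) (\<lambda>k. \<Sum>i=2..r. uniform_moment (k * d + 1) i * forest_gf (r - i) $ k)"
    by (intro coeff_order_sum uniform_moment_forest_gf_lower[OF IH]) auto
  have 3: "coeff_order ((3 * real r - 2) / 2) (v / 2 * (\<Sum>i=1..r-1. limit_const i * limit_const (r - i))) (fps_nth (Psi 2 * (positive_part ^ 2) $ r))"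
    using r by (intro coeff_order_fps_mult_summable[OF _ positive_part_square_order[OF IH r] Psi_2_sums Psi_nonneg]) auto
  have 4: "coeff_order ((3 * real r - 2) / 2) (\<Sum>j=3..r. 0) (\<lambda>n. \<Sum>j=3..r. (Psi j * (positive_part ^ j) $ r) $ n)"
    by (intro coeff_order_sum Psi_positive_part_lower[OF IH]) auto
  have s12: "{1..r} = insert 1 {2..r}" "{2..r} = insert 2 {3..r}" using r by auto
  have "fps_nth (source r) = (\<lambda>k. ((uniform_moment (k * d + 1) 1 * forest_gf (r - 1) $ k) +
     (\<Sum>i=2..r. uniform_moment (k * d + 1) i * forest_gf (r - i) $ k)) +
     ((Psi 2 * (positive_part ^ 2) $ r) $ k + (\<Sum>j=3..r. (Psi j * (positive_part ^ j) $ r) $ k)))"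
  proof
    fix k
    have "source r $ k = (\<Sum>i\<in>{1..r}. uniform_moment (k * d + 1) i * forest_gf (r - i) $ k) +
       (\<Sum>j\<in>{2..r}. (Psi j * (positive_part ^ j) $ r) $ k)" by (simp add: source_def fps_sum_nth)
    also have "(\<Sum>i\<in>{1..r}. uniform_moment (k * d + 1) i * forest_gf (r - i) $ k) =
       (uniform_moment (k * d + 1) 1 * forest_gf (r - 1) $ k) + (\<Sum>i=2..r. uniform_moment (k * d + 1) i * forest_gf (r - i) $ k)"
      unfolding s12(1) by simp
    also have "(\<Sum>j\<in>{2..r}. (Psi j * (positive_part ^ j) $ r) $ k) = (Psi 2 * (positive_part ^ 2) $ r) $ k + (\<Sum>j=3..r. (Psi j * (positive_part ^ j) $ r) $ k)"
      unfolding s12(2) by simp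
    finally show "source r $ k = ((uniform_moment (k * d + 1) 1 * forest_gf (r - 1) $ k) +
     (\<Sum>i=2..r. uniform_moment (k * d + 1) i * forest_gf (r - i) $ k)) +
     ((Psi 2 * (positive_part ^ 2) $ r) $ k + (\<Sum>j=3..r. (Psi j * (positive_part ^ j) $ r) $ k))" .
  qed
  with coeff_order_add[OF coeff_order_add[OF 1 2] coeff_order_add[OF 3 4]] show ?thesis by simp
qed

lemma source_order_1: "coeff_order (1 / 2) (\<kappa> / 2) (fps_nth (source 1))"
proof -
  have "(\<lambda>k. real d / 2 * real k / (real d * real k + 1)) \<longlonglongrightarrow> 1 / 2"
    using d_pos by real_asymp
  from tendsto_mult[OF lag_order[of 1, unfolded coeff_order_def] this]
  have "(\<lambda>k. lag 1 $ k / bin_coeff (1 / 2) k * (real d / 2 * real k / (real d * real k + 1))) \<longlonglongrightarrow> \<kappa> / 2" by simp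
  moreover have "lag 1 $ k / bin_coeff (1 / 2) k * (real d / 2 * real k / (real d * real k + 1)) =
     source 1 $ k / bin_coeff (1 / 2) k" for k
  proof -
    have "source 1 $ k = uniform_moment (k * d + 1) 1 * T $ k" by (simp add: source_def forest_gf_0)
    also have "\<dots> = real d / 2 * real k * (lag 1 $ k / (real d * real k + 1))"
      unfolding uniform_moment_1 T_nth by simp
    finally show ?thesis by (simp add: mult_ac)
  qed
  ultimately show ?thesis unfolding coeff_order_def by simp
qed

text \<open>
  Multiplication by \<open>lag 0\<close> adds \<open>1/2\<close> to the exponent of the source term and a factor \<open>\<kappa>\<close> to its constant.
\<close>
theorem mgf_order: "r \<ge> 1 \<Longrightarrow> coeff_order ((3 * real r - 1) / 2) (limit_const r) (fps_nth (mgf $ r))"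
proof (induction r rule: less_induct)
  case (less r)
  show ?case
  proof (cases "r = 1")
    case True
    have "coeff_order 1 (\<kappa> * (\<kappa> / 2)) (fps_nth (lag 0 * source 1))"
      by (rule coeff_order_fps_mult[OF _ _ lag_order source_order_1]) auto
    moreover have "\<kappa> * (\<kappa> / 2) = limit_const 1" unfolding limit_const_1 by (simp add: power2_eq_square)
    ultimately show ?thesis using True mgf_eq_lag_source[of 1] by simp
  next
    case False
    with less.prems have r: "r \<ge> 2" by simp
    have below: "orders_below r" using less.IH by (auto simp: orders_below_def)
    show ?thesis
      unfolding mgf_eq_lag_source[OF less.prems] limit_const_rec[OF r]
      by (rule coeff_order_fps_mult[OF _ _ lag_order source_order[OF below r]]) (use r in \<open>auto simp: field_simps\<close>)
  qed
qed

lemma T_pos_eventually: "eventually (\<lambda>k. T $ k > 0) sequentially"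
proof -
  have "eventually (\<lambda>k. 0 < lag 1 $ k / bin_coeff (1 / 2) k) sequentially"
    using lag_order[of 1] kappa_pos unfolding coeff_order_def by (intro order_tendstoD)
  then show ?thesis
  proof eventually_elim
    case (elim k)
    then have "lag 1 $ k > 0" using bin_coeff_pos[of "1 / 2" k] by (simp add: zero_less_divide_iff)
    moreover have "real (d * k + 1) > 0" by linarith
    ultimately show ?case unfolding T_nth by (rule divide_pos_pos)
  qed
qed

text \<open>
  The quotient of the asymptotics of \<open>mgf $ r\<close> and of \<open>T\<close>.  The latter is taken from \<open>lag 1\<close>, divided by
  the size; the quotient of size and index tends to \<open>d\<close>.
\<close>
theorem moment_limit:
  assumes r: "r \<ge> 1"
  shows "(\<lambda>k. fact r * mgf $ r $ k / T $ k / (1 / sqrt (8 * v) * real (k * d + 1) powr (3 / 2)) ^ r) \<longlonglongrightarrow> airy_moment r"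
proof -
  define c where "c = 1 / sqrt (8 * v)"
  have c: "c > 0" using v_pos by (simp add: c_def)
  \<comment> \<open>the powers of \<open>k\<close> in the quotient of the two asymptotics combine with the size to powers of \<open>q k\<close>\<close>
  define q where "q k = real (k * d + 1) / real k" for k
  have q: "q \<longlonglongrightarrow> real d"
  proof -
    have "(\<lambda>k. real d + 1 / real k) \<longlonglongrightarrow> real d" by real_asymp
    moreover have "eventually (\<lambda>k. real d + 1 / real k = q k) sequentially"
      using eventually_gt_at_top[of 0] by eventually_elim (simp add: q_def field_simps)
    ultimately show ?thesis by (rule Lim_transform_eventually)
  qed
  have "(\<lambda>k. mgf $ r $ k / real k powr ((3 * real r - 1) / 2 - 1)) \<longlonglongrightarrow> limit_const r / Gamma ((3 * real r - 1) / 2)"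
    by (rule coeff_order_powr[OF mgf_order[OF r]]) (use r in simp)
  note a = this
  have b: "(\<lambda>k. lag 1 $ k / real k powr (1 / 2 - 1)) \<longlonglongrightarrow> \<kappa> / sqrt pi"
    using coeff_order_powr[OF lag_order[of 1]] by (simp add: Gamma_one_half_real)
  have "(\<lambda>k. fact r * ((mgf $ r $ k / real k powr ((3 * real r - 1) / 2 - 1)) / (lag 1 $ k / real k powr (1 / 2 - 1)))
      * (q k / (c * q k powr (3 / 2)) ^ r)) \<longlonglongrightarrow>
      fact r * ((limit_const r / Gamma ((3 * real r - 1) / 2)) / (\<kappa> / sqrt pi)) * (real d / (c * real d powr (3 / 2)) ^ r)"
    using kappa_pos c d_pos
    by (intro tendsto_mult[OF tendsto_mult_left[OF tendsto_divide[OF a b]]] tendsto_intros q) auto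
  moreover have "fact r * ((limit_const r / Gamma ((3 * real r - 1) / 2)) / (\<kappa> / sqrt pi)) * (real d / (c * real d powr (3 / 2)) ^ r) = airy_moment r"
  proof -
    have e1: "c * real d powr (3 / 2) = \<kappa> * real d / 2"
    proof -
      have "real d powr (3 / 2) = real d * sqrt (real d)"
        using d_pos powr_add[of "real d" 1 "1 / 2"] by (simp add: powr_half_sqrt)
      moreover have "sqrt (8 * v) = 2 * sqrt (2 * v)"
        using real_sqrt_mult[of 4 "2 * v"] by simp
      ultimately show ?thesis by (simp add: c_def \<kappa>_def real_sqrt_divide mult_ac)
    qed
    have e2: "(\<kappa> * real d / 2) ^ r \<noteq> 0" using kappa_pos d_pos by simp
    have e3: "sqrt pi * real d / (\<kappa> * \<kappa> * v) = 2 * sqrt pi"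
    proof -
      have d: "real d = 2 * (\<kappa> * \<kappa> * v)" using kappa_sq v_pos by (simp add: power2_eq_square field_simps)
      show ?thesis unfolding d using kappa_pos v_pos by simp
    qed
    have e4: "fact r * ((x * (1 / (\<kappa> * v)) * (airy_C r / fact r) / g) / (\<kappa> / sqrt pi)) * (real d / x) =
        sqrt pi * real d / (\<kappa> * \<kappa> * v) * airy_C r / g" if "x \<noteq> 0" for x g
      using that kappa_pos v_pos by (simp add: field_simps)
    show ?thesis
      unfolding limit_const_def airy_c_def e1 e4[OF e2] e3 using r by (simp add: airy_moment_def)
  qed
  moreover have "eventually (\<lambda>k. fact r * ((mgf $ r $ k / real k powr ((3 * real r - 1) / 2 - 1)) / (lag 1 $ k / real k powr (1 / 2 - 1)))
      * (q k / (c * q k powr (3 / 2)) ^ r) =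
      fact r * mgf $ r $ k / T $ k / (c * real (k * d + 1) powr (3 / 2)) ^ r) sequentially"
    using eventually_gt_at_top[of 0] T_pos_eventually
  proof eventually_elim
    case (elim k)
    define x where "x = real k"
    define n where "n = real (k * d + 1)"
    have x: "x > 0" and n: "n > 0" using elim by (auto simp: x_def n_def intro: add_nonneg_pos simp del: of_nat_Suc)
    have Tk: "T $ k = lag 1 $ k / n" unfolding T_nth n_def by (simp add: mult.commute)
    then have l0: "lag 1 $ k \<noteq> 0" using elim n by auto
    have 1: "x powr ((3 * real r - 1) / 2 - 1) / x powr (1 / 2 - 1) = (x powr (3 / 2)) ^ r / x"
    proof -
      have "(x powr (3 / 2)) ^ r / x = x powr (3 / 2 * real r - 1)"
        using x by (simp add: powr_realpow[symmetric] powr_powr powr_diff)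
      also have "3 / 2 * real r - 1 = ((3 * real r - 1) / 2 - 1) - (1 / 2 - 1)" by (simp add: field_simps)
      finally show ?thesis by (simp only: powr_diff)
    qed
    have 2: "q k / (c * q k powr (3 / 2)) ^ r = n * (x powr (3 / 2)) ^ r / (x * (c * n powr (3 / 2)) ^ r)"
      unfolding q_def x_def[symmetric] n_def[symmetric]
      using x n c by (simp add: powr_divide power_divide power_mult_distrib)
    have "(mgf $ r $ k / x powr ((3 * real r - 1) / 2 - 1)) / (lag 1 $ k / x powr (1 / 2 - 1)) =
        mgf $ r $ k / lag 1 $ k / (x powr ((3 * real r - 1) / 2 - 1) / x powr (1 / 2 - 1))"
      by simp
    then show ?case
      unfolding x_def[symmetric] n_def[symmetric] 1 2 Tk using x n c l0
      by (simp add: field_simps)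
  qed
  ultimately show ?thesis unfolding c_def[symmetric] using Lim_transform_eventually by force
qed

end

section \<open>From simply generated trees to critical weights\<close>

text \<open>
  The powers of \<open>\<tau>\<close> count the edges, of which there is one less than vertices; hence the factor \<open>\<tau>\<close>
  on the left.
\<close>
lemma weight_tilt:
  assumes "\<And>l. p l = \<phi> l * \<tau> ^ l / \<Phi>" "\<tau> > 0" "\<Phi> > (0::real)"
  shows "\<tau> * weight p t = weight \<phi> t * (\<tau> / \<Phi>) ^ length (labels t)"
proof (induction t)
  case (Node a ts)
  have "\<tau> ^ length ts * prod_list (map (weight p) ts) =
      prod_list (map (weight \<phi>) ts) * (\<tau> / \<Phi>) ^ length (concat (map labels ts))"
    using Node
  proof (induction ts)
    case (Cons t ts)
    have "\<tau> ^ length (t # ts) * prod_list (map (weight p) (t # ts)) =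
       (\<tau> * weight p t) * (\<tau> ^ length ts * prod_list (map (weight p) ts))" by simp
    also have "\<dots> = (weight \<phi> t * (\<tau> / \<Phi>) ^ length (labels t)) *
       (prod_list (map (weight \<phi>) ts) * (\<tau> / \<Phi>) ^ length (concat (map labels ts)))"
      using Cons by simp
    finally show ?case by (simp add: power_add mult_ac)
  qed simp
  note h = this
  have "\<tau> * weight p (Node a ts) = \<phi> (length ts) * (\<tau> / \<Phi>) * (\<tau> ^ length ts * prod_list (map (weight p) ts))"
    by (simp add: assms(1))
  also have "\<dots> = weight \<phi> (Node a ts) * (\<tau> / \<Phi>) ^ length (labels (Node a ts))"
    unfolding h by simp
  finally show ?case .
qed

lemma random_tree_tilt:
  assumes p: "\<And>l. p l = \<phi> l * \<tau> ^ l / \<Phi>" and pos: "\<tau> > 0" "\<Phi> > (0::real)"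
  shows "random_tree p n = random_tree \<phi> n"
proof -
  define C where "C = (\<tau> / \<Phi>) ^ n / \<tau>"
  have "C > 0" using pos by (simp add: C_def)
  have w: "weight p T = C * weight \<phi> T" if "T \<in> labelled_trees n" for T
    using weight_tilt[of p \<phi> \<tau> \<Phi> T, OF p pos] that pos by (simp add: C_def labelled_trees_def field_simps)
  then have "total_weight p n = C * total_weight \<phi> n"
    by (simp add: total_weight_def sum_distrib_left)
  then have eq: "weight p T / total_weight p n = weight \<phi> T / total_weight \<phi> n" if "T \<in> labelled_trees n" for T
    using w[OF that] \<open>C > 0\<close> by simp
  show ?thesis
    unfolding random_tree_def point_measure_def
    by (rule density_cong) (auto simp: eq AE_count_space)
qed

lemma finite_labelled_trees: "finite (labelled_trees n)"
  unfolding labelled_trees_eq by (rule finite_trees_on) simp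

lemma weight_nonneg: "(\<And>l. p l \<ge> 0) \<Longrightarrow> weight p t \<ge> 0"
  by (induction t) (auto intro!: mult_nonneg_nonneg prod_list_nonneg)

lemma integral_random_tree:
  fixes f :: "nat otree \<Rightarrow> real"
  assumes "\<And>l. p l \<ge> 0"
  shows "(\<integral>T. f T \<partial>random_tree p n) = (\<Sum>T\<in>labelled_trees n. weight p T * f T) / total_weight p n"
    and "integrable (random_tree p n) f"
proof -
  have nn: "weight p T / total_weight p n \<ge> 0" for T
    unfolding total_weight_def by (intro divide_nonneg_nonneg sum_nonneg weight_nonneg assms)
  show "(\<integral>T. f T \<partial>random_tree p n) = (\<Sum>T\<in>labelled_trees n. weight p T * f T) / total_weight p n"
    unfolding random_tree_def
    by (subst lebesgue_integral_point_measure_finite[OF finite_labelled_trees nn])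
       (simp add: sum_divide_distrib)
  show "integrable (random_tree p n) f"
    unfolding random_tree_def by (rule integrable_point_measure_finite[OF finite_labelled_trees])
qed

context critical_offspring
begin

text \<open>
  Where the total weight vanishes this is the null measure; that concerns finitely many \<open>k\<close> only.
\<close>
definition scaled_law :: "nat \<Rightarrow> real measure" where
  "scaled_law k = distr (random_tree p (k * d + 1)) borel
     (\<lambda>T. real (card (inversions T)) / (1 / sqrt (8 * v) * real (k * d + 1) powr (3 / 2)))"

lemma T_total_weight: "T $ k = total_weight p (k * d + 1) / fact (k * d + 1)"
  by (simp add: moment_gf_def inversion_moment_def total_weight_def)

lemma random_tree_measurable: "f \<in> measurable (random_tree p n) borel"
  by (simp add: random_tree_def measurable_point_measure_eq1)

lemma inversion_moment_eq:
  "(\<integral>T. real (card (inversions T)) ^ r \<partial>random_tree p (k * d + 1)) = fact r * mgf $ r $ k / T $ k"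
  unfolding integral_random_tree[OF p_nonneg] T_total_weight
  by (simp add: moment_gf_def inversion_moment_def sum_divide_distrib[symmetric] del: fact_Suc)

lemma scaled_law_moment:
  "integrable (scaled_law k) (\<lambda>x. x ^ r)"
  "(\<integral>x. x ^ r \<partial>scaled_law k) = fact r * mgf $ r $ k / T $ k / (1 / sqrt (8 * v) * real (k * d + 1) powr (3 / 2)) ^ r"
proof -
  show "integrable (scaled_law k) (\<lambda>x. x ^ r)"
    unfolding scaled_law_def
    by (subst integrable_distr_eq[OF random_tree_measurable]) (auto intro!: integral_random_tree p_nonneg)
  show "(\<integral>x. x ^ r \<partial>scaled_law k) = fact r * mgf $ r $ k / T $ k / (1 / sqrt (8 * v) * real (k * d + 1) powr (3 / 2)) ^ r"
    unfolding scaled_law_def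
    by (subst integral_distr[OF random_tree_measurable], measurable)
       (simp only: power_divide inversion_moment_eq[symmetric] integral_divide_zero)
qed

lemma scaled_law_real_distribution:
  assumes "T $ k > 0"
  shows "real_distribution (scaled_law k)"
proof -
  have tw: "total_weight p (k * d + 1) > 0"
    using assms unfolding T_total_weight by (simp add: zero_less_divide_iff del: fact_Suc)
  have "emeasure (random_tree p (k * d + 1)) (space (random_tree p (k * d + 1))) =
      (\<Sum>T\<in>labelled_trees (k * d + 1). ennreal (weight p T / total_weight p (k * d + 1)))"
    unfolding random_tree_def by (simp add: space_point_measure emeasure_point_measure_finite finite_labelled_trees)
  also have "\<dots> = ennreal (\<Sum>T\<in>labelled_trees (k * d + 1). weight p T / total_weight p (k * d + 1))"
    using tw by (intro sum_ennreal divide_nonneg_nonneg weight_nonneg p_nonneg) auto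
  also have "(\<Sum>T\<in>labelled_trees (k * d + 1). weight p T / total_weight p (k * d + 1)) = 1"
    using tw by (simp add: sum_divide_distrib[symmetric] total_weight_def)
  finally have "prob_space (random_tree p (k * d + 1))" by (intro prob_spaceI) simp
  then interpret prob_space "random_tree p (k * d + 1)" .
  show ?thesis unfolding scaled_law_def
    by (rule real_distribution_distr) (rule random_tree_measurable)
qed

text \<open>
  The method of moments needs probability measures, so it is applied from the index on from which the
  total weights are positive.
\<close>
theorem scaled_law_weak_conv: "weak_conv_m scaled_law airy_distribution"
proof -
  obtain K where K: "\<And>k. k \<ge> K \<Longrightarrow> T $ k > 0"
    using T_pos_eventually by (auto simp: eventually_sequentially)
  have lim: "(\<lambda>k. \<integral>x. x ^ r \<partial>scaled_law (k + K)) \<longlonglongrightarrow> airy_moment r" for r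
  proof (cases "r = 0")
    case True
    have "(\<integral>x. x ^ r \<partial>scaled_law (k + K)) = 1" for k
      using real_distribution.axioms(1)[OF scaled_law_real_distribution[OF K[of "k + K"]]] True
      by (simp add: prob_space.prob_space)
    then show ?thesis using True by (simp add: airy_moment_def)
  next
    case False
    then show ?thesis
      using LIMSEQ_ignore_initial_segment[OF moment_limit[of r], of K] by (simp add: scaled_law_moment)
  qed
  obtain L where L: "real_distribution L" "weak_conv_m (\<lambda>k. scaled_law (k + K)) L"
    "\<And>r. integrable L (\<lambda>x. x ^ r) \<and> (\<integral>x. x ^ r \<partial>L) = airy_moment r"
    using method_of_moments[of "\<lambda>k. scaled_law (k + K)", OF scaled_law_real_distribution scaled_law_moment(1) lim airy_moment_growth] K
    by auto
  have "airy_distribution = L" by (rule airy_distribution_unique[OF L(1,3)])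
  with L(2) show ?thesis
    unfolding weak_conv_m_def weak_conv_def by (auto dest!: LIMSEQ_offset)
qed

theorem mean_inversions_asymp:
  "(\<lambda>k. \<integral>T. real (card (inversions T)) \<partial>random_tree p (k * d + 1))
     \<sim>[at_top] (\<lambda>k. 1 / sqrt (8 * v) * sqrt pi * real (k * d + 1) powr (3 / 2))"
proof (rule asymp_equivI')
  have "airy_moment 1 = sqrt pi" using airy_C_1 by (simp add: airy_moment_def)
  with moment_limit[of 1] have "(\<lambda>k. fact 1 * mgf $ 1 $ k / T $ k / (1 / sqrt (8 * v) * real (k * d + 1) powr (3 / 2)) ^ 1 / sqrt pi)
      \<longlonglongrightarrow> sqrt pi / sqrt pi" by (intro tendsto_divide) auto
  moreover have "fact 1 * mgf $ 1 $ k / T $ k / (1 / sqrt (8 * v) * real (k * d + 1) powr (3 / 2)) ^ 1 / sqrt pi =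
     (\<integral>T. real (card (inversions T)) \<partial>random_tree p (k * d + 1)) / (1 / sqrt (8 * v) * sqrt pi * real (k * d + 1) powr (3 / 2))" for k
    using inversion_moment_eq[of k 1] by (simp add: mult_ac)
  ultimately show "(\<lambda>k. (\<integral>T. real (card (inversions T)) \<partial>random_tree p (k * d + 1)) /
     (1 / sqrt (8 * v) * sqrt pi * real (k * d + 1) powr (3 / 2))) \<longlonglongrightarrow> 1" by simp
qed

end

text \<open>
  Polynomial factors do not affect convergence inside the disc, by termwise differentiation.
\<close>
lemma summable_power_weight:
  fixes \<phi> :: "nat \<Rightarrow> real"
  assumes "ereal \<bar>x\<bar> < conv_radius \<phi>"
  shows "summable (\<lambda>l. real l ^ j * \<phi> l * x ^ l)"
  using assms
proof (induction j arbitrary: x)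
  case 0
  then show ?case by (simp add: summable_in_conv_radius)
next
  case (Suc j)
  obtain K where K: "\<bar>x\<bar> < K" "ereal K < conv_radius \<phi>"
    using Suc.prems ereal_dense2[of "ereal \<bar>x\<bar>"] by auto
  have "summable (\<lambda>n. diffs (\<lambda>l. real l ^ j * \<phi> l) n * x ^ n)"
  proof (rule termdiff_converges[of x K])
    fix y :: real assume "norm y < K"
    then have "ereal \<bar>y\<bar> < conv_radius \<phi>" using K(2) by (metis ereal_less(4) less_ereal.simps(1) order_less_trans real_norm_def)
    from Suc.IH[OF this] show "summable (\<lambda>n. real n ^ j * \<phi> n * y ^ n)" .
  qed (use K in auto)
  from summable_mult[OF this, of x]
  have "summable (\<lambda>n. real (Suc n) ^ Suc j * \<phi> (Suc n) * x ^ Suc n)"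
    by (simp add: diffs_def mult_ac del: of_nat_Suc)
  then show ?case by (subst (asm) summable_Suc_iff)
qed

lemma conv_radius_diffs_ge:
  fixes \<phi> :: "nat \<Rightarrow> real"
  shows "conv_radius \<phi> \<le> conv_radius (diffs \<phi>)"
proof -
  have "fps_nth (fps_deriv (Abs_fps \<phi>)) = diffs \<phi>"
    by (simp add: fun_eq_iff diffs_def)
  then show ?thesis
    using fps_conv_radius_deriv[of "Abs_fps \<phi>"] by (simp add: fps_conv_radius_def fps_nth_Abs_fps)
qed

lemma weight_gf_deriv:
  fixes \<phi> :: "nat \<Rightarrow> real"
  assumes "ereal \<bar>x\<bar> < conv_radius \<phi>"
  shows "(weight_gf \<phi> has_real_derivative weight_gf (diffs \<phi>) x) (at x)"
proof -
  obtain K where K: "\<bar>x\<bar> < K" "ereal K < conv_radius \<phi>"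
    using assms ereal_dense2[of "ereal \<bar>x\<bar>"] by auto
  have "summable (\<lambda>n. \<phi> n * K ^ n)" using K by (intro summable_in_conv_radius) auto
  from termdiffs_strong[OF this, of x] K show ?thesis by (simp add: weight_gf_def[abs_def])
qed

theorem theorem3p5:
  fixes \<phi> :: "nat \<Rightarrow> real" and \<tau> \<rho> c :: real and d :: nat
  assumes "\<And>l. \<phi> l \<ge> 0" and "\<phi> 0 > 0"
    and "conv_radius \<phi> > 0"
    and "\<tau> > 0" and "ereal \<tau> < conv_radius \<phi>"
    and "\<tau> * deriv (weight_gf \<phi>) \<tau> = weight_gf \<phi> \<tau>"
    and "\<And>t. 0 < t \<Longrightarrow> t < \<tau> \<Longrightarrow> t * deriv (weight_gf \<phi>) t \<noteq> weight_gf \<phi> t"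
    and "\<rho> = \<tau> / weight_gf \<phi> \<tau>"
    and "d = Gcd {l. \<phi> l > 0}"
    and "c = 1 / sqrt (8 * \<rho> * \<tau> * deriv (deriv (weight_gf \<phi>)) \<tau>)"
  shows "(\<lambda>k. \<integral>T. real (card (inversions T)) \<partial>random_tree \<phi> (k * d + 1))
           \<sim>[at_top] (\<lambda>k. c * sqrt pi * real (k * d + 1) powr (3 / 2))
       \<and> weak_conv_m
           (\<lambda>k. distr (random_tree \<phi> (k * d + 1)) borel
              (\<lambda>T. real (card (inversions T)) / (c * real (k * d + 1) powr (3 / 2))))
           airy_distribution"
proof -
  note nonneg = assms(1) and phi_0 = assms(2) and tau = assms(4) and radius = assms(5)
  define \<Phi> where "\<Phi> = weight_gf \<phi> \<tau>"
  have sm: "summable (\<lambda>l. real l ^ j * \<phi> l * \<tau> ^ l)" for j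
    using radius tau by (intro summable_power_weight) simp
  have Phi: "(\<lambda>l. \<phi> l * \<tau> ^ l) sums \<Phi>"
    using summable_sums[OF sm[of 0]] by (simp add: \<Phi>_def weight_gf_def)
  have "\<phi> 0 * \<tau> ^ 0 \<le> \<Phi>"
    using sum_le_suminf[of "\<lambda>l. \<phi> l * \<tau> ^ l" "{0}"] Phi nonneg tau by (auto simp: sums_iff)
  then have Phi_pos: "\<Phi> > 0" using phi_0 by simp
  define p where "p l = \<phi> l * \<tau> ^ l / \<Phi>" for l
  define v where "v = \<rho> * \<tau> * deriv (deriv (weight_gf \<phi>)) \<tau>"
  have d1: "deriv (weight_gf \<phi>) t = weight_gf (diffs \<phi>) t" if "ereal \<bar>t\<bar> < conv_radius \<phi>" for t
    by (rule DERIV_imp_deriv[OF weight_gf_deriv[OF that]])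
  have radius': "ereal \<bar>\<tau>\<bar> < conv_radius \<phi>" using radius tau by simp
  \<comment> \<open>the equation for \<open>\<tau>\<close>, read as a statement on the mean\<close>
  have mean: "(\<lambda>l. real l * (\<phi> l * \<tau> ^ l)) sums \<Phi>"
  proof -
    have s: "summable (\<lambda>l. real l * (\<phi> l * \<tau> ^ l))" using sm[of 1] by (simp add: mult.assoc)
    then have "(\<lambda>l. real (Suc l) * (\<phi> (Suc l) * \<tau> ^ Suc l)) sums (\<Sum>l. real l * (\<phi> l * \<tau> ^ l))"
      using sums_Suc_iff[of "\<lambda>l. real l * (\<phi> l * \<tau> ^ l)"] summable_sums[OF s] by simp
    then have "(\<lambda>l. diffs \<phi> l * \<tau> ^ l * \<tau>) sums (\<Sum>l. real l * (\<phi> l * \<tau> ^ l))"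
      by (simp add: diffs_def mult_ac)
    from sums_divide[OF this, of \<tau>] tau have "(\<lambda>l. diffs \<phi> l * \<tau> ^ l) sums ((\<Sum>l. real l * (\<phi> l * \<tau> ^ l)) / \<tau>)"
      by simp
    then have "weight_gf (diffs \<phi>) \<tau> = (\<Sum>l. real l * (\<phi> l * \<tau> ^ l)) / \<tau>"
      by (simp add: weight_gf_def sums_iff)
    then have "\<tau> * deriv (weight_gf \<phi>) \<tau> = (\<Sum>l. real l * (\<phi> l * \<tau> ^ l))"
      using d1[OF radius'] tau by simp
    then show ?thesis using summable_sums[OF s] assms(6) by (simp add: \<Phi>_def)
  qed
  \<comment> \<open>the second derivative of the weight series is a second factorial moment\<close>
  have var: "(\<lambda>l. real l * (real l - 1) * p l) sums v"
  proof -
    have s1: "(\<lambda>l. real l ^ 2 * \<phi> l * \<tau> ^ l - real l * (\<phi> l * \<tau> ^ l)) sums ((\<Sum>l. real l ^ 2 * \<phi> l * \<tau> ^ l) - \<Phi>)"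
      by (intro sums_diff summable_sums sm mean)
    define S where "S = (\<Sum>l. real l ^ 2 * \<phi> l * \<tau> ^ l) - \<Phi>"
    have s2: "(\<lambda>l. real l * (real l - 1) * (\<phi> l * \<tau> ^ l)) sums S"
      using s1 by (simp add: S_def power2_eq_square algebra_simps)
    then have "(\<lambda>l. real (l + 2) * (real (l + 2) - 1) * (\<phi> (l + 2) * \<tau> ^ (l + 2))) sums S"
      by (subst sums_iff_shift[of _ 2]) (simp add: numeral_2_eq_2)
    moreover have "real (l + 2) * (real (l + 2) - 1) * (\<phi> (l + 2) * \<tau> ^ (l + 2)) = diffs (diffs \<phi>) l * \<tau> ^ l * \<tau> ^ 2" for l
      by (simp add: diffs_def power2_eq_square algebra_simps)
    ultimately have "(\<lambda>l. diffs (diffs \<phi>) l * \<tau> ^ l * \<tau> ^ 2) sums S" by (simp only:)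
    from sums_divide[OF this, of "\<tau> ^ 2"] tau have "(\<lambda>l. diffs (diffs \<phi>) l * \<tau> ^ l) sums (S / \<tau> ^ 2)" by simp
    then have S: "weight_gf (diffs (diffs \<phi>)) \<tau> = S / \<tau> ^ 2" by (simp add: weight_gf_def sums_iff)
    have "deriv (deriv (weight_gf \<phi>)) \<tau> = deriv (weight_gf (diffs \<phi>)) \<tau>"
    proof (rule deriv_cong_ev)
      obtain K where K: "\<tau> < K" "ereal K < conv_radius \<phi>"
        using radius ereal_dense2[of "ereal \<tau>"] by auto
      have "eventually (\<lambda>t. t \<in> {- K<..<K}) (nhds \<tau>)"
        using K tau by (intro eventually_nhds_in_open) auto
      then show "eventually (\<lambda>t. deriv (weight_gf \<phi>) t = weight_gf (diffs \<phi>) t) (nhds \<tau>)"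
      proof eventually_elim
        case (elim t)
        then have "\<bar>t\<bar> < K" by auto
        then have "ereal \<bar>t\<bar> < ereal K" by simp
        with K(2) show ?case by (intro d1) (rule order_less_trans)
      qed
    qed simp
    also have "\<dots> = weight_gf (diffs (diffs \<phi>)) \<tau>"
      by (intro DERIV_imp_deriv weight_gf_deriv less_le_trans[OF radius' conv_radius_diffs_ge])
    finally have "v = S / \<Phi>"
      unfolding v_def S assms(8) \<Phi>_def[symmetric] using tau by (simp add: power2_eq_square)
    with sums_divide[OF s2, of \<Phi>] show ?thesis by (simp add: p_def)
  qed
  have p_nonneg: "p l \<ge> 0" for l using nonneg tau Phi_pos by (simp add: p_def)
  have p_sums: "p sums 1" using sums_divide[OF Phi, of \<Phi>] Phi_pos by (simp add: p_def[abs_def])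
  have p_mean: "(\<lambda>l. real l * p l) sums 1" using sums_divide[OF mean, of \<Phi>] Phi_pos by (simp add: p_def)
  \<comment> \<open>otherwise \<open>p\<close> lives on \<open>{0, 1}\<close> and its mean \<open>1\<close> forces \<open>p 0 = 0\<close>; this makes \<open>v\<close> and \<open>d\<close> positive\<close>
  have "\<exists>l\<ge>2. p l > 0"
  proof (rule ccontr)
    assume "\<not> ?thesis"
    then have z: "p l = 0" if "l \<ge> 2" for l using that p_nonneg[of l] by force
    have "(\<lambda>l. p l - real l * p l) sums (1 - 1)" by (intro sums_diff p_sums p_mean)
    moreover have "(\<lambda>l. p l - real l * p l) = (\<lambda>l. if l = 0 then p 0 else 0)"
    proof
      fix l :: nat
      consider "l = 0" | "l = 1" | "l \<ge> 2" by linarith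
      then show "p l - real l * p l = (if l = 0 then p 0 else 0)" by cases (auto simp: z)
    qed
    moreover have "(\<lambda>l. if l = 0 then p 0 else 0) sums p 0" using sums_single[of 0 "\<lambda>_. p 0"] by simp
    ultimately have "p 0 = 0" using sums_unique2 by fastforce
    then show False using phi_0 Phi_pos by (simp add: p_def)
  qed
  then obtain l0 where l0: "l0 \<ge> 2" "p l0 > 0" by blast
  have v_pos: "v > 0"
  proof -
    have nn: "real l * (real l - 1) * p l \<ge> 0" for l using p_nonneg by (cases l) auto
    have "0 < real l0 * (real l0 - 1) * p l0" using l0 by simp
    also have "\<dots> \<le> v" using sum_le_suminf[OF sums_summable[OF var], of "{l0}"] nn sums_unique[OF var] by simp
    finally show ?thesis .
  qed
  have pos_iff: "p l > 0 \<longleftrightarrow> \<phi> l > 0" for l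
    using tau Phi_pos by (simp add: p_def zero_less_mult_iff zero_less_divide_iff)
  interpret critical_offspring p d v
  proof
    show "d = Gcd {l. p l > 0}" using assms(9) by (simp add: pos_iff)
    then have "d dvd l0" using l0 by (auto intro: Gcd_dvd)
    then show "d > 0" using l0 by (auto intro!: Nat.gr0I)
    show "summable (\<lambda>l. real l ^ j * p l)" for j
      using summable_divide[OF sm[of j], of \<Phi>] by (simp add: p_def mult.assoc)
  qed (use p_nonneg phi_0 Phi_pos p_sums p_mean var v_pos in \<open>auto simp: pos_iff\<close>)
  have c: "c = 1 / sqrt (8 * v)" unfolding assms(10) v_def by (simp add: mult.assoc)
  have rt: "random_tree \<phi> n = random_tree p n" for n
    using random_tree_tilt[of p \<phi> \<tau> \<Phi> n] tau Phi_pos by (simp add: p_def)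
  show ?thesis
    using mean_inversions_asymp scaled_law_weak_conv
    unfolding rt c scaled_law_def[abs_def] by blast
qed

end
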